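(* Let $X=(x_0,x_1)$ be a bounded interval and $x_0<y\le x_1$. Regard $E_\alpha^{(x_0,y)}$ as a function on $\mathbb{R}$. (i) $E^{(x_0,y)}_\alpha\in L^\infty(\mathbb{R})\cap C^\infty(\mathbb{R})$ for every $\alpha\in L^1_{\mathbb{R}}(X)$, and the mapping $E^{(x_0,y)}:L^1_{\mathbb{R}}(X)\to L^\infty(\mathbb{R})$, $\alpha\mapsto E_\alpha^{(x_0,y)}$, is continuous; (ii) for every $\alpha\in L^1_{\mathbb{R}}(X)$ and $\omega\in\mathbb{R}$, $\bigl|E^{(x_0,y)}_\alpha(\omega)\bigr|\le e^{\|\alpha\|}$, where $\|\alpha\|$ is the $L^1$ norm. Let $\alpha\in L^1_{\mathbb{R}}(X)$ and set $h=E^{(x_0,y)}_\alpha-1$. Then: (iii) $\operatorname{supp}\check h\subset[0,2(y-x_0)]$ and $\check h\in L^1(\mathbb{R})$; (iv) $h(\omega)\to0$ as $|\omega|\to\infty$; (v) $h\in L^2(\mathbb{R})$ if $\alpha\in L^2(X)$.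
   Context: $L^1_{\mathbb{R}}(X)$ is the space of real-valued integrable functions on $X$. The Fourier transform is $\hat f(\omega)=\int_{-\infty}^\infty f(t)e^{i\omega t}\,dt$, extended to tempered distributions, and $\check{\ }$ denotes the inverse Fourier transform. Harmonic exponential: for $\alpha\in L^1_{\mathbb{R}}(X)$ and $\omega\in\mathbb{R}$, $$E^{(x_0,y)}_\alpha(\omega)=1+\sum_{j=1}^\infty\ \int\limits_{x_0<s_1<\cdots<s_j<y}\exp\Bigl(2i\omega\sum_{\nu=1}^j(-1)^{j-\nu}(s_\nu-x_0)\Bigr)\prod_{\nu=1}^j\alpha(s_\nu)\,ds_1\cdots ds_j .$$ Equivalently $E^{(x_0,y)}_\alpha(\omega)=(1-\mathcal{A}_\omega)^{-1}\mathbb{1}(y)$, where $\mathcal{A}_\omega f(y)=\int_{x_0}^y\alpha(x)e^{2i(x-x_0)\omega}\overline{f(x)}\,dx$ on $C(\overline X)$ and $\mathbb{1}$ is the constant function $1$. *)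

theory Defs
  imports "HOL-Analysis.Analysis" "HOL-Probability.Essential_Supremum"
begin

definition ordered_simplex :: "real \<Rightarrow> real \<Rightarrow> nat \<Rightarrow> (nat \<Rightarrow> real) set" where
  "ordered_simplex x0 y j =
     {s. s ` {1..j} \<subseteq> {x0<..<y} \<and> strict_mono_on {1..j} s}"

text \<open>
  The points of \<open>\<real>\<^sup>j\<close> are functions on \<open>{1..j}\<close>, and the integral is taken with respect to the
  product of \<open>j\<close> copies of Lebesgue measure. Each integrand is absolutely integrable when
  \<open>\<alpha>\<close> is integrable on \<open>(x0, y)\<close>; only the values of \<open>\<alpha>\<close> on \<open>(x0, y)\<close> matter.
\<close>

definition harmonic_term :: "real \<Rightarrow> real \<Rightarrow> (real \<Rightarrow> real) \<Rightarrow> real \<Rightarrow> nat \<Rightarrow> complex" where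
  "harmonic_term x0 y \<alpha> \<omega> j =
     (LINT s:ordered_simplex x0 y j | PiM {1..j} (\<lambda>_. lebesgue).
        exp (2 * \<i> * complex_of_real \<omega> *
             complex_of_real (\<Sum>\<nu>=1..j. (-1) ^ (j - \<nu>) * (s \<nu> - x0))) *
        complex_of_real (\<Prod>\<nu>=1..j. \<alpha> (s \<nu>)))"

text \<open>The \<open>j\<close>-th term is bounded by \<open>\<parallel>\<alpha>\<parallel>\<^sup>j / j!\<close>, so the series converges absolutely.\<close>

definition harmonic_exp :: "real \<Rightarrow> real \<Rightarrow> (real \<Rightarrow> real) \<Rightarrow> real \<Rightarrow> complex" where
  "harmonic_exp x0 y \<alpha> \<omega> = 1 + (\<Sum>j. harmonic_term x0 y \<alpha> \<omega> (Suc j))"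

text \<open>
  Elements of the Lebesgue spaces are represented by functions, not by classes modulo null sets.
\<close>

definition L1_norm :: "'a measure \<Rightarrow> ('a \<Rightarrow> 'b::{banach, second_countable_topology}) \<Rightarrow> real" where
  "L1_norm M f = (LINT x|M. norm (f x))"

definition L2 :: "'a measure \<Rightarrow> ('a \<Rightarrow> 'b::{banach, second_countable_topology}) set" where
  "L2 M = {f \<in> borel_measurable M. integrable M (\<lambda>x. (norm (f x))\<^sup>2)}"

definition Linf_norm :: "'a measure \<Rightarrow> ('a \<Rightarrow> 'b::{banach, second_countable_topology}) \<Rightarrow> ereal" where
  "Linf_norm M f = esssup M (\<lambda>x. ereal (norm (f x)))"

definition Linf :: "'a measure \<Rightarrow> ('a \<Rightarrow> 'b::{banach, second_countable_topology}) set" where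
  "Linf M = {f \<in> borel_measurable M. Linf_norm M f < \<infinity>}"

definition nth_deriv :: "nat \<Rightarrow> (real \<Rightarrow> complex) \<Rightarrow> real \<Rightarrow> complex" where
  "nth_deriv n f = ((\<lambda>g t. vector_derivative g (at t)) ^^ n) f"

definition smooth :: "(real \<Rightarrow> complex) \<Rightarrow> bool" where
  "smooth f \<longleftrightarrow> (\<forall>n t. nth_deriv n f differentiable (at t))"

definition schwartz :: "(real \<Rightarrow> complex) \<Rightarrow> bool" where
  "schwartz \<phi> \<longleftrightarrow> smooth \<phi> \<and> (\<forall>k n. bounded (range (\<lambda>x. x ^ k *\<^sub>R nth_deriv n \<phi> x)))"

definition test_function_on :: "real set \<Rightarrow> (real \<Rightarrow> complex) \<Rightarrow> bool" where
  "test_function_on U \<phi> \<longleftrightarrow>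
     smooth \<phi> \<and> compact (closure {x. \<phi> x \<noteq> 0}) \<and> closure {x. \<phi> x \<noteq> 0} \<subseteq> U"

text \<open>
  A tempered distribution is represented by its action on functions; only its values on
  Schwartz functions are meaningful.
\<close>

type_synonym distribution = "(real \<Rightarrow> complex) \<Rightarrow> complex"

definition regular_dist :: "(real \<Rightarrow> complex) \<Rightarrow> distribution" where
  "regular_dist f \<phi> = (LINT x|lebesgue. f x * \<phi> x)"

text \<open>
  The convention for the Fourier transform is \<open>\<integral> f(t) e\<^bsup>i\<omega>t\<^esup> dt\<close>, so the inverse transform
  carries the factor \<open>1/(2\<pi>)\<close> and the kernel \<open>e\<^bsup>-i\<omega>t\<^esup>\<close>. This kernel is symmetric in
  \<open>\<omega>\<close> and \<open>t\<close>, so the extension to distributions is by transposition.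
\<close>

definition inv_fourier :: "(real \<Rightarrow> complex) \<Rightarrow> real \<Rightarrow> complex" where
  "inv_fourier \<phi> t =
     1 / (2 * complex_of_real pi) * (LINT \<omega>|lebesgue. \<phi> \<omega> * exp (- \<i> * complex_of_real (\<omega> * t)))"

definition dist_inv_fourier :: "distribution \<Rightarrow> distribution" where
  "dist_inv_fourier T \<phi> = T (inv_fourier \<phi>)"

definition dist_supp :: "distribution \<Rightarrow> real set" where
  "dist_supp T = {t. \<forall>U. open U \<and> t \<in> U \<longrightarrow> (\<exists>\<phi>. test_function_on U \<phi> \<and> T \<phi> \<noteq> 0)}"

definition dist_in_L1 :: "distribution \<Rightarrow> bool" where
  "dist_in_L1 T \<longleftrightarrow>
     (\<exists>g. integrable lebesgue g \<and> (\<forall>\<phi>. schwartz \<phi> \<longrightarrow> T \<phi> = regular_dist g \<phi>))"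

end

theory Submission
  imports Defs "HOL-Probability.Probability"
begin

text \<open>
  Integrating over the largest variable first, the terms of the series satisfy
  \<open>T\<^sub>j\<^sub>+\<^sub>1(y) = \<integral>\<^bsub>x\<^sub>0\<^esub>\<^bsup>y\<^esup> \<alpha>(x) e\<^bsup>2i\<omega>(x - x\<^sub>0)\<^esup> cnj (T\<^sub>j(x)) dx\<close>. By induction, \<open>T\<^sub>j\<close> with \<open>j \<ge> 1\<close> is the
  Fourier transform of an integrable function supported in \<open>[0, 2(y - x\<^sub>0)]\<close> whose \<open>L\<^sup>1\<close> norm is
  at most \<open>\<parallel>\<alpha>\<parallel>\<^sup>j / j!\<close>; the sum of these functions is the inverse transform of \<open>h\<close>, and
  smoothness, decay and the support statement follow from it. For square integrability only
  \<open>T\<^sub>1\<close> needs the Plancherel inequality; the Cauchy--Schwarz inequality carries the bound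
  through the recursion.
\<close>

section \<open>Fourier transforms of integrable functions\<close>

definition fourier :: "(real \<Rightarrow> complex) \<Rightarrow> real \<Rightarrow> complex" where
  "fourier f \<omega> = (LINT t|lborel. f t * cis (\<omega> * t))"

lemma borel_measurable_cis [measurable]: "cis \<in> borel_measurable borel"
  by (intro borel_measurable_continuous_onI continuous_intros)

lemma integrable_fourier:
  assumes "integrable lborel f"
  shows "integrable lborel (\<lambda>t. f t * cis (\<omega> * t))"
proof (rule Bochner_Integration.integrable_bound[OF assms])
  have [measurable]: "f \<in> borel_measurable borel"
    using borel_measurable_integrable[OF assms] by simp
  show "(\<lambda>t. f t * cis (\<omega> * t)) \<in> borel_measurable lborel" by measurable
qed (simp add: norm_mult)

lemma norm_fourier_le: "norm (fourier f \<omega>) \<le> (LINT t|lborel. norm (f t))"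
  unfolding fourier_def
  by (rule order_trans[OF integral_norm_bound]) (simp add: norm_mult)

lemma borel_measurable_fourier [measurable]:
  assumes [measurable]: "f \<in> borel_measurable borel"
  shows "fourier f \<in> borel_measurable borel"
  unfolding fourier_def[abs_def] by measurable

lemma norm_cis_diff_le: "norm (cis x - cis y) \<le> \<bar>x - y\<bar>"
proof -
  have "norm (cis x - cis y) = norm (cis y * (cis (x - y) - 1))"
    by (simp add: algebra_simps cis_mult)
  also have "\<dots> \<le> \<bar>x - y\<bar>"
    using iexp_approx1[of "x - y" 0] by (simp add: norm_mult cis_conv_exp)
  finally show ?thesis .
qed

text \<open>The quotient form puts the whole error into one integrand, so that differentiating an
  integral becomes a matter of dominated convergence.\<close>

lemma has_vector_derivative_iff_quotient:
  fixes f :: "real \<Rightarrow> 'a::real_normed_vector"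
  shows "(f has_vector_derivative D) (at x) \<longleftrightarrow>
    ((\<lambda>h. (f (x + h) - f x - h *\<^sub>R D) /\<^sub>R h) \<longlongrightarrow> 0) (at 0)"
  unfolding has_vector_derivative_def has_derivative_at
  by (subst (2) tendsto_norm_zero_iff[symmetric])
     (simp add: bounded_linear_scaleR_left divide_inverse mult.commute)

lemma fourier_has_vector_derivative:
  assumes f: "integrable lborel f" and tf: "integrable lborel (\<lambda>t. \<i> * of_real t * f t)"
  shows "(fourier f has_vector_derivative fourier (\<lambda>t. \<i> * of_real t * f t) \<omega>) (at \<omega>)"
proof -
  have [measurable]: "f \<in> borel_measurable borel"
    using borel_measurable_integrable[OF f] by simp
  \<comment> \<open>\<open>q h t\<close> is the error of the difference quotient of the kernel; the
    error for the transform is the integral of \<open>f t * q h t\<close>.\<close>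
  define q where "q h t = (cis ((\<omega> + h) * t) - cis (\<omega> * t) - h *\<^sub>R (t *\<^sub>R (\<i> * cis (\<omega> * t)))) /\<^sub>R h" for h t
  \<comment> \<open>One \<open>\<bar>t\<bar>\<close> bounds the difference quotient, the other the
    derivative itself; the majorant is independent of h.\<close>
  have q_bound: "norm (q h t) \<le> 2 * \<bar>t\<bar>" if "h \<noteq> 0" for h t
  proof -
    have "norm (cis ((\<omega> + h) * t) - cis (\<omega> * t)) \<le> \<bar>h\<bar> * \<bar>t\<bar>"
      using norm_cis_diff_le[of "(\<omega> + h) * t" "\<omega> * t"] by (simp add: algebra_simps abs_mult)
    moreover have "norm (h *\<^sub>R (t *\<^sub>R (\<i> * cis (\<omega> * t)))) = \<bar>h\<bar> * \<bar>t\<bar>"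
      by (simp add: norm_mult abs_mult)
    ultimately have "norm (cis ((\<omega> + h) * t) - cis (\<omega> * t) - h *\<^sub>R (t *\<^sub>R (\<i> * cis (\<omega> * t)))) \<le> \<bar>h\<bar> * (2 * \<bar>t\<bar>)"
      by (intro order_trans[OF norm_triangle_ineq4]) simp
    then show ?thesis
      using that by (simp add: q_def divide_simps mult_ac)
  qed
  have q_lim: "((\<lambda>h. q h t) \<longlongrightarrow> 0) (at 0)" for t
  proof -
    have "((\<lambda>u. cis (u * t)) has_vector_derivative (t *\<^sub>R (\<i> * cis (\<omega> * t)))) (at \<omega>)"
      unfolding has_vector_derivative_def
      by (auto intro!: derivative_eq_intros simp: mult_ac)
    then show ?thesis
      unfolding has_vector_derivative_iff_quotient q_def .
  qed
  \<comment> \<open>Dominated convergence concerns sequences, so the limit at 0 is tested along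
    sequences that avoid 0.\<close>
  show ?thesis
    unfolding has_vector_derivative_iff_quotient
  proof (subst tendsto_at_iff_sequentially, safe)
    fix X :: "nat \<Rightarrow> real"
    assume X: "\<forall>i. X i \<in> UNIV - {0}" "X \<longlonglongrightarrow> 0"
    let ?D = "fourier (\<lambda>t. \<i> * of_real t * f t) \<omega>"
    have eq: "(fourier f (\<omega> + h) - fourier f \<omega> - h *\<^sub>R ?D) /\<^sub>R h = (LINT t|lborel. f t * q h t)" for h
    proof -
      have "(fourier f (\<omega> + h) - fourier f \<omega> - h *\<^sub>R ?D) /\<^sub>R h =
        (LINT t|lborel. (f t * cis ((\<omega> + h) * t) - f t * cis (\<omega> * t) -
          h *\<^sub>R ((\<i> * of_real t * f t) * cis (\<omega> * t))) /\<^sub>R h)"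
        unfolding fourier_def
        by (simp add: integrable_fourier[OF f] integrable_fourier[OF tf])
      also have "\<dots> = (LINT t|lborel. f t * q h t)"
        by (intro Bochner_Integration.integral_cong refl)
           (simp add: q_def algebra_simps scaleR_conv_of_real)
      finally show ?thesis .
    qed
    have "(\<lambda>i. LINT t|lborel. f t * q (X i) t) \<longlonglongrightarrow> (LINT (t::real)|lborel. (0::complex))"
    proof (rule integral_dominated_convergence)
      show "integrable lborel (\<lambda>t. 2 * norm (\<i> * of_real t * f t))"
        using tf by (intro integrable_mult_right integrable_norm)
      show "AE t in lborel. norm (f t * q (X i) t) \<le> 2 * norm (\<i> * of_real t * f t)" for i
      proof (rule AE_I2)
        fix t
        have "norm (f t) * norm (q (X i) t) \<le> norm (f t) * (2 * \<bar>t\<bar>)"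
          using X by (intro mult_left_mono q_bound) auto
        then show "norm (f t * q (X i) t) \<le> 2 * norm (\<i> * of_real t * f t)"
          by (simp add: norm_mult mult_ac)
      qed
      show "AE t in lborel. (\<lambda>i. f t * q (X i) t) \<longlonglongrightarrow> 0"
      proof (rule AE_I2)
        fix t
        have "((\<lambda>h. q h t) \<circ> X) \<longlonglongrightarrow> 0"
          using q_lim[of t] X unfolding tendsto_at_iff_sequentially by blast
        then show "(\<lambda>i. f t * q (X i) t) \<longlonglongrightarrow> 0"
          unfolding comp_def by (rule tendsto_mult_right_zero)
      qed
      show "(\<lambda>t. f t * q (X i) t) \<in> borel_measurable lborel" for i
        unfolding q_def by measurable
    qed measurable
    then show "((\<lambda>h. (fourier f (\<omega> + h) - fourier f \<omega> - h *\<^sub>R ?D) /\<^sub>R h) \<circ> X) \<longlonglongrightarrow> 0"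
      unfolding comp_def eq by simp
  qed
qed

lemma integrable_power_times_bounded_support:
  assumes f: "integrable lborel f" and supp: "\<And>t. f t \<noteq> 0 \<Longrightarrow> \<bar>t\<bar> \<le> R"
  shows "integrable lborel (\<lambda>t. (\<i> * of_real t) ^ n * f t)"
proof (rule Bochner_Integration.integrable_bound)
  show "integrable lborel (\<lambda>t. of_real (R ^ n) * f t)"
    using f by (rule integrable_mult_right)
  have [measurable]: "f \<in> borel_measurable borel"
    using borel_measurable_integrable[OF f] by simp
  show "(\<lambda>t. (\<i> * of_real t) ^ n * f t) \<in> borel_measurable lborel" by measurable
  have "norm ((\<i> * of_real t) ^ n * f t) \<le> norm (of_real (R ^ n) * f t)" for t
  proof (cases "f t = 0")
    case False
    then have "\<bar>t\<bar> \<le> R" by (rule supp)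
    then have "\<bar>t\<bar> ^ n \<le> \<bar>R\<bar> ^ n" by (intro power_mono) auto
    then show ?thesis
      by (simp add: norm_mult norm_power mult_right_mono power_abs)
  qed simp
  then show "AE t in lborel. norm ((\<i> * of_real t) ^ n * f t) \<le> norm (of_real (R ^ n) * f t)"
    by simp
qed

lemma nth_deriv_fourier:
  assumes f: "integrable lborel f" and supp: "\<And>t. f t \<noteq> 0 \<Longrightarrow> \<bar>t\<bar> \<le> R"
  shows "nth_deriv n (fourier f) = fourier (\<lambda>t. (\<i> * of_real t) ^ n * f t)"
proof (induction n)
  case (Suc n)
  have int: "integrable lborel (\<lambda>t. (\<i> * of_real t) ^ m * f t)" for m
    using assms by (rule integrable_power_times_bounded_support)
  have "integrable lborel (\<lambda>t. \<i> * of_real t * ((\<i> * of_real t) ^ n * f t))"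
    using int[of "Suc n"] by (simp add: mult.assoc)
  from fourier_has_vector_derivative[OF int this]
  have "vector_derivative (fourier (\<lambda>t. (\<i> * of_real t) ^ n * f t)) (at \<omega>) =
      fourier (\<lambda>t. (\<i> * of_real t) ^ Suc n * f t) \<omega>" for \<omega>
    by (simp add: vector_derivative_at mult.assoc)
  moreover have "nth_deriv (Suc n) (fourier f) \<omega> = vector_derivative (nth_deriv n (fourier f)) (at \<omega>)" for \<omega>
    by (simp add: nth_deriv_def)
  ultimately show ?case
    unfolding Suc by (intro ext) metis
qed (simp add: nth_deriv_def)

lemma smooth_fourier:
  assumes f: "integrable lborel f" and supp: "\<And>t. f t \<noteq> 0 \<Longrightarrow> \<bar>t\<bar> \<le> R"
  shows "smooth (fourier f)"
  unfolding smooth_def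
proof (intro allI)
  fix n t
  have int: "integrable lborel (\<lambda>t. (\<i> * of_real t) ^ m * f t)" for m
    using assms by (rule integrable_power_times_bounded_support)
  have "integrable lborel (\<lambda>t. \<i> * of_real t * ((\<i> * of_real t) ^ n * f t))"
    using int[of "Suc n"] by (simp add: mult.assoc)
  from fourier_has_vector_derivative[OF int this]
  show "nth_deriv n (fourier f) differentiable at t"
    by (subst nth_deriv_fourier[where R = R]) (auto intro: assms differentiableI_vector)
qed

lemma smooth_add_const:
  assumes "smooth f"
  shows "smooth (\<lambda>t. c + f t)"
proof -
  have f0: "f differentiable (at t)" for t
    using assms unfolding smooth_def nth_deriv_def by (metis funpow_0)
  have shift: "vector_derivative (\<lambda>t. c + f t) (at t) = vector_derivative f (at t)" for t
    using f0[of t] by (intro vector_derivative_at)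
      (auto intro!: derivative_eq_intros simp: vector_derivative_works)
  \<comment> \<open>The innermost derivative is split off the iterate. The constant disappears
    there, so only order 0 has to be treated separately.\<close>
  have Suc: "nth_deriv (Suc n) (\<lambda>t. c + f t) = nth_deriv (Suc n) f" for n
    unfolding nth_deriv_def funpow_Suc_right comp_def shift ..
  show ?thesis
    unfolding smooth_def
  proof (intro allI)
    fix n t
    show "nth_deriv n (\<lambda>t. c + f t) differentiable at t"
    proof (cases n)
      case 0
      then show ?thesis using f0[of t] by (simp add: nth_deriv_def)
    next
      case n: (Suc m)
      show ?thesis using assms unfolding n Suc smooth_def by blast
    qed
  qed
qed

text \<open>Fubini for \<open>f x * g t * cis (x * t)\<close>, absolutely integrable because the
  kernel has modulus one. This symmetry moves transforms between the factors of an integral, both in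
  the Gaussian regularisation and in the pairing with test functions.\<close>

lemma fourier_multiplication_formula:
  assumes f: "integrable lborel f" and g: "integrable lborel g"
  shows "(LINT x|lborel. f x * fourier g x) = (LINT x|lborel. fourier f x * g x)"
proof -
  have [measurable]: "f \<in> borel_measurable borel" "g \<in> borel_measurable borel"
    using borel_measurable_integrable[OF f] borel_measurable_integrable[OF g] by simp_all
  have "integrable (lborel \<Otimes>\<^sub>M lborel) (\<lambda>(x, t). f x * (g t * cis (x * t)))"
  proof (rule lborel_pair.Fubini_integrable)
    show "integrable lborel (\<lambda>x. LINT t|lborel. norm (case (x, t) of (x, t) \<Rightarrow> f x * (g t * cis (x * t))))"
      using f by (simp add: norm_mult)
    show "AE x in lborel. integrable lborel (\<lambda>t. case (x, t) of (x, t) \<Rightarrow> f x * (g t * cis (x * t)))"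
      using integrable_fourier[OF g] by (intro AE_I2) simp
  qed measurable
  from lborel_pair.Fubini_integral[OF this]
  have swap: "(LINT t|lborel. LINT x|lborel. f x * (g t * cis (x * t))) =
      (LINT x|lborel. LINT t|lborel. f x * (g t * cis (x * t)))" .
  have inner1: "(LINT t|lborel. f x * (g t * cis (x * t))) = f x * fourier g x" for x
    unfolding fourier_def by (rule integral_mult_right_zero)
  have inner2: "(LINT x|lborel. f x * (g t * cis (x * t))) = fourier f t * g t" for t
    unfolding fourier_def
    by (subst integral_mult_left_zero[symmetric]) (simp add: mult_ac)
  show ?thesis
    using swap unfolding inner1 inner2 by (rule sym)
qed

text \<open>Normalised to be 1 at the origin, not to have integral 1: it is a cut-off that tends to
  1 as \<open>\<sigma>\<close> grows, while its transform concentrates at 0 with integral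
  \<open>2 * pi\<close>.\<close>

definition gauss_weight :: "real \<Rightarrow> real \<Rightarrow> complex" where
  "gauss_weight \<sigma> x = of_real (exp (- (x / \<sigma>)\<^sup>2 / 2))"

lemma gauss_weight_eq_normal_density:
  "\<sigma> > 0 \<Longrightarrow> gauss_weight \<sigma> x = of_real (sqrt (2 * pi) * \<sigma> * normal_density 0 \<sigma> x)"
  by (simp add: gauss_weight_def normal_density_def real_sqrt_mult power_divide field_simps)

lemma borel_measurable_gauss_weight [measurable]: "gauss_weight \<sigma> \<in> borel_measurable borel"
  unfolding gauss_weight_def[abs_def] by measurable

lemma integrable_gauss_weight: "\<sigma> > 0 \<Longrightarrow> integrable lborel (gauss_weight \<sigma>)"
  by (simp add: gauss_weight_eq_normal_density cong: Bochner_Integration.integrable_cong)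

lemma fourier_gauss_weight:
  assumes "\<sigma> > 0"
  shows "fourier (gauss_weight \<sigma>) u = of_real (2 * pi * normal_density 0 (1 / \<sigma>) u)"
proof -
  have "fourier (gauss_weight \<sigma>) u =
      \<sigma> *\<^sub>R (LINT x|lborel. gauss_weight \<sigma> (\<sigma> * x) * cis (u * (\<sigma> * x)))"
    unfolding fourier_def using assms
    by (subst lborel_integral_real_affine[where c = \<sigma> and t = 0]) auto
  also have "(\<lambda>x. gauss_weight \<sigma> (\<sigma> * x) * cis (u * (\<sigma> * x))) =
      (\<lambda>x. of_real (sqrt (2 * pi)) * (std_normal_density x *\<^sub>R iexp (\<sigma> * u * x)))"
    using assms
    by (simp add: fun_eq_iff gauss_weight_def std_normal_density_def scaleR_conv_of_real cis_conv_exp mult_ac)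
  also have "(LINT x|lborel. of_real (sqrt (2 * pi)) * (std_normal_density x *\<^sub>R iexp (\<sigma> * u * x))) =
      of_real (sqrt (2 * pi)) * char std_normal_distribution (\<sigma> * u)"
    unfolding char_def by (subst integral_density) (simp_all only: integral_mult_right_zero, auto)
  also have "\<sigma> *\<^sub>R (of_real (sqrt (2 * pi)) * char std_normal_distribution (\<sigma> * u)) =
      of_real (2 * pi * normal_density 0 (1 / \<sigma>) u)"
  proof -
    have "\<sigma> * (sqrt (2 * pi) * exp (- (\<sigma> * u)\<^sup>2 / 2)) = 2 * pi * normal_density 0 (1 / \<sigma>) u"
      using assms
      by (simp add: normal_density_def real_sqrt_mult power_mult_distrib real_sqrt_divide field_simps)
    then show ?thesis
      unfolding char_std_normal_distribution scaleR_conv_of_real of_real_mult[symmetric] by simp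
  qed
  finally show ?thesis .
qed

lemma fourier_modulate: "fourier (\<lambda>x. f x * cis (s * x)) u = fourier f (s + u)"
  by (simp add: fourier_def cis_mult mult.assoc distrib_right)

lemma fourier_reflect: "fourier (\<lambda>t. f (- t)) \<omega> = fourier f (- \<omega>)"
  unfolding fourier_def
  by (subst lborel_integral_real_affine[where c = "-1" and t = 0]) auto

lemma cnj_fourier: "cnj (fourier f \<omega>) = fourier (\<lambda>t. cnj (f t)) (- \<omega>)"
proof -
  have "cnj (fourier f \<omega>) = (LINT t|lborel. cnj (f t * cis (\<omega> * t)))"
    unfolding fourier_def by (rule Bochner_Integration.integral_cnj[symmetric])
  then show ?thesis
    by (simp add: fourier_def cis_cnj)
qed

section \<open>Gaussian regularisation\<close>

lemma borel_measurable_cnj [measurable]: "cnj \<in> borel_measurable borel"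
  by (intro borel_measurable_continuous_onI continuous_intros)

text \<open>If integrability fails, the Bochner integral is 0 by convention. This permits estimates
  before anything is known about the integrability of slices.\<close>

lemma norm_integral_le_nn_integral:
  fixes f :: "_ \<Rightarrow> 'b::{banach, second_countable_topology}"
  shows "ennreal (norm (integral\<^sup>L M f)) \<le> (\<integral>\<^sup>+x. ennreal (norm (f x)) \<partial>M)"
  by (cases "integrable M f")
     (simp_all add: integral_norm_bound_ennreal not_integrable_integral_eq)

lemma tendsto_integral_gauss_weight:
  assumes f: "integrable lborel f"
  shows "(\<lambda>n. LINT x|lborel. gauss_weight (real (Suc n)) x * f x) \<longlonglongrightarrow> (LINT x|lborel. f x)"
proof (rule integral_dominated_convergence)
  have [measurable]: "f \<in> borel_measurable borel"
    using borel_measurable_integrable[OF f] by simp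
  show "(\<lambda>x. gauss_weight (real (Suc n)) x * f x) \<in> borel_measurable lborel" for n by measurable
  show "f \<in> borel_measurable lborel" by measurable
  show "integrable lborel (\<lambda>x. norm (f x))" using f by (rule integrable_norm)
  show "AE x in lborel. norm (gauss_weight (real (Suc n)) x * f x) \<le> norm (f x)" for n
    by (intro AE_I2) (simp add: norm_mult gauss_weight_def mult_left_le_one_le)
  show "AE x in lborel. (\<lambda>n. gauss_weight (real (Suc n)) x * f x) \<longlonglongrightarrow> f x"
  proof (rule AE_I2)
    fix x
    have "(\<lambda>n. x / real (Suc n)) \<longlonglongrightarrow> 0" by real_asymp
    then have "(\<lambda>n. exp (- (x / real (Suc n))\<^sup>2 / 2)) \<longlonglongrightarrow> exp (- 0\<^sup>2 / 2)"
      by (intro tendsto_intros) auto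
    then have "(\<lambda>n. gauss_weight (real (Suc n)) x) \<longlonglongrightarrow> of_real (exp (- 0\<^sup>2 / 2))"
      unfolding gauss_weight_def by (rule tendsto_of_real)
    from tendsto_mult_right[OF this, of "f x"]
    show "(\<lambda>n. gauss_weight (real (Suc n)) x * f x) \<longlonglongrightarrow> f x" by simp
  qed
qed

lemma integrable_gauss_weight_mult:
  assumes \<sigma>: "\<sigma> > 0" and [measurable]: "f \<in> borel_measurable borel" and f: "\<And>x. norm (f x) \<le> C"
  shows "integrable lborel (\<lambda>x. gauss_weight \<sigma> x * f x)"
proof (rule Bochner_Integration.integrable_bound)
  show "integrable lborel (\<lambda>x. of_real C * gauss_weight \<sigma> x)"
    by (intro integrable_mult_right integrable_gauss_weight \<sigma>)
  show "AE x in lborel. norm (gauss_weight \<sigma> x * f x) \<le> norm (of_real C * gauss_weight \<sigma> x)"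
  proof (rule AE_I2)
    fix x
    have "norm (f x) \<le> \<bar>C\<bar>" using f[of x] by linarith
    then show "norm (gauss_weight \<sigma> x * f x) \<le> norm (of_real C * gauss_weight \<sigma> x)"
      using mult_left_mono[of "norm (f x)" "\<bar>C\<bar>" "norm (gauss_weight \<sigma> x)"]
      by (simp add: norm_mult mult.commute)
  qed
qed measurable

text \<open>Moving the transform from \<open>f\<close> to the Gaussian weight is what makes the inversion formula and
  the Plancherel inequality below absolutely convergent computations.\<close>

lemma integral_gauss_weight_fourier:
  assumes f: "integrable lborel f" and \<sigma>: "\<sigma> > 0"
  shows "(LINT x|lborel. gauss_weight \<sigma> x * (cis (s * x) * fourier f (- x))) =
    of_real (2 * pi) * (LINT u|lborel. normal_density s (1 / \<sigma>) u *\<^sub>R f u)"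
proof -
  have [measurable]: "f \<in> borel_measurable borel"
    using borel_measurable_integrable[OF f] by simp
  have f': "integrable lborel (\<lambda>t. f (- t))"
    using lborel_integrable_real_affine[OF f, of "-1" 0] by simp
  have g: "integrable lborel (\<lambda>x. gauss_weight \<sigma> x * cis (s * x))"
    using \<sigma> by (intro integrable_gauss_weight_mult[where C = 1]) auto
  have "(LINT x|lborel. gauss_weight \<sigma> x * (cis (s * x) * fourier f (- x))) =
      (LINT x|lborel. (gauss_weight \<sigma> x * cis (s * x)) * fourier (\<lambda>t. f (- t)) x)"
    by (simp add: fourier_reflect mult.assoc)
  also have "\<dots> = (LINT u|lborel. of_real (2 * pi * normal_density 0 (1 / \<sigma>) (s + u)) * f (- u))"
    by (simp add: fourier_multiplication_formula[OF g f'] fourier_modulate fourier_gauss_weight[OF \<sigma>])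
  also have "\<dots> = (LINT u|lborel. of_real (2 * pi * normal_density 0 (1 / \<sigma>) (s - u)) * f u)"
    by (subst lborel_integral_real_affine[where c = "-1" and t = 0]) auto
  also have "\<dots> = (LINT u|lborel. of_real (2 * pi) * (normal_density s (1 / \<sigma>) u *\<^sub>R f u))"
    by (simp add: normal_density_def power2_commute scaleR_conv_of_real mult.assoc)
  also have "\<dots> = of_real (2 * pi) * (LINT u|lborel. normal_density s (1 / \<sigma>) u *\<^sub>R f u)"
    by (rule integral_mult_right_zero)
  finally show ?thesis .
qed

text \<open>The substitution \<open>u = s + v / (n + 1)\<close> freezes the density and moves the
  dependence on n into the argument of \<open>\<phi>\<close>. Continuity gives the pointwise limit,
  and \<open>C\<close> times the density is a majorant.\<close>

lemma tendsto_integral_normal_density: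
  fixes \<phi> :: "real \<Rightarrow> complex"
  assumes cont: "continuous_on UNIV \<phi>" and bound: "\<And>x. norm (\<phi> x) \<le> C"
  shows "(\<lambda>n. LINT u|lborel. normal_density s (1 / real (Suc n)) u *\<^sub>R \<phi> u) \<longlonglongrightarrow> \<phi> s"
proof -
  have [measurable]: "\<phi> \<in> borel_measurable borel"
    using cont by (rule borel_measurable_continuous_onI)
  have eq: "(LINT u|lborel. normal_density s (1 / real (Suc n)) u *\<^sub>R \<phi> u) =
      (LINT v|lborel. std_normal_density v *\<^sub>R \<phi> (s + (1 / real (Suc n)) * v))" for n
  proof -
    let ?c = "1 / real (Suc n)"
    have nd: "?c * normal_density s ?c (s + ?c * v) = std_normal_density v" for v
      by (simp add: normal_density_def real_sqrt_mult real_sqrt_divide power_mult_distrib field_simps del: of_nat_Suc)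
    have "(LINT u|lborel. normal_density s ?c u *\<^sub>R \<phi> u) =
        ?c *\<^sub>R (LINT v|lborel. normal_density s ?c (s + ?c * v) *\<^sub>R \<phi> (s + ?c * v))"
      by (subst lborel_integral_real_affine[where c = ?c and t = s]) auto
    also have "\<dots> = (LINT v|lborel. (?c * normal_density s ?c (s + ?c * v)) *\<^sub>R \<phi> (s + ?c * v))"
      by (simp flip: integral_scaleR_right)
    finally show ?thesis unfolding nd .
  qed
  have "(\<lambda>n. LINT v|lborel. std_normal_density v *\<^sub>R \<phi> (s + (1 / real (Suc n)) * v)) \<longlonglongrightarrow>
      (LINT v|lborel. std_normal_density v *\<^sub>R \<phi> s)"
  proof (rule integral_dominated_convergence)
    show "integrable lborel (\<lambda>v. C * std_normal_density v)" by simp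
    show "AE v in lborel. norm (std_normal_density v *\<^sub>R \<phi> (s + (1 / real (Suc n)) * v)) \<le> C * std_normal_density v" for n
      using bound by (intro AE_I2) (simp add: mult.commute[of C] mult_left_mono)
    show "AE v in lborel. (\<lambda>n. std_normal_density v *\<^sub>R \<phi> (s + (1 / real (Suc n)) * v))
        \<longlonglongrightarrow> std_normal_density v *\<^sub>R \<phi> s"
    proof (rule AE_I2)
      fix v
      have "(\<lambda>n. s + (1 / real (Suc n)) * v) \<longlonglongrightarrow> s" by real_asymp
      moreover have "isCont \<phi> s" using cont by (simp add: continuous_on_eq_continuous_at)
      ultimately have "(\<lambda>n. \<phi> (s + (1 / real (Suc n)) * v)) \<longlonglongrightarrow> \<phi> s"
        by (rule isCont_tendsto_compose[rotated])
      then show "(\<lambda>n. std_normal_density v *\<^sub>R \<phi> (s + (1 / real (Suc n)) * v))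
        \<longlonglongrightarrow> std_normal_density v *\<^sub>R \<phi> s" by (intro tendsto_intros)
    qed
  qed measurable
  then show ?thesis unfolding eq by simp
qed

text \<open>Both sides are limits of the same Gaussian-weighted integral: the weight tends to 1, and
  its transform is an approximate identity concentrating at \<open>t\<close>.\<close>

lemma fourier_inversion:
  assumes \<phi>: "integrable lborel \<phi>" and cont: "continuous_on UNIV \<phi>"
    and bound: "\<And>x. norm (\<phi> x) \<le> C" and F: "integrable lborel (fourier \<phi>)"
  shows "fourier (\<lambda>\<omega>. fourier \<phi> (- \<omega>)) t = of_real (2 * pi) * \<phi> t"
proof (rule LIMSEQ_unique)
  have F': "integrable lborel (\<lambda>x. cis (t * x) * fourier \<phi> (- x))"
    using integrable_fourier[of "\<lambda>x. fourier \<phi> (- x)" t] lborel_integrable_real_affine[OF F, of "-1" 0]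
    by (simp add: mult.commute)
  show "(\<lambda>n. LINT x|lborel. gauss_weight (real (Suc n)) x * (cis (t * x) * fourier \<phi> (- x)))
      \<longlonglongrightarrow> fourier (\<lambda>\<omega>. fourier \<phi> (- \<omega>)) t"
    using tendsto_integral_gauss_weight[OF F'] by (simp add: fourier_def[of "\<lambda>\<omega>. fourier \<phi> (- \<omega>)"] mult.commute)
  show "(\<lambda>n. LINT x|lborel. gauss_weight (real (Suc n)) x * (cis (t * x) * fourier \<phi> (- x)))
      \<longlonglongrightarrow> of_real (2 * pi) * \<phi> t"
    by (subst integral_gauss_weight_fourier[OF \<phi>])
       (simp, intro tendsto_mult tendsto_const tendsto_integral_normal_density[OF cont bound])
qed

lemma nn_integral_normal_density:
  assumes "\<sigma> > 0"
  shows "(\<integral>\<^sup>+t. ennreal (normal_density s \<sigma> t) \<partial>lborel) = 1"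
  using assms by (subst nn_integral_eq_integral) auto

text \<open>With a Gaussian weight the left side becomes \<open>2 * pi\<close> times a double
  integral of \<open>cnj (f u) * f s\<close> against a symmetric probability kernel. The inequality
  between the product and half the sum of squares bounds it uniformly in the width, and Fatou
  removes the weight. The right side may be infinite.\<close>

lemma plancherel_le:
  assumes f: "integrable lborel f"
  shows "(\<integral>\<^sup>+\<omega>. ennreal ((norm (fourier f \<omega>))\<^sup>2) \<partial>lborel)
    \<le> ennreal (2 * pi) * (\<integral>\<^sup>+t. ennreal ((norm (f t))\<^sup>2) \<partial>lborel)"
proof -
  have [measurable]: "f \<in> borel_measurable borel"
    using borel_measurable_integrable[OF f] by simp
  define N where "N = (\<integral>\<^sup>+t. ennreal ((norm (f t))\<^sup>2) \<partial>lborel)"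
  define F where "F = fourier f"
  have [measurable]: "F \<in> borel_measurable borel" unfolding F_def by measurable
  define w where "w n \<omega> = exp (- (\<omega> / real (Suc n))\<^sup>2 / 2)" for n \<omega>
  have [measurable]: "w n \<in> borel_measurable borel" for n unfolding w_def[abs_def] by measurable
  have step: "(\<integral>\<^sup>+\<omega>. ennreal (w n \<omega> * (norm (F \<omega>))\<^sup>2) \<partial>lborel) \<le> ennreal (2 * pi) * N" for n
  proof -
    define \<tau> where "\<tau> = 1 / real (Suc n)"
    have \<tau>: "\<tau> > 0" by (simp add: \<tau>_def)
    let ?g = "gauss_weight (real (Suc n))"
    let ?C = "LINT t|lborel. norm (f t)"
    have bF: "norm (F \<omega>) \<le> ?C" for \<omega> unfolding F_def by (rule norm_fourier_le)
    have C0: "0 \<le> ?C" by simp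
    have w_eq: "of_real (w n \<omega>) = ?g \<omega>" for \<omega> by (simp add: w_def gauss_weight_def)
    have ig: "integrable lborel (\<lambda>\<omega>. ?g \<omega> * cnj (F \<omega>))"
      using bF by (intro integrable_gauss_weight_mult[where C = ?C]) auto
    have igg: "integrable lborel (\<lambda>\<omega>. ?g \<omega> * (cnj (F \<omega>) * F \<omega>))"
      using bF C0 by (intro integrable_gauss_weight_mult[where C = "?C * ?C"]) (auto simp: norm_mult intro!: mult_mono)
    have wF: "?g \<omega> * (cnj (F \<omega>) * F \<omega>) = of_real (w n \<omega> * (norm (F \<omega>))\<^sup>2)" for \<omega>
      unfolding of_real_mult complex_norm_square w_eq by (simp add: mult.commute)
    have int_w: "integrable lborel (\<lambda>\<omega>. w n \<omega> * (norm (F \<omega>))\<^sup>2)"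
      using igg unfolding wF by (simp only: complex_of_real_integrable_eq)
    have inner: "fourier (\<lambda>\<omega>. ?g \<omega> * cnj (F \<omega>)) s =
        of_real (2 * pi) * (LINT u|lborel. normal_density s \<tau> u *\<^sub>R cnj (f u))" for s
    proof -
      have "fourier (\<lambda>\<omega>. ?g \<omega> * cnj (F \<omega>)) s =
        (LINT x|lborel. ?g x * (cis (s * x) * fourier (\<lambda>t. cnj (f t)) (- x)))"
        unfolding fourier_def[of _ s] F_def cnj_fourier by (simp add: mult_ac)
      also have "\<dots> = of_real (2 * pi) * (LINT u|lborel. normal_density s \<tau> u *\<^sub>R cnj (f u))"
        unfolding \<tau>_def using f by (intro integral_gauss_weight_fourier) auto
      finally show ?thesis .
    qed
    have "(\<integral>\<^sup>+\<omega>. ennreal (w n \<omega> * (norm (F \<omega>))\<^sup>2) \<partial>lborel) =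
        ennreal (LINT \<omega>|lborel. w n \<omega> * (norm (F \<omega>))\<^sup>2)"
      using int_w by (intro nn_integral_eq_integral) (auto simp: w_def)
    also have "\<dots> \<le> ennreal (norm (LINT \<omega>|lborel. ?g \<omega> * (cnj (F \<omega>) * F \<omega>)))"
      unfolding wF by (simp only: integral_complex_of_real norm_of_real abs_ge_self ennreal_leI)
    also have "(LINT \<omega>|lborel. ?g \<omega> * (cnj (F \<omega>) * F \<omega>)) =
        (LINT s|lborel. fourier (\<lambda>\<omega>. ?g \<omega> * cnj (F \<omega>)) s * f s)"
      using fourier_multiplication_formula[OF ig f] by (simp add: F_def mult.assoc)
    also have "\<dots> = (LINT s|lborel. of_real (2 * pi) * ((LINT u|lborel. normal_density s \<tau> u *\<^sub>R cnj (f u)) * f s))"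
      unfolding inner by (simp add: mult.assoc)
    also have "\<dots> = of_real (2 * pi) * (LINT s|lborel. (LINT u|lborel. normal_density s \<tau> u *\<^sub>R cnj (f u)) * f s)"
      by (rule integral_mult_right_zero)
    also have "ennreal (norm \<dots>) = ennreal (2 * pi) *
        ennreal (norm (LINT s|lborel. (LINT u|lborel. normal_density s \<tau> u *\<^sub>R cnj (f u)) * f s))"
      by (simp add: norm_mult ennreal_mult)
    also have "ennreal (norm (LINT s|lborel. (LINT u|lborel. normal_density s \<tau> u *\<^sub>R cnj (f u)) * f s)) \<le> N"
    proof -
      have "ennreal (norm (LINT s|lborel. (LINT u|lborel. normal_density s \<tau> u *\<^sub>R cnj (f u)) * f s)) \<le>
          (\<integral>\<^sup>+s. ennreal (norm ((LINT u|lborel. normal_density s \<tau> u *\<^sub>R cnj (f u)) * f s)) \<partial>lborel)"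
        by (rule norm_integral_le_nn_integral)
      also have "\<dots> \<le> (\<integral>\<^sup>+s. (\<integral>\<^sup>+u. ennreal (normal_density s \<tau> u) *
            (ennreal ((norm (f u))\<^sup>2 / 2) + ennreal ((norm (f s))\<^sup>2 / 2)) \<partial>lborel) \<partial>lborel)"
      proof (rule nn_integral_mono)
        fix s
        have "ennreal (norm ((LINT u|lborel. normal_density s \<tau> u *\<^sub>R cnj (f u)) * f s)) =
          ennreal (norm (LINT u|lborel. normal_density s \<tau> u *\<^sub>R cnj (f u) * f s))"
          by (subst integral_mult_left_zero[symmetric]) simp
        also have "\<dots> \<le> (\<integral>\<^sup>+u. ennreal (norm (normal_density s \<tau> u *\<^sub>R cnj (f u) * f s)) \<partial>lborel)"
          by (rule norm_integral_le_nn_integral)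
        also have "\<dots> \<le> (\<integral>\<^sup>+u. ennreal (normal_density s \<tau> u) *
            (ennreal ((norm (f u))\<^sup>2 / 2) + ennreal ((norm (f s))\<^sup>2 / 2)) \<partial>lborel)"
        proof (rule nn_integral_mono)
          fix u
          have "norm (f u) * norm (f s) \<le> (norm (f u))\<^sup>2 / 2 + (norm (f s))\<^sup>2 / 2"
            using sum_squares_bound[of "norm (f u)" "norm (f s)"] by simp
          then have "normal_density s \<tau> u * (norm (f u) * norm (f s)) \<le>
              normal_density s \<tau> u * ((norm (f u))\<^sup>2 / 2 + (norm (f s))\<^sup>2 / 2)"
            by (intro mult_left_mono) auto
          then show "ennreal (norm (normal_density s \<tau> u *\<^sub>R cnj (f u) * f s)) \<le>
            ennreal (normal_density s \<tau> u) * (ennreal ((norm (f u))\<^sup>2 / 2) + ennreal ((norm (f s))\<^sup>2 / 2))"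
            by (simp add: norm_mult ennreal_leI mult.assoc flip: ennreal_plus ennreal_mult')
        qed
        finally show "ennreal (norm ((LINT u|lborel. normal_density s \<tau> u *\<^sub>R cnj (f u)) * f s)) \<le> \<dots>" .
      qed
      \<comment> \<open>Each half is integrated first in the variable that its square does not
        contain, where the kernel has mass 1. For the first half this needs Tonelli and the symmetry
        of the density in mean and argument.\<close>
      also have "\<dots> = (\<integral>\<^sup>+s. (\<integral>\<^sup>+u. ennreal (normal_density s \<tau> u) * ennreal ((norm (f u))\<^sup>2 / 2) \<partial>lborel) \<partial>lborel) +
          (\<integral>\<^sup>+s. (\<integral>\<^sup>+u. ennreal (normal_density s \<tau> u) * ennreal ((norm (f s))\<^sup>2 / 2) \<partial>lborel) \<partial>lborel)"
        unfolding distrib_left normal_density_def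
        by (subst nn_integral_add[symmetric]) (auto intro!: nn_integral_cong nn_integral_add)
      also have "(\<integral>\<^sup>+s. (\<integral>\<^sup>+u. ennreal (normal_density s \<tau> u) * ennreal ((norm (f s))\<^sup>2 / 2) \<partial>lborel) \<partial>lborel) =
          (\<integral>\<^sup>+s. ennreal ((norm (f s))\<^sup>2 / 2) \<partial>lborel)"
        using nn_integral_normal_density[OF \<tau>] by (subst nn_integral_multc) auto
      also have "(\<integral>\<^sup>+s. (\<integral>\<^sup>+u. ennreal (normal_density s \<tau> u) * ennreal ((norm (f u))\<^sup>2 / 2) \<partial>lborel) \<partial>lborel) =
          (\<integral>\<^sup>+u. (\<integral>\<^sup>+s. ennreal (normal_density s \<tau> u) * ennreal ((norm (f u))\<^sup>2 / 2) \<partial>lborel) \<partial>lborel)"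
        unfolding normal_density_def by (rule lborel_pair.Fubini') measurable
      also have "\<dots> = (\<integral>\<^sup>+u. (\<integral>\<^sup>+s. ennreal (normal_density u \<tau> s) * ennreal ((norm (f u))\<^sup>2 / 2) \<partial>lborel) \<partial>lborel)"
        unfolding normal_density_def by (simp add: power2_commute)
      also have "\<dots> = (\<integral>\<^sup>+s. ennreal ((norm (f s))\<^sup>2 / 2) \<partial>lborel)"
        using nn_integral_normal_density[OF \<tau>] by (subst nn_integral_multc) auto
      also have "(\<integral>\<^sup>+s. ennreal ((norm (f s))\<^sup>2 / 2) \<partial>lborel) + (\<integral>\<^sup>+s. ennreal ((norm (f s))\<^sup>2 / 2) \<partial>lborel) = N"
        unfolding N_def by (subst nn_integral_add[symmetric]) (auto simp flip: ennreal_plus)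
      finally show ?thesis .
    qed
    finally show ?thesis by (simp add: mult_left_mono)
  qed
  have "(\<integral>\<^sup>+\<omega>. ennreal ((norm (F \<omega>))\<^sup>2) \<partial>lborel) =
      (\<integral>\<^sup>+\<omega>. liminf (\<lambda>n. ennreal (w n \<omega> * (norm (F \<omega>))\<^sup>2)) \<partial>lborel)"
  proof (intro nn_integral_cong)
    fix \<omega>
    have "(\<lambda>n. \<omega> / real (Suc n)) \<longlonglongrightarrow> 0" by real_asymp
    then have "(\<lambda>n. w n \<omega>) \<longlonglongrightarrow> exp (- 0\<^sup>2 / 2)"
      unfolding w_def by (intro tendsto_intros) auto
    then have "(\<lambda>n. w n \<omega> * (norm (F \<omega>))\<^sup>2) \<longlonglongrightarrow> (norm (F \<omega>))\<^sup>2"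
      by (auto intro!: tendsto_eq_intros)
    then show "ennreal ((norm (F \<omega>))\<^sup>2) = liminf (\<lambda>n. ennreal (w n \<omega> * (norm (F \<omega>))\<^sup>2))"
      by (intro lim_imp_Liminf[symmetric] tendsto_ennrealI) auto
  qed
  \<comment> \<open>Fatou's lemma, since no integrable majorant is known before the bound is
    proved.\<close>
  also have "\<dots> \<le> liminf (\<lambda>n. \<integral>\<^sup>+\<omega>. ennreal (w n \<omega> * (norm (F \<omega>))\<^sup>2) \<partial>lborel)"
    by (rule nn_integral_liminf) measurable
  also have "\<dots> \<le> ennreal (2 * pi) * N"
    using step by (intro Liminf_le) auto
  finally show ?thesis unfolding F_def N_def .
qed

section \<open>Riemann--Lebesgue lemma and Schwartz functions\<close>

lemma fourier_add:
  assumes "integrable lborel f" "integrable lborel g"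
  shows "fourier (\<lambda>t. f t + g t) \<omega> = fourier f \<omega> + fourier g \<omega>"
  using assms unfolding fourier_def by (simp add: distrib_right integrable_fourier)

lemma fourier_diff:
  assumes "integrable lborel f" "integrable lborel g"
  shows "fourier (\<lambda>t. f t - g t) \<omega> = fourier f \<omega> - fourier g \<omega>"
  using assms unfolding fourier_def by (simp add: left_diff_distrib integrable_fourier)

lemma fourier_mult_left: "fourier (\<lambda>t. c * f t) \<omega> = c * fourier f \<omega>"
  unfolding fourier_def mult.assoc by (rule integral_mult_right_zero)

lemma tendsto_divide_norm: "((\<lambda>x::real. c / norm x) \<longlongrightarrow> (0::real)) at_infinity"
  by (rule tendsto_divide_0[OF tendsto_const filterlim_at_top_imp_at_infinity[OF filterlim_norm_at_top]])

text \<open>Dominated convergence gives convergence in \<open>L^1\<close>, hence uniform convergence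
  of the transforms; one fixed \<open>s i\<close> then decides the behaviour at infinity up to
  \<open>e / 2\<close>.\<close>

lemma fourier_vanishes_lim:
  assumes s: "\<And>i. (fourier (s i) \<longlongrightarrow> 0) at_infinity"
    and [measurable]: "\<And>i. s i \<in> borel_measurable borel"
    and lim: "\<And>x. (\<lambda>i. s i x) \<longlonglongrightarrow> f x"
    and bound: "\<And>i x. norm (s i x) \<le> w x" and w: "integrable lborel w"
  shows "(fourier f \<longlongrightarrow> 0) at_infinity"
proof (rule tendstoI)
  fix e :: real assume e: "0 < e"
  have [measurable]: "w \<in> borel_measurable borel"
    using borel_measurable_integrable[OF w] by simp
  have [measurable]: "f \<in> borel_measurable borel"
    by (rule borel_measurable_LIMSEQ_metric[of s]) (rule assms(2), rule lim)
  have bf: "norm (f x) \<le> w x" for x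
    by (rule Lim_bounded[OF tendsto_norm[OF lim]]) (use bound in auto)
  have int_s: "integrable lborel (s i)" for i
    by (rule Bochner_Integration.integrable_bound[OF w])
       (simp_all add: order_trans[OF bound abs_ge_self])
  have int_f: "integrable lborel f"
    by (rule Bochner_Integration.integrable_bound[OF w])
       (simp_all add: order_trans[OF bf abs_ge_self])
  have "(\<lambda>i. LINT x|lborel. norm (f x - s i x)) \<longlonglongrightarrow> (LINT (x::real)|lborel. (0::real))"
  proof (rule integral_dominated_convergence)
    show "integrable lborel (\<lambda>x. 2 * w x)" using w by simp
    show "AE x in lborel. norm (norm (f x - s i x)) \<le> 2 * w x" for i
    proof (rule AE_I2)
      fix x
      show "norm (norm (f x - s i x)) \<le> 2 * w x"
        using norm_triangle_ineq4[of "f x" "s i x"] bf[of x] bound[of i x] by simp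
    qed
    have "(\<lambda>i. norm (f x - s i x)) \<longlonglongrightarrow> norm (f x - f x)" for x
      by (intro tendsto_intros lim)
    then show "AE x in lborel. (\<lambda>i. norm (f x - s i x)) \<longlonglongrightarrow> 0" by simp
  qed measurable
  then have "\<forall>\<^sub>F i in sequentially. (LINT x|lborel. norm (f x - s i x)) < e / 2"
    using e by (intro order_tendstoD) auto
  then obtain i where i: "(LINT x|lborel. norm (f x - s i x)) < e / 2"
    using eventually_happens' sequentially_bot by blast
  have "\<forall>\<^sub>F \<omega> in at_infinity. dist (fourier (s i) \<omega>) 0 < e / 2"
    using e by (intro tendstoD[OF s]) auto
  then show "\<forall>\<^sub>F \<omega> in at_infinity. dist (fourier f \<omega>) 0 < e"
  proof eventually_elim
    case (elim \<omega>)
    have "norm (fourier f \<omega> - fourier (s i) \<omega>) < e / 2"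
      using norm_fourier_le[of "\<lambda>x. f x - s i x" \<omega>] i by (simp add: fourier_diff[OF int_f int_s])
    then show ?case
      using elim norm_triangle_sub[of "fourier f \<omega>" "fourier (s i) \<omega>"] by simp
  qed
qed

lemma fourier_indicator_Ioc_vanishes:
  "(fourier (indicator {a<..b}) \<longlongrightarrow> 0) at_infinity"
proof (cases "a \<le> b")
  case False
  then have "indicator {a<..b} = (\<lambda>t. 0 :: complex)" by auto
  then show ?thesis by (simp add: fourier_def[abs_def])
next
  case True
  have "norm (fourier (indicator {a<..b}) \<omega>) \<le> 2 / \<bar>\<omega>\<bar>" if "\<omega> \<noteq> 0" for \<omega>
  proof -
    \<comment> \<open>The endpoint is negligible, so the half-open interval may be replaced by the
      open one, over which the antiderivative is explicit.\<close>
    have "fourier (indicator {a<..b}) \<omega> = (LBINT t=a..b. cis (\<omega> * t))"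
      unfolding fourier_def interval_lebesgue_integral_def set_lebesgue_integral_def
      using True
      by (auto intro!: Bochner_Integration.integral_cong_AE AE_lborel_singleton[of b, THEN eventually_mono]
            simp: scaleR_conv_of_real split: split_indicator)
    also have "\<dots> = cis (\<omega> * b) / (\<i> * \<omega>) - cis (\<omega> * a) / (\<i> * \<omega>)"
    proof (rule interval_integral_FTC_finite)
      show "continuous_on {min a b..max a b} (\<lambda>t. cis (\<omega> * t))" by (intro continuous_intros)
      show "((\<lambda>t. cis (\<omega> * t) / (\<i> * \<omega>)) has_vector_derivative cis (\<omega> * x)) (at x within {min a b..max a b})" for x
        unfolding has_vector_derivative_def using that
        by (auto intro!: derivative_eq_intros simp: scaleR_conv_of_real fun_eq_iff field_simps)
    qed
    also have "norm \<dots> \<le> 1 / \<bar>\<omega>\<bar> + 1 / \<bar>\<omega>\<bar>"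
      by (rule order_trans[OF norm_triangle_ineq4]) (simp add: norm_divide norm_mult)
    finally show ?thesis by simp
  qed
  then have "\<forall>\<^sub>F \<omega> in at_infinity. norm (fourier (indicator {a<..b}) \<omega>) \<le> 2 / norm \<omega>"
    by (auto simp: eventually_at_infinity intro!: exI[of _ 1])
  then show ?thesis using tendsto_divide_norm by (rule Lim_null_comparison)
qed

text \<open>Dynkin's argument, starting from half-open intervals. The window \<open>{l<..u}\<close>
  keeps the complement step meaningful, because a complement in the whole line need not have an
  integrable indicator.\<close>

lemma fourier_indicator_vanishes:
  assumes A: "A \<in> sets borel"
  shows "(fourier (indicator (A \<inter> {l<..u})) \<longlongrightarrow> 0) at_infinity"
proof -
  have "emeasure lborel {l<..u} < \<infinity>" by (cases "l \<le> u") auto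
  then have int_Ioc: "integrable lborel (indicator {l<..u} :: real \<Rightarrow> real)"
    by (intro integrable_real_indicator) auto
  have int: "integrable lborel (indicator (B \<inter> {l<..u}) :: real \<Rightarrow> complex)" if "B \<in> sets borel" for B
  proof (rule Bochner_Integration.integrable_bound)
    show "integrable lborel (indicator {l<..u} :: real \<Rightarrow> real)" by (rule int_Ioc)
  qed (use that in \<open>auto split: split_indicator\<close>)
  let ?G = "range (\<lambda>(a, b). {a <.. b::real})"
  have sets: "sets borel = sigma_sets UNIV ?G"
    unfolding borel_sigma_sets_Ioc by (rule sets_measure_of) simp
  have "Int_stable ?G"
  proof (rule Int_stableI)
    fix A B assume "A \<in> ?G" "B \<in> ?G"
    then obtain a b c d where "A = {a<..b}" "B = {c<..d}" by auto
    then have "A \<inter> B = (\<lambda>(a, b). {a<..b}) (max a c, min b d)" by auto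
    then show "A \<inter> B \<in> ?G" by blast
  qed
  moreover have "?G \<subseteq> Pow UNIV" by simp
  moreover have "A \<in> sigma_sets UNIV ?G" using A unfolding sets .
  ultimately show ?thesis
  proof (induction rule: sigma_sets_induct_disjoint)
    case (basic A)
    then obtain a b where "A = {a<..b}" by auto
    then have "A \<inter> {l<..u} = {max a l<..min b u}" by auto
    then show ?case using fourier_indicator_Ioc_vanishes by simp
  next
    case empty
    show ?case by (simp add: fourier_def[abs_def])
  next
    case (compl A)
    then have [measurable]: "A \<in> sets borel" unfolding sets by simp
    have "indicator ((UNIV - A) \<inter> {l<..u}) = (\<lambda>t. indicator {l<..u} t - indicator (A \<inter> {l<..u}) t :: complex)"
      by (auto simp: fun_eq_iff split: split_indicator)
    moreover have "fourier (\<lambda>t. indicator {l<..u} t - indicator (A \<inter> {l<..u}) t) =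
        (\<lambda>\<omega>. fourier (indicator {l<..u}) \<omega> - fourier (indicator (A \<inter> {l<..u})) \<omega>)"
      using int[of UNIV] int[of A] by (intro ext fourier_diff) auto
    ultimately show ?case
      using tendsto_diff[OF fourier_indicator_Ioc_vanishes[of l u] compl.IH] by simp
  next
    case (union F)
    have F[measurable]: "F i \<in> sets borel" for i using union unfolding sets by auto
    \<comment> \<open>Finite partial unions follow from additivity by disjointness; the window is
      then the majorant for the passage to the countable union.\<close>
    have part: "(fourier (indicator ((\<Union>i<n. F i) \<inter> {l<..u})) \<longlongrightarrow> 0) at_infinity" for n
    proof (induction n)
      case 0
      show ?case by (simp add: fourier_def[abs_def])
    next
      case (Suc n)
      have disj: "t \<notin> F i" if "t \<in> F n" "i < n" for t i
        using disjoint_family_onD[OF union(1), of i n] that by auto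
      have "indicator ((\<Union>i<Suc n. F i) \<inter> {l<..u}) =
          (\<lambda>t. indicator ((\<Union>i<n. F i) \<inter> {l<..u}) t + indicator (F n \<inter> {l<..u}) t :: complex)"
        by (auto simp: fun_eq_iff lessThan_Suc dest: disj split: split_indicator)
      moreover have "fourier (\<lambda>t. indicator ((\<Union>i<n. F i) \<inter> {l<..u}) t + indicator (F n \<inter> {l<..u}) t) =
        (\<lambda>\<omega>. fourier (indicator ((\<Union>i<n. F i) \<inter> {l<..u})) \<omega> + fourier (indicator (F n \<inter> {l<..u})) \<omega>)"
        using int by (intro ext fourier_add) auto
      ultimately show ?case
        using tendsto_add[OF Suc.IH union(3)[of n]] by simp
    qed
    show ?case
    proof (rule fourier_vanishes_lim[OF part])
      show "(\<lambda>n. indicator ((\<Union>i<n. F i) \<inter> {l<..u}) x :: complex) \<longlonglongrightarrow> indicator ((\<Union>i. F i) \<inter> {l<..u}) x" for x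
        unfolding indicator_inter_arith
        by (intro tendsto_mult tendsto_const LIMSEQ_indicator_UN)
      show "norm (indicator ((\<Union>i<n. F i) \<inter> {l<..u}) x :: complex) \<le> indicator {l<..u} x" for n x
        by (auto split: split_indicator)
      show "integrable lborel (indicator {l<..u} :: real \<Rightarrow> real)" by (rule int_Ioc)
    qed measurable
  qed
qed

theorem riemann_lebesgue:
  assumes "integrable lborel f"
  shows "(fourier f \<longlongrightarrow> 0) at_infinity"
  using assms
proof (induction rule: integrable_induct)
  case (base A c)
  then have [measurable]: "A \<in> sets borel" by simp
  have iA: "integrable lborel (indicator A :: real \<Rightarrow> real)" using base by simp
  \<comment> \<open>The set of finite measure is exhausted by its intersections with bounded
    windows, its own indicator being the majorant.\<close>
  have "(fourier (indicator A) \<longlongrightarrow> 0) at_infinity"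
  proof (rule fourier_vanishes_lim[OF fourier_indicator_vanishes])
    show "A \<in> sets borel" by simp
    show "(\<lambda>n. indicator (A \<inter> {- real n<..real n}) x :: complex) \<longlonglongrightarrow> indicator A x" for x
    proof (rule tendsto_eventually)
      have "\<forall>\<^sub>F n in sequentially. \<bar>x\<bar> < real n"
        using reals_Archimedean2[of "\<bar>x\<bar>"] by (auto simp: eventually_sequentially) (meson less_le_trans of_nat_le_iff)
      then show "\<forall>\<^sub>F n in sequentially. indicator (A \<inter> {- real n<..real n}) x = (indicator A x :: complex)"
        by eventually_elim (auto split: split_indicator)
    qed
    show "norm (indicator (A \<inter> {- real n<..real n}) x :: complex) \<le> indicator A x" for n x
      by (auto split: split_indicator)
  qed (use iA in measurable)
  then have "((\<lambda>\<omega>. c * fourier (indicator A) \<omega>) \<longlongrightarrow> 0) at_infinity"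
    by (rule tendsto_mult_right_zero)
  moreover have "(\<lambda>x. indicator A x *\<^sub>R c) = (\<lambda>x. c * indicator A x)"
    by (auto split: split_indicator)
  ultimately show ?case by (simp add: fourier_mult_left[abs_def])
next
  case (add f g)
  have "fourier (\<lambda>x. f x + g x) = (\<lambda>\<omega>. fourier f \<omega> + fourier g \<omega>)"
    using add by (intro ext fourier_add)
  then show ?case using tendsto_add[OF add.IH] by simp
next
  case (lim f s)
  \<comment> \<open>The factor 2 is the bound on the approximating functions that the induction rule
    provides.\<close>
  show ?case
    using lim by (intro fourier_vanishes_lim[of s f "\<lambda>x. 2 * norm (f x)"]) auto
qed

section \<open>Schwartz functions and the inverse transform of distributions\<close>

lemma nth_deriv_has_vector_derivative:
  assumes "smooth \<phi>"
  shows "(nth_deriv n \<phi> has_vector_derivative nth_deriv (Suc n) \<phi> x) (at x)"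
  using assms unfolding smooth_def by (simp add: vector_derivative_works nth_deriv_def)

lemma continuous_on_nth_deriv:
  assumes "smooth \<phi>"
  shows "continuous_on UNIV (nth_deriv n \<phi>)"
  using nth_deriv_has_vector_derivative[OF assms]
  by (meson continuous_at_imp_continuous_on has_vector_derivative_continuous)

text \<open>Integration by parts, carried out as the fundamental theorem on the whole line for
  \<open>\<phi> t * cis (\<omega> * t)\<close>, whose boundary values vanish. The positive exponent
  of the kernel produces the minus sign.\<close>

lemma fourier_derivative:
  assumes \<phi>: "integrable lborel \<phi>" and \<phi>': "integrable lborel \<phi>'"
    and deriv: "\<And>x. (\<phi> has_vector_derivative \<phi>' x) (at x)" and cont: "continuous_on UNIV \<phi>'"
    and top: "(\<phi> \<longlongrightarrow> 0) at_top" and bot: "(\<phi> \<longlongrightarrow> 0) at_bot"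
  shows "fourier \<phi>' \<omega> = - \<i> * of_real \<omega> * fourier \<phi> \<omega>"
proof -
  let ?F = "\<lambda>t. \<phi> t * cis (\<omega> * t)"
  let ?f = "\<lambda>t. \<phi>' t * cis (\<omega> * t) + \<i> * of_real \<omega> * (\<phi> t * cis (\<omega> * t))"
  have int: "integrable lborel ?f"
    by (intro Bochner_Integration.integrable_add integrable_mult_right integrable_fourier \<phi> \<phi>')
  have "(LBINT t=-\<infinity>..\<infinity>. ?f t) = 0 - 0"
  proof (rule interval_integral_FTC_integrable)
    have "((\<lambda>t. cis (\<omega> * t)) has_vector_derivative \<i> * of_real \<omega> * cis (\<omega> * x)) (at x)" for x
      unfolding has_vector_derivative_def
      by (auto intro!: derivative_eq_intros simp: scaleR_conv_of_real mult_ac)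
    note d = has_vector_derivative_mult[OF deriv this]
    have eq: "\<phi> x * (\<i> * of_real \<omega> * cis (\<omega> * x)) + \<phi>' x * cis (\<omega> * x) = ?f x" for x
      by (simp add: algebra_simps)
    show "(?F has_vector_derivative ?f x) (at x)" for x
      using d[of x] unfolding eq .
    have "isCont \<phi> x" "isCont \<phi>' x" for x
      using has_vector_derivative_continuous[OF deriv] cont
      by (auto simp: continuous_on_eq_continuous_at)
    moreover have "isCont (\<lambda>t. cis (\<omega> * t)) x" for x
      using continuous_on_cis[of UNIV "\<lambda>t. \<omega> * t"]
      by (auto simp: continuous_on_eq_continuous_at intro: continuous_intros)
    ultimately show "isCont ?f x" for x by (intro continuous_intros)
    show "set_integrable lborel (einterval (- \<infinity>) \<infinity>) ?f"
      using int by (simp add: set_integrable_def)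
    have *: "(?F \<longlongrightarrow> 0) F" if "(\<phi> \<longlongrightarrow> 0) F" for F
      using tendsto_norm_zero[OF that] by - (rule tendsto_norm_zero_cancel, simp add: norm_mult)
    show "((?F \<circ> real_of_ereal) \<longlongrightarrow> 0) (at_right (- \<infinity>))" "((?F \<circ> real_of_ereal) \<longlongrightarrow> 0) (at_left \<infinity>)"
      using *[OF top] *[OF bot] by (simp_all only: ereal_tendsto_simps)
  qed auto
  then have "(LINT t|lborel. ?f t) = 0"
    unfolding interval_lebesgue_integral_def set_lebesgue_integral_def by simp
  then have "fourier \<phi>' \<omega> + \<i> * of_real \<omega> * fourier \<phi> \<omega> = 0"
    unfolding fourier_def
    by (subst (asm) Bochner_Integration.integral_add)
       (simp_all only: integrable_mult_right integrable_fourier \<phi> \<phi>' integral_mult_right_zero)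
  then show ?thesis by (simp add: add_eq_0_iff)
qed

lemma integrable_inverse_one_plus_square: "integrable lborel (\<lambda>x::real. 1 / (1 + x\<^sup>2))"
  using integrable_inverse_1_plus_square by (simp add: set_integrable_def divide_inverse)

lemma integrable_if_quadratic_decay:
  fixes f :: "real \<Rightarrow> complex"
  assumes [measurable]: "f \<in> borel_measurable borel" and b: "\<And>x. norm (f x) * (1 + x\<^sup>2) \<le> C"
  shows "integrable lborel f"
proof (rule Bochner_Integration.integrable_bound)
  show "integrable lborel (\<lambda>x. C * (1 / (1 + x\<^sup>2)))"
    by (intro integrable_mult_right integrable_inverse_one_plus_square)
  show "AE x in lborel. norm (f x) \<le> norm (C * (1 / (1 + x\<^sup>2)))"
  proof (rule AE_I2)
    fix x :: real
    have pos: "0 < 1 + x\<^sup>2" by (simp add: add_pos_nonneg)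
    then have "norm (f x) \<le> C / (1 + x\<^sup>2)" using b[of x] by (simp add: le_divide_eq)
    also have "\<dots> \<le> norm (C * (1 / (1 + x\<^sup>2)))" using abs_ge_self[of "C / (1 + x\<^sup>2)"] by simp
    finally show "norm (f x) \<le> norm (C * (1 / (1 + x\<^sup>2)))" .
  qed
qed measurable

lemma schwartz_bound:
  assumes "schwartz \<phi>"
  obtains C where "\<And>x. \<bar>x\<bar> ^ k * norm (nth_deriv n \<phi> x) \<le> C"
proof -
  have "bounded (range (\<lambda>x. x ^ k *\<^sub>R nth_deriv n \<phi> x))"
    using assms unfolding schwartz_def by blast
  then obtain C where "\<And>x. norm (x ^ k *\<^sub>R nth_deriv n \<phi> x) \<le> C"
    unfolding bounded_iff by auto
  then show ?thesis by (intro that[of C]) (simp add: power_abs)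
qed

lemma schwartz_integrable:
  assumes "schwartz \<phi>"
  shows "integrable lborel (nth_deriv n \<phi>)"
proof -
  have sm: "smooth \<phi>" using assms by (simp add: schwartz_def)
  obtain C0 where C0: "\<And>x. \<bar>x\<bar> ^ 0 * norm (nth_deriv n \<phi> x) \<le> C0" using schwartz_bound[OF assms] by blast
  obtain C2 where C2: "\<And>x. \<bar>x\<bar> ^ 2 * norm (nth_deriv n \<phi> x) \<le> C2" using schwartz_bound[OF assms] by blast
  show ?thesis
  proof (rule integrable_if_quadratic_decay)
    show "nth_deriv n \<phi> \<in> borel_measurable borel"
      using continuous_on_nth_deriv[OF sm] by (rule borel_measurable_continuous_onI)
    show "norm (nth_deriv n \<phi> x) * (1 + x\<^sup>2) \<le> C0 + C2" for x
      using C0[of x] C2[of x] by (simp add: algebra_simps)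
  qed
qed

lemma schwartz_tendsto_0:
  assumes "schwartz \<phi>"
  shows "(nth_deriv n \<phi> \<longlongrightarrow> 0) at_infinity"
proof -
  obtain C where C: "\<And>x. \<bar>x\<bar> ^ 1 * norm (nth_deriv n \<phi> x) \<le> C" using schwartz_bound[OF assms] by blast
  have "\<forall>\<^sub>F x in at_infinity. norm (nth_deriv n \<phi> x) \<le> C / norm x"
    unfolding eventually_at_infinity
  proof (intro exI[of _ 1] allI impI)
    fix x :: real assume "1 \<le> norm x"
    then show "norm (nth_deriv n \<phi> x) \<le> C / norm x" using C[of x] by (simp add: le_divide_eq mult.commute)
  qed
  then show ?thesis using tendsto_divide_norm by (rule Lim_null_comparison)
qed

text \<open>Transforming the second derivative shows that \<open>\<omega> ^ 2\<close> times the
  transform is bounded; together with the bound on the transform itself this is quadratic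
  decay.\<close>

lemma schwartz_fourier_integrable:
  assumes "schwartz \<phi>"
  shows "integrable lborel (fourier \<phi>)"
proof (rule integrable_if_quadratic_decay)
  have sm: "smooth \<phi>" using assms by (simp add: schwartz_def)
  have n0: "nth_deriv 0 \<phi> = \<phi>" by (simp add: nth_deriv_def)
  have step: "fourier (nth_deriv (Suc n) \<phi>) \<omega> = - \<i> * of_real \<omega> * fourier (nth_deriv n \<phi>) \<omega>" for n \<omega>
  proof (rule fourier_derivative)
    show "(nth_deriv n \<phi> \<longlongrightarrow> 0) at_top" "(nth_deriv n \<phi> \<longlongrightarrow> 0) at_bot"
      using schwartz_tendsto_0[OF assms, of n]
      by (auto elim!: filterlim_mono simp: at_top_le_at_infinity at_bot_le_at_infinity)
  qed (use schwartz_integrable[OF assms] nth_deriv_has_vector_derivative[OF sm] continuous_on_nth_deriv[OF sm] in auto)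
  show "fourier \<phi> \<in> borel_measurable borel"
    using borel_measurable_integrable[OF schwartz_integrable[OF assms, of 0]]
    by (intro borel_measurable_fourier) (simp add: n0)
  have "fourier (nth_deriv 2 \<phi>) \<omega> = - of_real (\<omega>\<^sup>2) * fourier \<phi> \<omega>" for \<omega>
    using step[of 1 \<omega>] step[of 0 \<omega>]
    by (simp add: n0 numeral_2_eq_2[symmetric] power2_eq_square algebra_simps)
  then have "norm (fourier \<phi> \<omega>) * \<omega>\<^sup>2 = norm (fourier (nth_deriv 2 \<phi>) \<omega>)" for \<omega>
    by (simp add: norm_mult norm_power mult.commute)
  then show "norm (fourier \<phi> \<omega>) * (1 + \<omega>\<^sup>2) \<le>
      (LINT t|lborel. norm (\<phi> t)) + (LINT t|lborel. norm (nth_deriv 2 \<phi> t))" for \<omega>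
    using norm_fourier_le[of \<phi> \<omega>] norm_fourier_le[of "nth_deriv 2 \<phi>" \<omega>]
    by (simp add: distrib_left)
qed

lemma inv_fourier_eq_fourier:
  assumes [measurable]: "\<phi> \<in> borel_measurable borel"
  shows "inv_fourier \<phi> t = 1 / (2 * of_real pi) * fourier \<phi> (- t)"
proof -
  have "exp (- \<i> * complex_of_real (\<omega> * t)) = cis (- t * \<omega>)" for \<omega>
    by (simp add: cis_conv_exp mult.commute)
  then show ?thesis
    unfolding inv_fourier_def fourier_def by (subst integral_completion) auto
qed

text \<open>The transform of \<open>g\<close> is bounded but need not be integrable, so it is not
  inverted directly. The multiplication formula moves the transform to the test function, where
  inversion applies.\<close>

lemma dist_inv_fourier_regular_dist_fourier:
  assumes g: "integrable lborel g" and \<phi>: "schwartz \<phi>"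
  shows "dist_inv_fourier (regular_dist (fourier g)) \<phi> = (LINT t|lborel. g t * \<phi> t)"
proof -
  have n0: "nth_deriv 0 \<phi> = \<phi>" by (simp add: nth_deriv_def)
  have sm: "smooth \<phi>" using \<phi> by (simp add: schwartz_def)
  have int: "integrable lborel \<phi>" and cont: "continuous_on UNIV \<phi>"
    using schwartz_integrable[OF \<phi>, of 0] continuous_on_nth_deriv[OF sm, of 0] by (simp_all add: n0)
  have [measurable]: "\<phi> \<in> borel_measurable borel" "g \<in> borel_measurable borel"
    using borel_measurable_integrable[OF int] borel_measurable_integrable[OF g] by simp_all
  obtain C where C: "\<And>x. norm (\<phi> x) \<le> C"
    using schwartz_bound[OF \<phi>, of 0 0] by (auto simp: n0)
  have intF: "integrable lborel (\<lambda>x. fourier \<phi> (- x))"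
    using lborel_integrable_real_affine[OF schwartz_fourier_integrable[OF \<phi>], of "-1" 0] by simp
  let ?c = "1 / (2 * of_real pi) :: complex"
  have "dist_inv_fourier (regular_dist (fourier g)) \<phi> = (LINT x|lborel. fourier g x * (?c * fourier \<phi> (- x)))"
    unfolding dist_inv_fourier_def regular_dist_def inv_fourier_eq_fourier[OF \<open>\<phi> \<in> _\<close>]
    by (subst integral_completion) auto
  also have "\<dots> = (LINT x|lborel. g x * fourier (\<lambda>x. ?c * fourier \<phi> (- x)) x)"
    using fourier_multiplication_formula[OF g integrable_mult_right[OF intF, of ?c]] by simp
  also have "\<dots> = (LINT x|lborel. g x * \<phi> x)"
    unfolding fourier_mult_left fourier_inversion[OF int cont C schwartz_fourier_integrable[OF \<phi>]] by simp
  finally show ?thesis .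
qed

text \<open>\<open>dist_supp\<close> tests with compactly supported functions, whereas the pairing
  is evaluated on Schwartz functions; this connects the two.\<close>

lemma test_function_on_imp_schwartz:
  assumes "test_function_on U \<phi>"
  shows "schwartz \<phi>"
  unfolding schwartz_def
proof (intro conjI allI)
  show sm: "smooth \<phi>" using assms by (simp add: test_function_on_def)
  fix k n
  define K where "K = closure {x. \<phi> x \<noteq> 0}"
  have K: "compact K" using assms by (simp add: test_function_on_def K_def)
  have zero: "\<forall>x. x \<notin> K \<longrightarrow> nth_deriv n \<phi> x = 0"
  proof (induction n)
    case 0
    show ?case using closure_subset[of "{x. \<phi> x \<noteq> 0}"] by (auto simp: K_def nth_deriv_def)
  next
    case (Suc n)
    show ?case
    proof safe
      fix x assume x: "x \<notin> K"
      \<comment> \<open>The derivative at x depends on a neighbourhood of x, and the complement of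
        the closed support is one.\<close>
      have "open (- K)" using K by (simp add: compact_imp_closed open_Compl)
      moreover have "((\<lambda>_. 0) has_vector_derivative (0::complex)) (at x)" by simp
      ultimately have "(nth_deriv n \<phi> has_vector_derivative 0) (at x)"
        using Suc x by (elim has_vector_derivative_transform_within_open) auto
      with nth_deriv_has_vector_derivative[OF sm] show "nth_deriv (Suc n) \<phi> x = 0"
        by (rule vector_derivative_unique_at)
    qed
  qed
  have "bounded ((\<lambda>x. x ^ k *\<^sub>R nth_deriv n \<phi> x) ` K)"
    by (intro compact_imp_bounded compact_continuous_image K continuous_intros
          continuous_on_subset[OF continuous_on_nth_deriv[OF sm]]) auto
  then have "bounded (insert 0 ((\<lambda>x. x ^ k *\<^sub>R nth_deriv n \<phi> x) ` K))" by simp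
  then show "bounded (range (\<lambda>x. x ^ k *\<^sub>R nth_deriv n \<phi> x))"
    by (rule bounded_subset) (use zero in auto)
qed

section \<open>Iterated primitives\<close>

text \<open>The interval is encoded by a cut-off inside an integral over the whole line. This makes
  measurability in parameters automatic and gives the value 0 for \<open>y \<le> c\<close>, without
  orientation.\<close>

definition prim :: "real \<Rightarrow> (real \<Rightarrow> 'b::{banach, second_countable_topology}) \<Rightarrow> real \<Rightarrow> 'b" where
  "prim c p y = (LINT x|lborel. (if c < x \<and> x < y then p x else 0))"

lemma integrable_restrict_Ioo:
  fixes p :: "real \<Rightarrow> 'b::{banach, second_countable_topology}"
  assumes p: "integrable lborel p"
  shows "integrable lborel (\<lambda>x. if c < x \<and> x < y then p x else 0)"
proof (rule Bochner_Integration.integrable_bound[OF p])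
  have [measurable]: "p \<in> borel_measurable borel"
    using borel_measurable_integrable[OF p] by simp
  show "(\<lambda>x. if c < x \<and> x < y then p x else 0) \<in> borel_measurable lborel" by measurable
qed auto

lemma borel_measurable_prim [measurable]:
  fixes f :: "'a \<Rightarrow> real \<Rightarrow> 'b::{banach, second_countable_topology}"
  assumes [measurable]: "case_prod f \<in> borel_measurable (N \<Otimes>\<^sub>M borel)" "g \<in> borel_measurable N"
  shows "(\<lambda>z. prim c (f z) (g z)) \<in> borel_measurable N"
  unfolding prim_def by measurable

lemma prim_cong: "(\<And>x. c < x \<Longrightarrow> x < y \<Longrightarrow> p x = q x) \<Longrightarrow> prim c p y = prim c q y"
  unfolding prim_def by (intro Bochner_Integration.integral_cong) auto

lemma prim_mult_left:
  fixes f :: "real \<Rightarrow> 'b::{real_normed_field, banach, second_countable_topology}"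
  shows "prim c (\<lambda>x. r * f x) y = r * prim c f y"
  unfolding prim_def
  by (subst integral_mult_right_zero[symmetric]) (intro Bochner_Integration.integral_cong, auto)

lemma prim_add:
  assumes "integrable lborel f" "integrable lborel g"
  shows "prim c (\<lambda>x. f x + g x) y = prim c f y + prim c g y"
  unfolding prim_def using assms
  by (subst Bochner_Integration.integral_add[symmetric])
     (auto intro!: integrable_restrict_Ioo Bochner_Integration.integral_cong)

lemma prim_diff:
  assumes "integrable lborel f" "integrable lborel g"
  shows "prim c (\<lambda>x. f x - g x) y = prim c f y - prim c g y"
  unfolding prim_def using assms
  by (subst Bochner_Integration.integral_diff[symmetric])
     (auto intro!: integrable_restrict_Ioo Bochner_Integration.integral_cong)

text \<open>\<open>k\<close> may fail to be integrable; its primitive is then 0 by convention, a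
  case that the sign condition on \<open>m\<close> covers.\<close>

lemma prim_mono:
  assumes m: "integrable lborel m" and le: "\<And>x. c < x \<Longrightarrow> x < y \<Longrightarrow> k x \<le> (m x :: real)"
    and m0: "\<And>x. c < x \<Longrightarrow> x < y \<Longrightarrow> 0 \<le> m x"
  shows "prim c k y \<le> prim c m y"
  unfolding prim_def
  by (rule integral_mono'[OF integrable_restrict_Ioo[OF m]]) (auto simp: le m0)

lemma norm_prim_le:
  assumes m: "integrable lborel m" and le: "\<And>x. c < x \<Longrightarrow> x < y \<Longrightarrow> norm (p x) \<le> m x"
  shows "norm (prim c p y) \<le> prim c m y"
proof -
  have "norm (prim c p y) \<le> prim c (\<lambda>x. norm (p x)) y"
    unfolding prim_def by (rule order_trans[OF integral_norm_bound]) (simp add: if_distrib cong: if_cong)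
  also have "\<dots> \<le> prim c m y"
    by (rule prim_mono[OF m le]) (use le norm_ge_zero order_trans in blast)+
  finally show ?thesis .
qed

lemma prim_nonneg: "(\<And>x. 0 \<le> m x) \<Longrightarrow> 0 \<le> (prim c m y :: real)"
  unfolding prim_def by (intro Bochner_Integration.integral_nonneg) auto

lemma prim_mono_right:
  fixes m :: "real \<Rightarrow> real"
  assumes "integrable lborel m" and "\<And>x. 0 \<le> m x" and "x \<le> y"
  shows "prim c m x \<le> prim c m y"
  unfolding prim_def using assms(2,3)
  by (intro integral_mono'[OF integrable_restrict_Ioo[OF assms(1)]]) auto

lemma prim_le_integral:
  fixes m :: "real \<Rightarrow> real"
  assumes "integrable lborel m" and "\<And>x. 0 \<le> m x"
  shows "prim c m y \<le> (LINT x|lborel. m x)"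
  unfolding prim_def using assms by (intro integral_mono'[OF assms(1)]) auto

text \<open>The product is an integral over a square, which the diagonal cuts into two triangles.
  Fubini takes the place of the product rule, since \<open>p\<close> and \<open>q\<close> are merely
  integrable.\<close>

lemma prim_mult:
  fixes p q :: "real \<Rightarrow> real"
  assumes p: "integrable lborel p" and q: "integrable lborel q"
  shows "prim c p y * prim c q y =
    prim c (\<lambda>x. p x * prim c q x) y + prim c (\<lambda>x. q x * prim c p x) y"
proof -
  have [measurable]: "p \<in> borel_measurable borel" "q \<in> borel_measurable borel"
    using borel_measurable_integrable[OF p] borel_measurable_integrable[OF q] by simp_all
  define P where "P x = (if c < x \<and> x < y then p x else 0)" for x
  define Q where "Q x = (if c < x \<and> x < y then q x else 0)" for x
  have [measurable]: "P \<in> borel_measurable borel" "Q \<in> borel_measurable borel"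
    unfolding P_def[abs_def] Q_def[abs_def] by measurable
  have iP: "integrable lborel P" and iQ: "integrable lborel Q"
    unfolding P_def[abs_def] Q_def[abs_def] using p q by (intro integrable_restrict_Ioo; simp)+
  have iPQ: "integrable (lborel \<Otimes>\<^sub>M lborel) (\<lambda>(s, t). P s * Q t)"
  proof (rule lborel_pair.Fubini_integrable)
    show "integrable lborel (\<lambda>s. LINT t|lborel. norm (case (s, t) of (s, t) \<Rightarrow> P s * Q t))"
      using iP by (simp add: abs_mult)
    show "AE s in lborel. integrable lborel (\<lambda>t. case (s, t) of (s, t) \<Rightarrow> P s * Q t)"
      using iQ by simp
  qed measurable
  define k1 where "k1 s t = (if t < s then P s * Q t else 0)" for s t
  define k2 where "k2 s t = (if s < t then P s * Q t else 0)" for s t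
  have ik1: "integrable (lborel \<Otimes>\<^sub>M lborel) (case_prod k1)"
    unfolding k1_def by (rule Bochner_Integration.integrable_bound[OF iPQ]) (measurable, auto)
  have ik2: "integrable (lborel \<Otimes>\<^sub>M lborel) (case_prod k2)"
    unfolding k2_def by (rule Bochner_Integration.integrable_bound[OF iPQ]) (measurable, auto)
  have row1: "integrable lborel (k1 s)" and row2: "integrable lborel (k2 s)" for s
    unfolding k1_def[abs_def] k2_def[abs_def]
    by (rule Bochner_Integration.integrable_bound[OF integrable_mult_right[OF iQ, of "P s"]]; (measurable | simp))+
  have split: "P s * prim c q y = (LINT t|lborel. k1 s t) + (LINT t|lborel. k2 s t)" for s
  proof -
    have "P s * prim c q y = (LINT t|lborel. P s * Q t)"
      unfolding prim_def Q_def by simp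
    also have "\<dots> = (LINT t|lborel. k1 s t + k2 s t)"
    proof (rule integral_cong_AE)
      \<comment> \<open>Only the diagonal point \<open>t = s\<close> is missed, a null set for each
        fixed s.\<close>
      show "AE t in lborel. P s * Q t = k1 s t + k2 s t"
        using AE_lborel_singleton[of s] by eventually_elim (auto simp: k1_def k2_def)
    qed (use row1[of s] row2[of s] in \<open>auto dest!: borel_measurable_integrable\<close>)
    also have "\<dots> = (LINT t|lborel. k1 s t) + (LINT t|lborel. k2 s t)"
      by (intro Bochner_Integration.integral_add row1 row2)
    finally show ?thesis .
  qed
  have "prim c p y * prim c q y = (LINT s|lborel. P s * prim c q y)"
    unfolding prim_def[of c p] P_def by (rule integral_mult_left_zero[symmetric])
  also have "\<dots> = (LINT s|lborel. LINT t|lborel. k1 s t) + (LINT s|lborel. LINT t|lborel. k2 s t)"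
    unfolding split
    using lborel_pair.integrable_fst[OF ik1] lborel_pair.integrable_fst[OF ik2]
    by (intro Bochner_Integration.integral_add) auto
  also have "(LINT s|lborel. LINT t|lborel. k2 s t) = (LINT t|lborel. LINT s|lborel. k2 s t)"
    by (rule lborel_pair.Fubini_integral[OF ik2, symmetric])
  also have "(LINT s|lborel. LINT t|lborel. k1 s t) = prim c (\<lambda>x. p x * prim c q x) y"
    unfolding prim_def[of c "\<lambda>x. p x * prim c q x"]
  proof (rule Bochner_Integration.integral_cong[OF refl])
    fix s
    have "(LINT t|lborel. k1 s t) = (LINT t|lborel. P s * (if c < t \<and> t < s then q t else 0))"
      by (rule Bochner_Integration.integral_cong) (auto simp: k1_def P_def Q_def)
    also have "\<dots> = P s * prim c q s" unfolding prim_def by (rule integral_mult_right_zero)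
    finally show "(LINT t|lborel. k1 s t) = (if c < s \<and> s < y then p s * prim c q s else 0)"
      by (simp add: P_def)
  qed
  also have "(LINT t|lborel. LINT s|lborel. k2 s t) = prim c (\<lambda>x. q x * prim c p x) y"
    unfolding prim_def[of c "\<lambda>x. q x * prim c p x"]
  proof (rule Bochner_Integration.integral_cong[OF refl])
    fix t
    have "(LINT s|lborel. k2 s t) = (LINT s|lborel. Q t * (if c < s \<and> s < t then p s else 0))"
      by (rule Bochner_Integration.integral_cong) (auto simp: k2_def P_def Q_def)
    also have "\<dots> = Q t * prim c p t" unfolding prim_def by (rule integral_mult_right_zero)
    finally show "(LINT s|lborel. k2 s t) = (if c < t \<and> t < y then q t * prim c p t else 0)"
      by (simp add: Q_def)
  qed
  finally show ?thesis .
qed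

lemma integrable_mult_prim_power:
  fixes m :: "real \<Rightarrow> real"
  assumes m: "integrable lborel m" and m0: "\<And>x. 0 \<le> m x"
  shows "integrable lborel (\<lambda>x. m x * prim c m x ^ k)"
proof (rule Bochner_Integration.integrable_bound)
  have [measurable]: "m \<in> borel_measurable borel"
    using borel_measurable_integrable[OF m] by simp
  show "integrable lborel (\<lambda>x. m x * (LINT x|lborel. m x) ^ k)" using m by simp
  show "(\<lambda>x. m x * prim c m x ^ k) \<in> borel_measurable lborel" by measurable
  show "AE x in lborel. norm (m x * prim c m x ^ k) \<le> norm (m x * (LINT x|lborel. m x) ^ k)"
    using m0 prim_nonneg[OF m0] prim_le_integral[OF m m0]
    by (intro AE_I2) (auto simp: abs_mult power_abs intro!: mult_left_mono power_mono)
qed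

text \<open>This is \<open>\<integral> u^k du\<close> with u the primitive of \<open>m\<close>.
  Since \<open>m\<close> is merely integrable, repeated use of \<open>prim_mult\<close> replaces the
  change of variables. The factorials in the estimates come from here.\<close>

lemma prim_mult_power:
  fixes m :: "real \<Rightarrow> real"
  assumes m: "integrable lborel m" and m0: "\<And>x. 0 \<le> m x"
  shows "prim c (\<lambda>x. m x * prim c m x ^ k) y = prim c m y ^ Suc k / real (Suc k)"
proof (induction k arbitrary: y)
  case (Suc k)
  have IH: "prim c (\<lambda>x. real (Suc k) * (m x * prim c m x ^ k)) y = prim c m y ^ Suc k" for y
    unfolding prim_mult_left Suc.IH by simp
  \<comment> \<open>The second factor is chosen so that its primitive is the power in the induction
    hypothesis. The unknown integral then occurs once and \<open>k + 1\<close> times, together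
    \<open>k + 2\<close> times.\<close>
  have "prim c m y * prim c m y ^ Suc k =
      prim c (\<lambda>x. m x * prim c m x ^ Suc k) y + prim c (\<lambda>x. real (Suc k) * (m x * prim c m x ^ k) * prim c m x) y"
    using prim_mult[OF m integrable_mult_right[OF integrable_mult_prim_power[OF m m0, of c k], of "real (Suc k)"], of c y]
    unfolding IH .
  also have "(\<lambda>x. real (Suc k) * (m x * prim c m x ^ k) * prim c m x) =
      (\<lambda>x. real (Suc k) * (m x * prim c m x ^ Suc k))"
    by (simp add: fun_eq_iff mult_ac)
  finally have "prim c m y ^ Suc (Suc k) = real (Suc (Suc k)) * prim c (\<lambda>x. m x * prim c m x ^ Suc k) y"
    unfolding prim_mult_left by (simp add: algebra_simps)
  then show ?case by (simp add: field_simps del: of_nat_Suc)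
qed simp

text \<open>The summands of the Neumann series of \<open>1 / (1 - A)\<close> applied to the constant
  1, where A is the conjugate-linear integral operator of the recursion. They are functions of the
  upper limit and involve one-dimensional integrals only.\<close>

primrec iter_term :: "real \<Rightarrow> (real \<Rightarrow> real) \<Rightarrow> nat \<Rightarrow> real \<Rightarrow> real \<Rightarrow> complex" where
  "iter_term c a 0 \<omega> y = 1"
| "iter_term c a (Suc j) \<omega> y =
    prim c (\<lambda>x. a x *\<^sub>R (cis (2 * \<omega> * (x - c)) * cnj (iter_term c a j \<omega> x))) y"

text \<open>The index is shifted: \<open>term_density c a j\<close> is the density of \<open>iter_term c a (Suc j)\<close>.
  Conjugation reflects a density and the factor \<open>e\<^bsup>2i\<omega>(x - c)\<^esup>\<close> translates it, whence the
  argument \<open>2 * (x - c) - t\<close>.\<close>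

primrec term_density :: "real \<Rightarrow> (real \<Rightarrow> real) \<Rightarrow> nat \<Rightarrow> real \<Rightarrow> real \<Rightarrow> real" where
  "term_density c a 0 y t = (if 0 < t \<and> t < 2 * (y - c) then a (c + t / 2) / 2 else 0)"
| "term_density c a (Suc j) y t =
    prim c (\<lambda>x. a x * term_density c a j x (2 * (x - c) - t)) y"

lemma borel_measurable_iter_term [measurable]:
  assumes [measurable]: "a \<in> borel_measurable borel" "f \<in> borel_measurable N" "g \<in> borel_measurable N"
  shows "(\<lambda>z. iter_term c a j (f z) (g z)) \<in> borel_measurable N"
proof -
  have "(\<lambda>p. iter_term c a j (fst p) (snd p)) \<in> borel_measurable (borel \<Otimes>\<^sub>M borel)"
  proof (induction j)
    case (Suc j)
    have [measurable]: "(\<lambda>z :: (real \<times> real) \<times> real. iter_term c a j (fst (fst z)) (snd z))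
        \<in> borel_measurable ((borel \<Otimes>\<^sub>M borel) \<Otimes>\<^sub>M borel)"
      using measurable_compose[OF _ Suc.IH, of "\<lambda>z :: (real \<times> real) \<times> real. (fst (fst z), snd z)"]
      by simp
    show ?case
      unfolding iter_term.simps by (rule borel_measurable_prim; (simp only: split_beta')?; measurable)
  qed simp
  from measurable_compose[OF _ this, of "\<lambda>z. (f z, g z)" N] show ?thesis by simp
qed

lemma borel_measurable_term_density [measurable]:
  assumes [measurable]: "a \<in> borel_measurable borel" "f \<in> borel_measurable N" "g \<in> borel_measurable N"
  shows "(\<lambda>z. term_density c a j (f z) (g z)) \<in> borel_measurable N"
proof -
  have "(\<lambda>p. term_density c a j (fst p) (snd p)) \<in> borel_measurable (borel \<Otimes>\<^sub>M borel)"
  proof (induction j)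
    case 0
    show ?case unfolding term_density.simps by measurable
  next
    case (Suc j)
    have [measurable]: "(\<lambda>z :: (real \<times> real) \<times> real. term_density c a j (snd z) (2 * (snd z - c) - snd (fst z)))
        \<in> borel_measurable ((borel \<Otimes>\<^sub>M borel) \<Otimes>\<^sub>M borel)"
      using measurable_compose[OF _ Suc.IH, of "\<lambda>z :: (real \<times> real) \<times> real. (snd z, 2 * (snd z - c) - snd (fst z))"]
      by simp
    show ?case
      unfolding term_density.simps by (rule borel_measurable_prim; (simp only: split_beta')?; measurable)
  qed
  from measurable_compose[OF _ this, of "\<lambda>z. (f z, g z)" N] show ?thesis by simp
qed

text \<open>The recursion integrates \<open>\<bar>a x\<bar>\<close> against the preceding power of
  its own primitive, and \<open>prim_mult_power\<close> adds one factor to the factorial at each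
  step.\<close>

lemma norm_iter_term_le:
  assumes a: "integrable lborel a"
  shows "norm (iter_term c a j \<omega> y) \<le> prim c (\<lambda>x. \<bar>a x\<bar>) y ^ j / fact j"
proof (induction j arbitrary: y)
  case (Suc j)
  let ?m = "\<lambda>x. \<bar>a x\<bar>"
  have m: "integrable lborel ?m" using a by simp
  have "norm (iter_term c a (Suc j) \<omega> y) \<le> prim c (\<lambda>x. (1 / fact j) * (?m x * prim c ?m x ^ j)) y"
    unfolding iter_term.simps
  proof (rule norm_prim_le)
    show "integrable lborel (\<lambda>x. (1 / fact j) * (?m x * prim c ?m x ^ j))"
      by (intro integrable_mult_right integrable_mult_prim_power m) simp
    show "norm (a x *\<^sub>R (cis (2 * \<omega> * (x - c)) * cnj (iter_term c a j \<omega> x))) \<le>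
        (1 / fact j) * (?m x * prim c ?m x ^ j)" for x
      using mult_left_mono[OF Suc.IH[of x], of "\<bar>a x\<bar>"] by (simp add: norm_mult)
  qed
  also have "\<dots> = (1 / fact j) * prim c (\<lambda>x. ?m x * prim c ?m x ^ j) y"
    by (rule prim_mult_left)
  also have "\<dots> = prim c ?m y ^ Suc j / fact (Suc j)"
    by (subst prim_mult_power[OF m]) (simp_all add: field_simps)
  finally show ?case .
qed simp

lemma integrable_iter_term_mult:
  assumes a: "integrable lborel a" and b: "integrable lborel b"
  shows "integrable lborel (\<lambda>x. a x *\<^sub>R (cis (2 * \<omega> * (x - c)) * cnj (iter_term c b j \<omega> x)))"
proof (rule Bochner_Integration.integrable_bound)
  have [measurable]: "a \<in> borel_measurable borel" "b \<in> borel_measurable borel"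
    using borel_measurable_integrable[OF a] borel_measurable_integrable[OF b] by simp_all
  let ?C = "(LINT x|lborel. \<bar>b x\<bar>) ^ j / fact j"
  show "integrable lborel (\<lambda>x. ?C * a x)" by (intro integrable_mult_right a)
  show "(\<lambda>x. a x *\<^sub>R (cis (2 * \<omega> * (x - c)) * cnj (iter_term c b j \<omega> x))) \<in> borel_measurable lborel"
    by measurable
  have "norm (iter_term c b j \<omega> x) \<le> ?C" for x
    using norm_iter_term_le[OF b, of c j \<omega> x]
    by (rule order_trans)
       (use b in \<open>intro divide_right_mono power_mono prim_le_integral prim_nonneg, auto\<close>)
  then have "\<bar>a x\<bar> * norm (iter_term c b j \<omega> x) \<le> \<bar>a x\<bar> * ?C" for x
    by (intro mult_left_mono) auto
  then show "AE x in lborel. norm (a x *\<^sub>R (cis (2 * \<omega> * (x - c)) * cnj (iter_term c b j \<omega> x)))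
      \<le> norm (?C * a x)"
    by (intro AE_I2) (simp add: norm_mult abs_mult mult.commute power_abs integral_nonneg)
qed

text \<open>Telescoping: b B - a A = (b - a) B + a (B - A), with A and B the preceding terms. One
  factor of the product is replaced by \<open>b - a\<close>, hence the exponent k for index
  \<open>Suc k\<close>. Since \<open>m\<close> dominates both functions, one primitive serves for
  both, and \<open>2 ^ k\<close> leaves room for adding the two contributions.\<close>

lemma norm_iter_term_diff_le:
  assumes a: "integrable lborel a" and b: "integrable lborel b"
  defines "m \<equiv> \<lambda>x. \<bar>a x\<bar> + \<bar>b x\<bar>"
  shows "norm (iter_term c b (Suc k) \<omega> y - iter_term c a (Suc k) \<omega> y) \<le>
    (LINT x|lborel. \<bar>b x - a x\<bar>) * (2 * prim c m y) ^ k / fact k"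
proof -
  define d where "d x = \<bar>b x - a x\<bar>" for x
  define \<delta> where "\<delta> = (LINT x|lborel. d x)"
  define e where "e x = cis (2 * \<omega> * (x - c))" for x
  have d: "integrable lborel d" and d0: "\<And>x. 0 \<le> d x"
    unfolding d_def[abs_def] using a b by auto
  have m: "integrable lborel m" and m0: "\<And>x. 0 \<le> m x"
    unfolding m_def using a b by auto
  have M0: "0 \<le> prim c m x" for x by (rule prim_nonneg[OF m0])
  have \<delta>0: "0 \<le> \<delta>" unfolding \<delta>_def using d0 by simp
  have diff: "iter_term c b (Suc j) \<omega> y - iter_term c a (Suc j) \<omega> y =
      prim c (\<lambda>x. (b x - a x) *\<^sub>R (e x * cnj (iter_term c b j \<omega> x)) +
        a x *\<^sub>R (e x * cnj (iter_term c b j \<omega> x - iter_term c a j \<omega> x))) y" for j y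
    unfolding iter_term.simps e_def
    by (subst prim_diff[symmetric, OF integrable_iter_term_mult[OF b b] integrable_iter_term_mult[OF a a]])
       (simp add: algebra_simps)
  have first: "norm ((b x - a x) *\<^sub>R (e x * cnj (iter_term c b j \<omega> x))) \<le> d x * (prim c m x ^ j / fact j)" for x j
  proof -
    have "prim c (\<lambda>x. \<bar>b x\<bar>) x \<le> prim c m x"
      by (rule prim_mono[OF m]) (auto simp: m_def)
    then have "prim c (\<lambda>x. \<bar>b x\<bar>) x ^ j / fact j \<le> prim c m x ^ j / fact j"
      by (intro divide_right_mono power_mono prim_nonneg) auto
    then have "norm (iter_term c b j \<omega> x) \<le> prim c m x ^ j / fact j"
      using norm_iter_term_le[OF b] order_trans by blast
    then show ?thesis
      using mult_left_mono[of "norm (iter_term c b j \<omega> x)" "prim c m x ^ j / fact j" "d x"] d0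
      by (simp add: norm_mult e_def d_def)
  qed
  have "norm (iter_term c b (Suc k) \<omega> y - iter_term c a (Suc k) \<omega> y) \<le> \<delta> * (2 * prim c m y) ^ k / fact k"
  proof (induction k arbitrary: y)
    case 0
    have "norm (iter_term c b (Suc 0) \<omega> y - iter_term c a (Suc 0) \<omega> y) \<le> prim c d y"
      unfolding diff by (rule norm_prim_le[OF d]) (simp add: norm_mult e_def d_def)
    also have "\<dots> \<le> \<delta>" unfolding \<delta>_def by (rule prim_le_integral[OF d d0])
    finally show ?case by simp
  next
    case (Suc k)
    let ?K = "prim c m y ^ Suc k / fact (Suc k)"
    let ?r = "\<delta> * 2 ^ k / fact k"
    have K0: "0 \<le> ?K" using M0 by simp
    have i1: "integrable lborel (\<lambda>x. ?K * d x)" by (intro integrable_mult_right d)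
    have i2: "integrable lborel (\<lambda>x. ?r * (m x * prim c m x ^ k))"
      by (intro integrable_mult_right integrable_mult_prim_power m m0)
    have "norm (iter_term c b (Suc (Suc k)) \<omega> y - iter_term c a (Suc (Suc k)) \<omega> y) \<le>
      prim c (\<lambda>x. ?K * d x + ?r * (m x * prim c m x ^ k)) y"
      unfolding diff[of "Suc k"]
    proof (rule norm_prim_le)
      show "integrable lborel (\<lambda>x. ?K * d x + ?r * (m x * prim c m x ^ k))"
        using i1 i2 by (rule Bochner_Integration.integrable_add)
      fix x assume x: "c < x" "x < y"
      \<comment> \<open>The primitive at x is replaced by its larger value at y, so that only
        \<open>d\<close> remains under the integral.\<close>
      have "prim c m x ^ Suc k / fact (Suc k) \<le> ?K"
        using x by (intro divide_right_mono power_mono prim_mono_right m m0 M0) auto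
      then have "d x * (prim c m x ^ Suc k / fact (Suc k)) \<le> d x * ?K"
        using d0 by (rule mult_left_mono)
      with first[of x "Suc k"] have A: "norm ((b x - a x) *\<^sub>R (e x * cnj (iter_term c b (Suc k) \<omega> x))) \<le> ?K * d x"
        unfolding mult.commute[of ?K] by (rule order_trans)
      have "norm (a x *\<^sub>R (e x * cnj (iter_term c b (Suc k) \<omega> x - iter_term c a (Suc k) \<omega> x))) =
          \<bar>a x\<bar> * norm (iter_term c b (Suc k) \<omega> x - iter_term c a (Suc k) \<omega> x)"
        by (simp add: norm_mult e_def del: iter_term.simps complex_cnj_diff)
      also have "\<dots> \<le> m x * (\<delta> * (2 * prim c m x) ^ k / fact k)"
        by (rule mult_mono[OF _ Suc.IH]) (auto simp: m_def)
      also have "\<dots> = ?r * (m x * prim c m x ^ k)"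
        by (simp add: power_mult_distrib)
      finally have B: "norm (a x *\<^sub>R (e x * cnj (iter_term c b (Suc k) \<omega> x - iter_term c a (Suc k) \<omega> x)))
          \<le> ?r * (m x * prim c m x ^ k)" .
      show "norm ((b x - a x) *\<^sub>R (e x * cnj (iter_term c b (Suc k) \<omega> x)) +
          a x *\<^sub>R (e x * cnj (iter_term c b (Suc k) \<omega> x - iter_term c a (Suc k) \<omega> x)))
          \<le> ?K * d x + ?r * (m x * prim c m x ^ k)"
        by (rule norm_triangle_mono[OF A B])
    qed
    also have "\<dots> = ?K * prim c d y + ?r * prim c (\<lambda>x. m x * prim c m x ^ k) y"
      unfolding prim_add[OF i1 i2] prim_mult_left ..
    also have "\<dots> \<le> ?K * \<delta> + ?r * (prim c m y ^ Suc k / real (Suc k))"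
      unfolding prim_mult_power[OF m m0] \<delta>_def
      by (intro add_mono mult_left_mono prim_le_integral d d0 K0 order_refl)
    \<comment> \<open>The summand 1 comes from \<open>b - a\<close>, the summand
      \<open>2 ^ k\<close> from the induction hypothesis; together they are at most
      \<open>2 ^ Suc k\<close>.\<close>
    also have "\<dots> = \<delta> * ?K * (1 + 2 ^ k)"
      by (simp add: divide_simps fact_Suc) (simp add: algebra_simps)
    also have "\<dots> \<le> \<delta> * ?K * 2 ^ Suc k"
      by (rule mult_left_mono[OF _ mult_nonneg_nonneg[OF \<delta>0 K0]]) simp
    also have "\<dots> = \<delta> * (2 * prim c m y) ^ Suc k / fact (Suc k)"
      by (simp add: power_mult_distrib)
    finally show ?case .
  qed
  then show ?thesis unfolding \<delta>_def d_def .
qed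

text \<open>If the reflected point \<open>2 * (x - c) - t\<close> lies strictly between 0 and
  \<open>2 * (x - c)\<close>, then so does t, and x < y only enlarges the bound. For t outside the
  range the integrand of the recursion therefore vanishes identically.\<close>

lemma term_density_support:
  "term_density c a j y t \<noteq> 0 \<Longrightarrow> 0 < t \<and> t < 2 * (y - c)"
proof (induction j arbitrary: y t)
  case 0
  then show ?case by (simp split: if_splits)
next
  case (Suc j)
  show ?case
  proof (rule ccontr)
    assume "\<not> ?case"
    then have "term_density c a j x (2 * (x - c) - t) = 0" if "c < x" "x < y" for x
      using Suc.IH[of x "2 * (x - c) - t"] that by argo
    then have "term_density c a (Suc j) y t = prim c (\<lambda>x. 0) y"
      unfolding term_density.simps by (intro prim_cong) simp
    then show False using Suc.prems by (simp add: prim_def)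
  qed
qed

section \<open>Densities of the iterated terms\<close>

lemma nn_integral_restrict_Ioo:
  assumes m: "integrable lborel m" and m0: "\<And>x. 0 \<le> m x"
  shows "(\<integral>\<^sup>+x. (if c < x \<and> x < y then ennreal (m x) else 0) \<partial>lborel) = ennreal (prim c m y)"
  unfolding prim_def
  by (subst nn_integral_eq_integral[symmetric, OF integrable_restrict_Ioo[OF m]])
     (auto simp: m0 intro!: nn_integral_cong)

text \<open>The substitution \<open>t = 2 * (x - c)\<close> turns the phase
  \<open>2 * \<omega> * (x - c)\<close> into \<open>\<omega> * t\<close>; the factor 1/2 in the
  density cancels its Jacobian.\<close>

lemma term_density_0_affine:
  "term_density c a 0 y (- 2 * c + 2 * x) = (if c < x \<and> x < y then a x / 2 else 0)"
proof -
  have "c + (- 2 * c + 2 * x) / 2 = x" by (simp add: field_simps)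
  then show ?thesis unfolding term_density.simps by auto
qed

text \<open>Tonelli applied to the recursion: the inner integral over t is invariant under
  reflection and translation. The estimate is made in \<open>ennreal\<close> because the
  integrability of the density is only deduced from it.\<close>

lemma nn_integral_term_density_le:
  assumes a: "integrable lborel a"
  shows "(\<integral>\<^sup>+t. ennreal \<bar>term_density c a j y t\<bar> \<partial>lborel) \<le>
    ennreal (prim c (\<lambda>x. \<bar>a x\<bar>) y ^ Suc j / fact (Suc j))"
proof (induction j arbitrary: y)
  case 0
  have [measurable]: "a \<in> borel_measurable borel"
    using borel_measurable_integrable[OF a] by simp
  have "(\<integral>\<^sup>+t. ennreal \<bar>term_density c a 0 y t\<bar> \<partial>lborel) =
      ennreal \<bar>2\<bar> * (\<integral>\<^sup>+x. ennreal \<bar>term_density c a 0 y (- 2 * c + 2 * x)\<bar> \<partial>lborel)"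
    by (rule nn_integral_real_affine) auto
  also have "\<dots> = (\<integral>\<^sup>+x. ennreal \<bar>2\<bar> * ennreal \<bar>term_density c a 0 y (- 2 * c + 2 * x)\<bar> \<partial>lborel)"
    by (rule nn_integral_cmult[symmetric]) measurable
  also have "\<dots> = (\<integral>\<^sup>+x. (if c < x \<and> x < y then ennreal \<bar>a x\<bar> else 0) \<partial>lborel)"
  proof (rule nn_integral_cong)
    fix x
    have "ennreal \<bar>2\<bar> * ennreal \<bar>a x / 2\<bar> = ennreal \<bar>a x\<bar>"
      by (subst ennreal_mult'[symmetric]) simp_all
    then show "ennreal \<bar>2\<bar> * ennreal \<bar>term_density c a 0 y (- 2 * c + 2 * x)\<bar> =
        (if c < x \<and> x < y then ennreal \<bar>a x\<bar> else 0)"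
      unfolding term_density_0_affine by simp
  qed
  also have "\<dots> = ennreal (prim c (\<lambda>x. \<bar>a x\<bar>) y)"
    using a by (intro nn_integral_restrict_Ioo) auto
  finally show ?case by simp
next
  case (Suc j)
  have [measurable]: "a \<in> borel_measurable borel"
    using borel_measurable_integrable[OF a] by simp
  let ?m = "\<lambda>x. \<bar>a x\<bar>"
  have m: "integrable lborel ?m" using a by simp
  let ?k = "\<lambda>x t. if c < x \<and> x < y then ennreal \<bar>a x\<bar> * ennreal \<bar>term_density c a j x (2 * (x - c) - t)\<bar> else 0"
  have "(\<integral>\<^sup>+t. ennreal \<bar>term_density c a (Suc j) y t\<bar> \<partial>lborel) \<le> (\<integral>\<^sup>+t. \<integral>\<^sup>+x. ?k x t \<partial>lborel \<partial>lborel)"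
  proof (rule nn_integral_mono)
    fix t
    have "ennreal \<bar>term_density c a (Suc j) y t\<bar> \<le>
      (\<integral>\<^sup>+x. ennreal (norm (if c < x \<and> x < y then a x * term_density c a j x (2 * (x - c) - t) else 0)) \<partial>lborel)"
      unfolding term_density.simps prim_def real_norm_def[symmetric] by (rule norm_integral_le_nn_integral)
    also have "\<dots> = (\<integral>\<^sup>+x. ?k x t \<partial>lborel)"
      by (rule nn_integral_cong) (auto simp: abs_mult ennreal_mult)
    finally show "ennreal \<bar>term_density c a (Suc j) y t\<bar> \<le> (\<integral>\<^sup>+x. ?k x t \<partial>lborel)" .
  qed
  also have "\<dots> = (\<integral>\<^sup>+x. \<integral>\<^sup>+t. ?k x t \<partial>lborel \<partial>lborel)"
    by (rule lborel_pair.Fubini') measurable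
  also have "\<dots> \<le> (\<integral>\<^sup>+x. (if c < x \<and> x < y then ennreal ((1 / fact (Suc j)) * (?m x * prim c ?m x ^ Suc j)) else 0) \<partial>lborel)"
  proof (rule nn_integral_mono)
    fix x
    have "(\<integral>\<^sup>+t. ennreal \<bar>a x\<bar> * ennreal \<bar>term_density c a j x (2 * (x - c) - t)\<bar> \<partial>lborel) =
        ennreal \<bar>a x\<bar> * (\<integral>\<^sup>+t. ennreal \<bar>term_density c a j x (2 * (x - c) + (- 1) * t)\<bar> \<partial>lborel)"
      by (subst nn_integral_cmult) auto
    also have "(\<integral>\<^sup>+t. ennreal \<bar>term_density c a j x (2 * (x - c) + (- 1) * t)\<bar> \<partial>lborel) =
        (\<integral>\<^sup>+t. ennreal \<bar>term_density c a j x t\<bar> \<partial>lborel)"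
      using nn_integral_real_affine[of "\<lambda>t. ennreal \<bar>term_density c a j x t\<bar>" "-1" "2 * (x - c)"] by simp
    also have "ennreal \<bar>a x\<bar> * \<dots> \<le> ennreal \<bar>a x\<bar> * ennreal (prim c ?m x ^ Suc j / fact (Suc j))"
      by (intro mult_left_mono Suc.IH) simp
    also have "\<dots> = ennreal ((1 / fact (Suc j)) * (?m x * prim c ?m x ^ Suc j))"
      by (subst ennreal_mult'[symmetric]) (auto simp: mult_ac)
    finally have le: "(\<integral>\<^sup>+t. ennreal \<bar>a x\<bar> * ennreal \<bar>term_density c a j x (2 * (x - c) - t)\<bar> \<partial>lborel) \<le>
        ennreal ((1 / fact (Suc j)) * (?m x * prim c ?m x ^ Suc j))" .
    show "(\<integral>\<^sup>+t. ?k x t \<partial>lborel) \<le>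
      (if c < x \<and> x < y then ennreal ((1 / fact (Suc j)) * (?m x * prim c ?m x ^ Suc j)) else 0)"
    proof (cases "c < x \<and> x < y")
      case True
      then show ?thesis using le by (simp only: if_True simp_thms)
    qed auto
  qed
  also have "\<dots> = ennreal (prim c (\<lambda>x. (1 / fact (Suc j)) * (?m x * prim c ?m x ^ Suc j)) y)"
    by (intro nn_integral_restrict_Ioo integrable_mult_right integrable_mult_prim_power m)
       (auto simp del: power_Suc fact_Suc intro!: mult_nonneg_nonneg divide_nonneg_nonneg zero_le_power prim_nonneg)
  also have "prim c (\<lambda>x. (1 / fact (Suc j)) * (?m x * prim c ?m x ^ Suc j)) y =
      prim c ?m y ^ Suc (Suc j) / fact (Suc (Suc j))"
    unfolding prim_mult_left prim_mult_power[OF m abs_ge_zero] by (simp add: field_simps)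
  finally show ?case .
qed

lemma integrable_term_density:
  assumes a: "integrable lborel a"
  shows "integrable lborel (term_density c a j y)"
proof (rule integrableI_bounded)
  have [measurable]: "a \<in> borel_measurable borel"
    using borel_measurable_integrable[OF a] by simp
  show "term_density c a j y \<in> borel_measurable lborel"
    by (rule borel_measurable_term_density[of a "\<lambda>_. y" lborel "\<lambda>t. t"]) measurable
  show "(\<integral>\<^sup>+t. ennreal (norm (term_density c a j y t)) \<partial>lborel) < \<infinity>"
    unfolding real_norm_def infinity_ennreal_def
    by (rule le_less_trans[OF nn_integral_term_density_le[OF a] ennreal_less_top])
qed

lemma integral_term_density_le:
  assumes a: "integrable lborel a"
  shows "(LINT t|lborel. \<bar>term_density c a j y t\<bar>) \<le> prim c (\<lambda>x. \<bar>a x\<bar>) y ^ Suc j / fact (Suc j)"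
proof -
  have "ennreal (LINT t|lborel. \<bar>term_density c a j y t\<bar>) = (\<integral>\<^sup>+t. ennreal \<bar>term_density c a j y t\<bar> \<partial>lborel)"
    using integrable_term_density[OF a] by (intro nn_integral_eq_integral[symmetric]) auto
  also note nn_integral_term_density_le[OF a]
  finally show ?thesis
    by (subst (asm) ennreal_le_iff) (auto simp del: power_Suc intro!: divide_nonneg_nonneg zero_le_power prim_nonneg)
qed

text \<open>Fubini applied to the recursion of the density. Conjugation acts on the kernel alone, as
  the densities are real.\<close>

lemma iter_term_eq_fourier:
  assumes a: "integrable lborel a"
  shows "iter_term c a (Suc j) \<omega> y = fourier (\<lambda>t. of_real (term_density c a j y t)) \<omega>"
proof (induction j arbitrary: y)
  case 0
  have "fourier (\<lambda>t. of_real (term_density c a 0 y t)) \<omega> =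
      \<bar>2\<bar> *\<^sub>R (LINT x|lborel. of_real (term_density c a 0 y (- 2 * c + 2 * x)) * cis (\<omega> * (- 2 * c + 2 * x)))"
    unfolding fourier_def by (rule lborel_integral_real_affine) simp
  also have "\<dots> = (LINT x|lborel. \<bar>2\<bar> *\<^sub>R (of_real (term_density c a 0 y (- 2 * c + 2 * x)) * cis (\<omega> * (- 2 * c + 2 * x))))"
    by simp
  also have "\<dots> = iter_term c a (Suc 0) \<omega> y"
    unfolding iter_term.simps prim_def term_density_0_affine
    by (rule Bochner_Integration.integral_cong)
       (auto simp: scaleR_conv_of_real algebra_simps)
  finally show ?case by simp
next
  case (Suc j)
  have [measurable]: "a \<in> borel_measurable borel"
    using borel_measurable_integrable[OF a] by simp
  let ?D = "term_density c a j"
  define K where "K x t = of_real (if c < x \<and> x < y then a x * ?D x (2 * (x - c) - t) else 0) * cis (\<omega> * t)" for x t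
  have D_int: "integrable lborel (\<lambda>t. ?D x (2 * (x - c) - t))" for x
    using lborel_integrable_real_affine[OF integrable_term_density[OF a, of c j x], of "-1" "2 * (x - c)"] by simp
  have K_int: "integrable (lborel \<Otimes>\<^sub>M lborel) (case_prod K)"
  proof (rule lborel_pair.Fubini_integrable)
    show "case_prod K \<in> borel_measurable (lborel \<Otimes>\<^sub>M lborel)"
      unfolding K_def split_beta' by measurable
    show "AE x in lborel. integrable lborel (\<lambda>t. case (x, t) of (x, t) \<Rightarrow> K x t)"
    proof (rule AE_I2)
      fix x
      show "integrable lborel (\<lambda>t. case (x, t) of (x, t) \<Rightarrow> K x t)"
      proof (cases "c < x \<and> x < y")
        case True
        then show ?thesis
          using integrable_fourier[OF integrable_of_real[OF integrable_mult_right[OF D_int, of "a x" x]], of \<omega>]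
          by (simp add: K_def)
      next
        case False
        then have "K x t = 0" for t by (simp only: K_def if_False of_real_0 mult_zero_left)
        then show ?thesis by simp
      qed
    qed
    show "integrable lborel (\<lambda>x. LINT t|lborel. norm (case (x, t) of (x, t) \<Rightarrow> K x t))"
    proof (rule Bochner_Integration.integrable_bound)
      \<comment> \<open>The total mass of \<open>\<bar>a x\<bar>\<close> replaces the primitive, so
        that the constant does not depend on x.\<close>
      let ?C = "(LINT x|lborel. \<bar>a x\<bar>) ^ Suc j / fact (Suc j)"
      show "integrable lborel (\<lambda>x. ?C * \<bar>a x\<bar>)" using a by (intro integrable_mult_right) simp
      show "(\<lambda>x. LINT t|lborel. norm (case (x, t) of (x, t) \<Rightarrow> K x t)) \<in> borel_measurable lborel"
        unfolding K_def by measurable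
      show "AE x in lborel. norm (LINT t|lborel. norm (case (x, t) of (x, t) \<Rightarrow> K x t)) \<le> norm (?C * \<bar>a x\<bar>)"
      proof (rule AE_I2)
        fix x
        have C0: "0 \<le> ?C" by simp
        have "(LINT t|lborel. norm (case (x, t) of (x, t) \<Rightarrow> K x t)) =
            (if c < x \<and> x < y then \<bar>a x\<bar> * (LINT t|lborel. \<bar>?D x (2 * (x - c) + (- 1) * t)\<bar>) else 0)"
        proof (cases "c < x \<and> x < y")
          case True
          then show ?thesis by (simp add: K_def norm_mult abs_mult)
        next
          case False
          then have "K x t = 0" for t by (simp only: K_def if_False of_real_0 mult_zero_left)
          with False show ?thesis by auto
        qed
        also have "(LINT t|lborel. \<bar>?D x (2 * (x - c) + (- 1) * t)\<bar>) = (LINT t|lborel. \<bar>?D x t\<bar>)"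
          using lborel_integral_real_affine[of "-1" "\<lambda>t. \<bar>?D x t\<bar>" "2 * (x - c)"] by simp
        also have "(if c < x \<and> x < y then \<bar>a x\<bar> * (LINT t|lborel. \<bar>?D x t\<bar>) else 0) \<le> \<bar>a x\<bar> * ?C"
        proof -
          have "(LINT t|lborel. \<bar>?D x t\<bar>) \<le> ?C"
            by (rule order_trans[OF integral_term_density_le[OF a]])
               (use a in \<open>intro divide_right_mono power_mono prim_le_integral prim_nonneg, auto\<close>)
          then have "\<bar>a x\<bar> * (LINT t|lborel. \<bar>?D x t\<bar>) \<le> \<bar>a x\<bar> * ?C"
            by (rule mult_left_mono) simp
          moreover have "0 \<le> \<bar>a x\<bar> * ?C" using C0 by (rule mult_nonneg_nonneg[OF abs_ge_zero])
          ultimately show ?thesis by (simp only: split: if_split) blast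
        qed
        finally show "norm (LINT t|lborel. norm (case (x, t) of (x, t) \<Rightarrow> K x t)) \<le> norm (?C * \<bar>a x\<bar>)"
          by (simp add: mult.commute abs_mult)
      qed
    qed
  qed
  have inner: "(LINT t|lborel. K x t) =
      (if c < x \<and> x < y then a x *\<^sub>R (cis (2 * \<omega> * (x - c)) * cnj (iter_term c a (Suc j) \<omega> x)) else 0)" for x
  proof -
    have "cis (2 * \<omega> * (x - c)) * cnj (iter_term c a (Suc j) \<omega> x) =
        (LINT t|lborel. cis (2 * \<omega> * (x - c)) * (of_real (?D x t) * cis (- \<omega> * t)))"
      unfolding Suc.IH cnj_fourier by (simp only: fourier_def complex_cnj_complex_of_real integral_mult_right_zero)
    \<comment> \<open>The two phases combine to that of the point \<open>2 * (x - c) - t\<close>;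
      taking this point as the new variable gives the integrand of the density recursion.\<close>
    also have "\<dots> = (LINT t|lborel. of_real (?D x t) * cis (\<omega> * (2 * (x - c) - t)))"
      by (rule Bochner_Integration.integral_cong) (auto simp: mult.left_commute cis_mult algebra_simps)
    also have "\<dots> = (LINT t|lborel. of_real (?D x (2 * (x - c) - t)) * cis (\<omega> * t))"
      by (subst lborel_integral_real_affine[of "-1" _ "2 * (x - c)"]) auto
    finally have *: "a x *\<^sub>R (cis (2 * \<omega> * (x - c)) * cnj (iter_term c a (Suc j) \<omega> x)) =
        of_real (a x) * (LINT t|lborel. of_real (?D x (2 * (x - c) - t)) * cis (\<omega> * t))"
      by (simp only: scaleR_conv_of_real)
    show ?thesis
    proof (cases "c < x \<and> x < y")
      case True
      then show ?thesis unfolding * K_def by (simp add: mult.assoc)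
    next
      case False
      then have "K x t = 0" for t by (simp only: K_def if_False of_real_0 mult_zero_left)
      with False show ?thesis by auto
    qed
  qed
  have "iter_term c a (Suc (Suc j)) \<omega> y = (LINT x|lborel. LINT t|lborel. K x t)"
    unfolding iter_term.simps(2)[of c a "Suc j"] prim_def inner ..
  also have "\<dots> = (LINT t|lborel. LINT x|lborel. K x t)"
    by (rule lborel_pair.Fubini_integral[OF K_int, symmetric])
  also have "\<dots> = (LINT t|lborel. of_real (term_density c a (Suc j) y t) * cis (\<omega> * t))"
  proof (rule Bochner_Integration.integral_cong[OF refl])
    fix t
    have "(LINT x|lborel. K x t) =
        (LINT x|lborel. of_real (if c < x \<and> x < y then a x * ?D x (2 * (x - c) - t) else 0)) * cis (\<omega> * t)"
      unfolding K_def by (rule integral_mult_left_zero)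
    also have "\<dots> = of_real (term_density c a (Suc j) y t) * cis (\<omega> * t)"
      unfolding term_density.simps prim_def by (subst integral_complex_of_real) simp
    finally show "(LINT x|lborel. K x t) = of_real (term_density c a (Suc j) y t) * cis (\<omega> * t)" .
  qed
  finally show ?case unfolding fourier_def .
qed

section \<open>The sum of the series\<close>

lemma summable_norm_iter_term:
  assumes a: "integrable lborel a"
  shows "summable (\<lambda>j. norm (iter_term c a j \<omega> y))"
proof (rule summable_comparison_test')
  show "summable (\<lambda>j. prim c (\<lambda>x. \<bar>a x\<bar>) y ^ j / fact j)"
    using exp_converges[of "prim c (\<lambda>x. \<bar>a x\<bar>) y"]
    by (auto simp: sums_iff divide_inverse mult.commute)
  show "norm (norm (iter_term c a j \<omega> y)) \<le> prim c (\<lambda>x. \<bar>a x\<bar>) y ^ j / fact j" for j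
    using norm_iter_term_le[OF a] by simp
qed

lemma norm_suminf_iter_term_le:
  assumes a: "integrable lborel a"
  shows "norm (1 + (\<Sum>j. iter_term c a (Suc j) \<omega> y)) \<le> exp (LINT x|lborel. \<bar>a x\<bar>)"
proof -
  let ?B = "prim c (\<lambda>x. \<bar>a x\<bar>) y"
  have B: "(\<lambda>j. ?B ^ j / fact j) sums exp ?B"
    using exp_converges[of ?B] by (simp add: divide_inverse mult.commute)
  note sn = summable_norm_iter_term[OF a, of c \<omega> y]
  have "1 + (\<Sum>j. iter_term c a (Suc j) \<omega> y) = (\<Sum>j. iter_term c a j \<omega> y)"
    using suminf_split_head[OF summable_norm_cancel[OF sn]] by simp
  also have "norm \<dots> \<le> (\<Sum>j. norm (iter_term c a j \<omega> y))"
    by (rule summable_norm[OF sn])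
  also have "\<dots> \<le> (\<Sum>j. ?B ^ j / fact j)"
    using B by (intro suminf_le norm_iter_term_le[OF a] sn) (simp add: sums_iff)
  also have "\<dots> = exp ?B" using B by (simp add: sums_iff)
  also have "\<dots> \<le> exp (LINT x|lborel. \<bar>a x\<bar>)"
    using a by (auto intro: prim_le_integral)
  finally show ?thesis .
qed

text \<open>The constant does not depend on the frequency, so this is a local Lipschitz bound in the
  supremum norm, from which continuity of the mapping follows.\<close>

lemma norm_suminf_iter_term_diff_le:
  assumes a: "integrable lborel a" and b: "integrable lborel b"
  shows "norm ((\<Sum>j. iter_term c b (Suc j) \<omega> y) - (\<Sum>j. iter_term c a (Suc j) \<omega> y)) \<le>
    (LINT x|lborel. \<bar>b x - a x\<bar>) * exp (2 * (LINT x|lborel. \<bar>a x\<bar> + \<bar>b x\<bar>))"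
proof -
  let ?m = "\<lambda>x. \<bar>a x\<bar> + \<bar>b x\<bar>"
  let ?\<delta> = "LINT x|lborel. \<bar>b x - a x\<bar>"
  let ?M = "2 * prim c ?m y"
  have m: "integrable lborel ?m" using a b by simp
  have M: "(\<lambda>j. ?\<delta> * ?M ^ j / fact j) sums (?\<delta> * exp ?M)"
    using sums_mult[OF exp_converges[of ?M], of ?\<delta>] by (simp add: divide_inverse mult.commute mult.left_commute)
  have s: "summable (\<lambda>j. iter_term c f (Suc j) \<omega> y)" if "integrable lborel f" for f
    using summable_norm_cancel[OF summable_norm_iter_term[OF that, of c \<omega> y]]
    by (subst summable_Suc_iff)
  have le: "norm (iter_term c b (Suc j) \<omega> y - iter_term c a (Suc j) \<omega> y) \<le> ?\<delta> * ?M ^ j / fact j" for j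
    by (rule norm_iter_term_diff_le[OF a b])
  have sn: "summable (\<lambda>j. norm (iter_term c b (Suc j) \<omega> y - iter_term c a (Suc j) \<omega> y))"
    by (rule summable_comparison_test'[OF sums_summable[OF M]]) (unfold real_norm_def abs_norm_cancel, rule le)
  have "(\<Sum>j. iter_term c b (Suc j) \<omega> y) - (\<Sum>j. iter_term c a (Suc j) \<omega> y) =
      (\<Sum>j. iter_term c b (Suc j) \<omega> y - iter_term c a (Suc j) \<omega> y)"
    by (rule suminf_diff[OF s[OF b] s[OF a]])
  also have "norm \<dots> \<le> (\<Sum>j. norm (iter_term c b (Suc j) \<omega> y - iter_term c a (Suc j) \<omega> y))"
    by (rule summable_norm[OF sn])
  also have "\<dots> \<le> (\<Sum>j. ?\<delta> * ?M ^ j / fact j)"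
    using M by (intro suminf_le le sn) (simp add: sums_iff)
  also have "\<dots> = ?\<delta> * exp ?M" using M by (simp add: sums_iff)
  also have "\<dots> \<le> ?\<delta> * exp (2 * (LINT x|lborel. ?m x))"
  proof (rule mult_left_mono)
    have "prim c ?m y \<le> (LINT x|lborel. ?m x)" by (rule prim_le_integral[OF m]) simp
    then show "exp ?M \<le> exp (2 * (LINT x|lborel. ?m x))" by simp
  qed simp
  finally show ?thesis .
qed

section \<open>The density of the whole series\<close>

definition total_density :: "real \<Rightarrow> (real \<Rightarrow> real) \<Rightarrow> real \<Rightarrow> real \<Rightarrow> real" where
  "total_density c a y t = (\<Sum>j. term_density c a j y t)"

lemma total_density_support:
  assumes "total_density c a y t \<noteq> 0"
  shows "0 < t \<and> t < 2 * (y - c)"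
proof (rule ccontr)
  assume "\<not> ?thesis"
  then have "term_density c a j y t = 0" for j
    using term_density_support by blast
  then show False using assms by (simp add: total_density_def)
qed

lemma summable_integral_term_density:
  assumes a: "integrable lborel a"
  shows "summable (\<lambda>j. LINT t|lborel. \<bar>term_density c a j y t\<bar>)"
proof (rule summable_comparison_test')
  let ?B = "prim c (\<lambda>x. \<bar>a x\<bar>) y"
  have "summable (\<lambda>j. ?B ^ j / fact j)"
    using exp_converges[of ?B] by (auto simp: sums_iff divide_inverse mult.commute)
  then show "summable (\<lambda>j. ?B ^ Suc j / fact (Suc j))"
    by (subst summable_Suc_iff)
  show "norm (LINT t|lborel. \<bar>term_density c a j y t\<bar>) \<le> ?B ^ Suc j / fact (Suc j)" for j
    using integral_term_density_le[OF a, of c j y] by (simp del: power_Suc fact_Suc)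
qed

text \<open>The \<open>L^1\<close> norms of the densities are summable, so by Tonelli the sum of
  their absolute values is finite almost everywhere. At the remaining points the value of
  \<open>total_density\<close> is immaterial, as they form a null set.\<close>

lemma AE_summable_term_density:
  assumes a: "integrable lborel a"
  shows "AE t in lborel. summable (\<lambda>j. \<bar>term_density c a j y t\<bar>)"
proof -
  have [measurable]: "a \<in> borel_measurable borel"
    using borel_measurable_integrable[OF a] by simp
  have "(\<integral>\<^sup>+t. (\<Sum>j. ennreal \<bar>term_density c a j y t\<bar>) \<partial>lborel) =
      (\<Sum>j. \<integral>\<^sup>+t. ennreal \<bar>term_density c a j y t\<bar> \<partial>lborel)"
    by (rule nn_integral_suminf) measurable
  also have "\<dots> = (\<Sum>j. ennreal (LINT t|lborel. \<bar>term_density c a j y t\<bar>))"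
    by (intro suminf_cong nn_integral_eq_integral integrable_abs integrable_term_density a) simp
  also have "\<dots> \<noteq> \<infinity>"
    unfolding infinity_ennreal_def
    by (rule ennreal_suminf_neq_top[OF summable_integral_term_density[OF a]])
       (rule Bochner_Integration.integral_nonneg, rule abs_ge_zero)
  finally have fin: "(\<integral>\<^sup>+t. (\<Sum>j. ennreal \<bar>term_density c a j y t\<bar>) \<partial>lborel) \<noteq> \<infinity>" .
  have "AE t in lborel. (\<Sum>j. ennreal \<bar>term_density c a j y t\<bar>) \<noteq> \<infinity>"
    by (rule nn_integral_PInf_AE[OF _ fin]) measurable
  then show ?thesis
  proof eventually_elim
    case (elim t)
    then show ?case by (intro summable_suminf_not_top) auto
  qed
qed

lemma integrable_total_density:
  assumes a: "integrable lborel a"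
  shows "integrable lborel (total_density c a y)"
  unfolding total_density_def[abs_def]
  using AE_summable_term_density[OF a] summable_integral_term_density[OF a]
  by (intro integrable_suminf integrable_term_density a) (simp_all only: real_norm_def)

lemma suminf_iter_term_eq_fourier:
  assumes a: "integrable lborel a"
  shows "(\<Sum>j. iter_term c a (Suc j) \<omega> y) = fourier (\<lambda>t. of_real (total_density c a y t)) \<omega>"
proof -
  let ?f = "\<lambda>j t. of_real (term_density c a j y t) * cis (\<omega> * t)"
  have "(\<Sum>j. iter_term c a (Suc j) \<omega> y) = (\<Sum>j. LINT t|lborel. ?f j t)"
    unfolding iter_term_eq_fourier[OF a] fourier_def ..
  also have "\<dots> = (LINT t|lborel. (\<Sum>j. ?f j t))"
  proof (rule integral_suminf[symmetric])
    show "integrable lborel (?f j)" for j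
      by (intro integrable_fourier integrable_of_real integrable_term_density a)
    show "AE t in lborel. summable (\<lambda>j. norm (?f j t))"
      using AE_summable_term_density[OF a] by (simp add: norm_mult)
    show "summable (\<lambda>j. LINT t|lborel. norm (?f j t))"
      using summable_integral_term_density[OF a] by (simp add: norm_mult)
  qed
  also have "\<dots> = (LINT t|lborel. of_real (total_density c a y t) * cis (\<omega> * t))"
  proof (rule integral_cong_AE)
    have [measurable]: "a \<in> borel_measurable borel"
      using borel_measurable_integrable[OF a] by simp
    show "(\<lambda>t. \<Sum>j. ?f j t) \<in> borel_measurable lborel" by measurable
    have [measurable]: "total_density c a y \<in> borel_measurable borel"
      using borel_measurable_integrable[OF integrable_total_density[OF a]] by simp
    show "(\<lambda>t. of_real (total_density c a y t) * cis (\<omega> * t)) \<in> borel_measurable lborel" by measurable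
    show "AE t in lborel. (\<Sum>j. ?f j t) = of_real (total_density c a y t) * cis (\<omega> * t)"
      using AE_summable_term_density[OF a, of c y]
    proof eventually_elim
      case (elim t)
      then have "summable (\<lambda>j. term_density c a j y t)" by (rule summable_rabs_cancel)
      then show ?case
        unfolding total_density_def
        by (subst suminf_of_real) (simp_all add: suminf_mult2[symmetric] summable_of_real)
    qed
  qed
  finally show ?thesis unfolding fourier_def .
qed

text \<open>Plancherel for the first term gives \<open>K\<close>. For each frequency,
  Cauchy--Schwarz for the measure \<open>\<bar>a x\<bar> dx\<close> bounds the square of the next
  term by \<open>A\<close> times the integral of the squares of the present one; integration over
  the frequency and Tonelli reduce this to the induction hypothesis. \<open>A ^ j\<close> counts the
  uses of Cauchy--Schwarz, and \<open>prim_mult_power\<close> supplies the factorial.\<close>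

lemma nn_integral_iter_term_square_le:
  assumes a: "integrable lborel a"
  defines "K \<equiv> ennreal (2 * pi) * (\<integral>\<^sup>+x. ennreal ((a x)\<^sup>2) \<partial>lborel)"
    and "A \<equiv> LINT x|lborel. \<bar>a x\<bar>"
  shows "(\<integral>\<^sup>+\<omega>. ennreal ((norm (iter_term c a (Suc j) \<omega> y))\<^sup>2) \<partial>lborel) \<le>
    K * ennreal (A ^ j * prim c (\<lambda>x. \<bar>a x\<bar>) y ^ j / fact j)"
proof (induction j arbitrary: y)
  case 0
  have [measurable]: "a \<in> borel_measurable borel"
    using borel_measurable_integrable[OF a] by simp
  have "(\<integral>\<^sup>+\<omega>. ennreal ((norm (iter_term c a (Suc 0) \<omega> y))\<^sup>2) \<partial>lborel) \<le>
      ennreal (2 * pi) * (\<integral>\<^sup>+t. ennreal ((norm (of_real (term_density c a 0 y t) :: complex))\<^sup>2) \<partial>lborel)"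
    unfolding iter_term_eq_fourier[OF a]
    by (intro plancherel_le integrable_of_real integrable_term_density a)
  also have "(\<integral>\<^sup>+t. ennreal ((norm (of_real (term_density c a 0 y t) :: complex))\<^sup>2) \<partial>lborel) =
      (\<integral>\<^sup>+t. ennreal ((term_density c a 0 y t)\<^sup>2) \<partial>lborel)"
    unfolding norm_of_real power2_abs ..
  also have "\<dots> = ennreal \<bar>2\<bar> * (\<integral>\<^sup>+x. ennreal ((term_density c a 0 y (- 2 * c + 2 * x))\<^sup>2) \<partial>lborel)"
    by (rule nn_integral_real_affine) auto
  also have "\<dots> = (\<integral>\<^sup>+x. ennreal \<bar>2\<bar> * ennreal ((term_density c a 0 y (- 2 * c + 2 * x))\<^sup>2) \<partial>lborel)"
    by (rule nn_integral_cmult[symmetric]) measurable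
  \<comment> \<open>The Jacobian 2 times the square of the factor 1/2 in the density is 1/2,
    estimated by 1.\<close>
  also have "\<dots> \<le> (\<integral>\<^sup>+x. ennreal ((a x)\<^sup>2) \<partial>lborel)"
  proof (rule nn_integral_mono)
    fix x
    have "ennreal \<bar>2\<bar> * ennreal ((a x / 2)\<^sup>2) = ennreal ((a x)\<^sup>2 / 2)"
      by (subst ennreal_mult'[symmetric]) (simp_all add: power_divide)
    also have "\<dots> \<le> ennreal ((a x)\<^sup>2)" by (rule ennreal_leI) simp
    finally show "ennreal \<bar>2\<bar> * ennreal ((term_density c a 0 y (- 2 * c + 2 * x))\<^sup>2) \<le> ennreal ((a x)\<^sup>2)"
      unfolding term_density_0_affine by simp
  qed
  finally show ?case by (simp add: K_def mult_left_mono)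
next
  case (Suc j)
  have [measurable]: "a \<in> borel_measurable borel"
    using borel_measurable_integrable[OF a] by simp
  let ?m = "\<lambda>x. \<bar>a x\<bar>"
  let ?r = "A ^ Suc j / fact j"
  have m: "integrable lborel ?m" using a by simp
  have A0: "0 \<le> A" unfolding A_def by simp
  have A_eq: "ennreal A = (\<integral>\<^sup>+x. ennreal \<bar>a x\<bar> \<partial>lborel)"
    unfolding A_def using a by (intro nn_integral_eq_integral[symmetric]) auto
  let ?T = "\<lambda>\<omega> x. ennreal (norm (iter_term c a (Suc j) \<omega> x))"
  \<comment> \<open>The square root of the weight goes into both factors of Cauchy--Schwarz; its own
    square has integral at most \<open>A\<close>.\<close>
  let ?s = "\<lambda>x. if c < x \<and> x < y then ennreal (sqrt \<bar>a x\<bar>) else 0"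
  have s2: "(?s x)\<^sup>2 \<le> ennreal \<bar>a x\<bar>" for x
    by (auto simp: ennreal_power)
  have point: "ennreal ((norm (iter_term c a (Suc (Suc j)) \<omega> y))\<^sup>2) \<le>
      ennreal A * (\<integral>\<^sup>+x. (?s x)\<^sup>2 * (?T \<omega> x)\<^sup>2 \<partial>lborel)" for \<omega>
  proof -
    have "ennreal (norm (iter_term c a (Suc (Suc j)) \<omega> y)) \<le>
      (\<integral>\<^sup>+x. ennreal (norm (if c < x \<and> x < y then
        a x *\<^sub>R (cis (2 * \<omega> * (x - c)) * cnj (iter_term c a (Suc j) \<omega> x)) else 0)) \<partial>lborel)"
      unfolding iter_term.simps(2)[of c a "Suc j"] prim_def by (rule norm_integral_le_nn_integral)
    also have "\<dots> = (\<integral>\<^sup>+x. ?s x * (?s x * ?T \<omega> x) \<partial>lborel)"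
    proof (rule nn_integral_cong)
      fix x
      have "ennreal (sqrt \<bar>a x\<bar>) * (ennreal (sqrt \<bar>a x\<bar>) * ?T \<omega> x) = ennreal (\<bar>a x\<bar> * norm (iter_term c a (Suc j) \<omega> x))"
        by (simp only: ennreal_mult'[symmetric] real_sqrt_ge_zero abs_ge_zero mult.assoc[symmetric] real_sqrt_mult_self abs_abs)
      then show "ennreal (norm (if c < x \<and> x < y then
        a x *\<^sub>R (cis (2 * \<omega> * (x - c)) * cnj (iter_term c a (Suc j) \<omega> x)) else 0)) = ?s x * (?s x * ?T \<omega> x)"
        by (simp add: norm_mult del: iter_term.simps)
    qed
    finally have "(ennreal (norm (iter_term c a (Suc (Suc j)) \<omega> y)))\<^sup>2 \<le> (\<integral>\<^sup>+x. ?s x * (?s x * ?T \<omega> x) \<partial>lborel)\<^sup>2"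
      by (rule power_mono) simp
    also have "\<dots> \<le> (\<integral>\<^sup>+x. (?s x)\<^sup>2 \<partial>lborel) * (\<integral>\<^sup>+x. (?s x * ?T \<omega> x)\<^sup>2 \<partial>lborel)"
      by (rule Cauchy_Schwarz_nn_integral) measurable
    also have "\<dots> \<le> ennreal A * (\<integral>\<^sup>+x. (?s x * ?T \<omega> x)\<^sup>2 \<partial>lborel)"
      unfolding A_eq by (intro mult_right_mono nn_integral_mono s2) simp
    finally show ?thesis by (simp add: ennreal_power power_mult_distrib del: iter_term.simps)
  qed
  have "(\<integral>\<^sup>+\<omega>. ennreal ((norm (iter_term c a (Suc (Suc j)) \<omega> y))\<^sup>2) \<partial>lborel) \<le>
      (\<integral>\<^sup>+\<omega>. ennreal A * (\<integral>\<^sup>+x. (?s x)\<^sup>2 * (?T \<omega> x)\<^sup>2 \<partial>lborel) \<partial>lborel)"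
    by (intro nn_integral_mono point)
  also have "\<dots> = ennreal A * (\<integral>\<^sup>+\<omega>. \<integral>\<^sup>+x. (?s x)\<^sup>2 * (?T \<omega> x)\<^sup>2 \<partial>lborel \<partial>lborel)"
    by (rule nn_integral_cmult) measurable
  also have "(\<integral>\<^sup>+\<omega>. \<integral>\<^sup>+x. (?s x)\<^sup>2 * (?T \<omega> x)\<^sup>2 \<partial>lborel \<partial>lborel) =
      (\<integral>\<^sup>+x. \<integral>\<^sup>+\<omega>. (?s x)\<^sup>2 * (?T \<omega> x)\<^sup>2 \<partial>lborel \<partial>lborel)"
    by (rule lborel_pair.Fubini') measurable
  also have "\<dots> \<le> (\<integral>\<^sup>+x. K * (if c < x \<and> x < y then ennreal (A ^ j / fact j * (?m x * prim c ?m x ^ j)) else 0) \<partial>lborel)"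
  proof (rule nn_integral_mono)
    fix x
    have "(\<integral>\<^sup>+\<omega>. (?s x)\<^sup>2 * (?T \<omega> x)\<^sup>2 \<partial>lborel) = (?s x)\<^sup>2 * (\<integral>\<^sup>+\<omega>. (?T \<omega> x)\<^sup>2 \<partial>lborel)"
      by (rule nn_integral_cmult) measurable
    also have "(\<integral>\<^sup>+\<omega>. (?T \<omega> x)\<^sup>2 \<partial>lborel) = (\<integral>\<^sup>+\<omega>. ennreal ((norm (iter_term c a (Suc j) \<omega> x))\<^sup>2) \<partial>lborel)"
      by (simp add: ennreal_power del: iter_term.simps)
    also have "(?s x)\<^sup>2 * \<dots> \<le> (?s x)\<^sup>2 * (K * ennreal (A ^ j * prim c ?m x ^ j / fact j))"
      by (intro mult_left_mono Suc.IH) simp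
    also have "\<dots> = K * (if c < x \<and> x < y then ennreal (A ^ j / fact j * (?m x * prim c ?m x ^ j)) else 0)"
    proof (cases "c < x \<and> x < y")
      case True
      have "ennreal \<bar>a x\<bar> * ennreal (A ^ j * prim c ?m x ^ j / fact j) =
          ennreal (A ^ j / fact j * (?m x * prim c ?m x ^ j))"
        by (subst ennreal_mult'[symmetric]) (simp_all add: mult_ac)
      with True show ?thesis by (simp add: ennreal_power mult.left_commute)
    qed auto
    finally show "(\<integral>\<^sup>+\<omega>. (?s x)\<^sup>2 * (?T \<omega> x)\<^sup>2 \<partial>lborel) \<le> \<dots>" .
  qed
  also have "\<dots> = K * ennreal (prim c (\<lambda>x. A ^ j / fact j * (?m x * prim c ?m x ^ j)) y)"
    by (subst nn_integral_cmult, measurable, subst nn_integral_restrict_Ioo)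
       (use A0 in \<open>auto intro!: integrable_mult_right integrable_mult_prim_power m mult_nonneg_nonneg divide_nonneg_nonneg zero_le_power prim_nonneg\<close>)
  also have "prim c (\<lambda>x. A ^ j / fact j * (?m x * prim c ?m x ^ j)) y = A ^ j * (prim c ?m y ^ Suc j / fact (Suc j))"
    unfolding prim_mult_left prim_mult_power[OF m abs_ge_zero] by (simp add: field_simps)
  also have "ennreal A * (K * ennreal (A ^ j * (prim c ?m y ^ Suc j / fact (Suc j)))) =
      K * ennreal (A ^ Suc j * prim c ?m y ^ Suc j / fact (Suc j))"
    using A0 by (simp add: mult.left_commute[of "ennreal A"] mult.assoc flip: ennreal_mult')
  finally show ?case by (simp add: mult_left_mono)
qed

text \<open>Cauchy--Schwarz for counting measure with weights \<open>(1 / 2) ^ j\<close> and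
  \<open>2 ^ j\<close>. The former sum to the constant 2; the growth of the latter is later absorbed
  by factorials.\<close>

lemma ennreal_norm_suminf_square_le:
  fixes T :: "nat \<Rightarrow> complex"
  assumes T: "summable (\<lambda>j. norm (T j))"
  shows "ennreal ((norm (\<Sum>j. T j))\<^sup>2) \<le> 2 * (\<Sum>j. ennreal (2 ^ j) * ennreal ((norm (T j))\<^sup>2))"
proof -
  let ?u = "\<lambda>j::nat. ennreal (sqrt ((1 / 2) ^ j))" and ?v = "\<lambda>j. ennreal (sqrt (2 ^ j) * norm (T j))"
  have uv: "?u j * ?v j = ennreal (norm (T j))" for j
  proof -
    have "sqrt ((1 / 2) ^ j) * (sqrt (2 ^ j) * norm (T j)) = norm (T j)"
      by (simp add: mult.assoc[symmetric] power_mult_distrib[symmetric] flip: real_sqrt_mult)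
    then show ?thesis by (subst ennreal_mult'[symmetric]) simp_all
  qed
  have "ennreal (norm (\<Sum>j. T j)) \<le> ennreal (\<Sum>j. norm (T j))"
    by (intro ennreal_leI summable_norm T)
  also have "\<dots> = (\<Sum>j. ?u j * ?v j)"
    unfolding uv by (rule suminf_ennreal2[symmetric]) (simp_all add: T)
  also have "\<dots> = (\<integral>\<^sup>+j. ?u j * ?v j \<partial>count_space UNIV)"
    by (rule nn_integral_count_space_nat[symmetric])
  finally have "(ennreal (norm (\<Sum>j. T j)))\<^sup>2 \<le> (\<integral>\<^sup>+j. ?u j * ?v j \<partial>count_space UNIV)\<^sup>2"
    by (rule power_mono) simp
  also have "\<dots> \<le> (\<integral>\<^sup>+j. (?u j)\<^sup>2 \<partial>count_space UNIV) * (\<integral>\<^sup>+j. (?v j)\<^sup>2 \<partial>count_space UNIV)"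
    by (rule Cauchy_Schwarz_nn_integral) auto
  also have "(\<integral>\<^sup>+j. (?u j)\<^sup>2 \<partial>count_space UNIV) = (\<Sum>j. ennreal ((1 / 2) ^ j))"
    unfolding nn_integral_count_space_nat by (intro suminf_cong) (simp add: ennreal_power)
  also have "\<dots> = 2"
    by (subst suminf_ennreal2) (auto simp: suminf_geometric summable_geometric)
  also have "(\<integral>\<^sup>+j. (?v j)\<^sup>2 \<partial>count_space UNIV) = (\<Sum>j. ennreal (2 ^ j) * ennreal ((norm (T j))\<^sup>2))"
    unfolding nn_integral_count_space_nat
    by (intro suminf_cong) (simp add: ennreal_power power_mult_distrib ennreal_mult')
  finally show ?thesis by (simp add: ennreal_power)
qed

lemma nn_integral_suminf_iter_term_square_finite:
  assumes a: "integrable lborel a" and a2: "integrable lborel (\<lambda>x. (a x)\<^sup>2)"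
  shows "(\<integral>\<^sup>+\<omega>. ennreal ((norm (\<Sum>j. iter_term c a (Suc j) \<omega> y))\<^sup>2) \<partial>lborel) < \<infinity>"
proof -
  have [measurable]: "a \<in> borel_measurable borel"
    using borel_measurable_integrable[OF a] by simp
  define K where "K = ennreal (2 * pi) * (\<integral>\<^sup>+x. ennreal ((a x)\<^sup>2) \<partial>lborel)"
  have K_fin: "K < \<infinity>"
    unfolding K_def by (subst nn_integral_eq_integral[OF a2]) (auto simp: ennreal_mult_less_top)
  let ?A = "LINT x|lborel. \<bar>a x\<bar>" and ?B = "prim c (\<lambda>x. \<bar>a x\<bar>) y"
  let ?T = "\<lambda>j \<omega>. iter_term c a (Suc j) \<omega> y"
  have A0: "0 \<le> ?A" by simp
  have B0: "0 \<le> ?B" by (rule prim_nonneg) simp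
  \<comment> \<open>In the base, 2 comes from the weights \<open>2 ^ j\<close>, \<open>?A\<close>
    from Cauchy--Schwarz and \<open>?B\<close> from the iterated primitives.\<close>
  let ?e = "\<lambda>j. (2 * ?A * ?B) ^ j / fact j"
  have se: "summable ?e"
    using exp_converges[of "2 * ?A * ?B"] by (auto simp: sums_iff divide_inverse mult.commute)
  have e0: "0 \<le> ?e j" for j using A0 B0 by simp
  have "(\<integral>\<^sup>+\<omega>. ennreal ((norm (\<Sum>j. ?T j \<omega>))\<^sup>2) \<partial>lborel) \<le>
      (\<integral>\<^sup>+\<omega>. 2 * (\<Sum>j. ennreal (2 ^ j) * ennreal ((norm (?T j \<omega>))\<^sup>2)) \<partial>lborel)"
  proof (rule nn_integral_mono)
    fix \<omega>
    have "summable (\<lambda>j. norm (?T j \<omega>))"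
      using summable_norm_iter_term[OF a, of c \<omega> y] by (subst summable_Suc_iff)
    then show "ennreal ((norm (\<Sum>j. ?T j \<omega>))\<^sup>2) \<le> 2 * (\<Sum>j. ennreal (2 ^ j) * ennreal ((norm (?T j \<omega>))\<^sup>2))"
      by (rule ennreal_norm_suminf_square_le)
  qed
  also have "\<dots> = 2 * (\<integral>\<^sup>+\<omega>. (\<Sum>j. ennreal (2 ^ j) * ennreal ((norm (?T j \<omega>))\<^sup>2)) \<partial>lborel)"
    by (rule nn_integral_cmult) measurable
  also have "(\<integral>\<^sup>+\<omega>. (\<Sum>j. ennreal (2 ^ j) * ennreal ((norm (?T j \<omega>))\<^sup>2)) \<partial>lborel) =
      (\<Sum>j. \<integral>\<^sup>+\<omega>. ennreal (2 ^ j) * ennreal ((norm (?T j \<omega>))\<^sup>2) \<partial>lborel)"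
    by (rule nn_integral_suminf) measurable
  also have "\<dots> = (\<Sum>j. ennreal (2 ^ j) * (\<integral>\<^sup>+\<omega>. ennreal ((norm (?T j \<omega>))\<^sup>2) \<partial>lborel))"
    by (rule suminf_cong, rule nn_integral_cmult) measurable
  also have "\<dots> \<le> (\<Sum>j. K * ennreal (?e j))"
  proof (intro suminf_le summableI)
    fix j
    have "ennreal (2 ^ j) * (\<integral>\<^sup>+\<omega>. ennreal ((norm (?T j \<omega>))\<^sup>2) \<partial>lborel) \<le>
        ennreal (2 ^ j) * (K * ennreal (?A ^ j * ?B ^ j / fact j))"
      unfolding K_def by (intro mult_left_mono nn_integral_iter_term_square_le a) simp
    also have "\<dots> = K * (ennreal (2 ^ j) * ennreal (?A ^ j * ?B ^ j / fact j))"
      by (rule mult.left_commute)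
    also have "ennreal (2 ^ j) * ennreal (?A ^ j * ?B ^ j / fact j) = ennreal (?e j)"
      by (subst ennreal_mult'[symmetric]) (simp_all add: power_mult_distrib mult.assoc)
    finally show "ennreal (2 ^ j) * (\<integral>\<^sup>+\<omega>. ennreal ((norm (?T j \<omega>))\<^sup>2) \<partial>lborel) \<le> K * ennreal (?e j)" .
  qed
  also have "\<dots> = K * (\<Sum>j. ennreal (?e j))" by (rule ennreal_suminf_cmult)
  also have "(\<Sum>j. ennreal (?e j)) = ennreal (\<Sum>j. ?e j)" by (rule suminf_ennreal2[OF e0 se])
  finally have "(\<integral>\<^sup>+\<omega>. ennreal ((norm (\<Sum>j. ?T j \<omega>))\<^sup>2) \<partial>lborel) \<le> 2 * (K * ennreal (\<Sum>j. ?e j))"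
    by (simp only: mult_left_mono zero_le)
  also have "\<dots> < \<infinity>" using K_fin by (simp add: ennreal_mult_less_top)
  finally show ?thesis .
qed

section \<open>Simplex integrals as iterated integrals\<close>

text \<open>The product theorems for the simplex integrals need this. The covering for
  \<open>lborel\<close> serves again, since completion does not change the measure of Borel
  sets.\<close>

lemma sigma_finite_lebesgue: "sigma_finite_measure (lebesgue :: 'a::euclidean_space measure)"
proof
  obtain A :: "'a set set" where A: "countable A" "A \<subseteq> sets lborel" "\<Union>A = space lborel"
      "\<forall>B\<in>A. emeasure lborel B \<noteq> \<infinity>"
    using lborel.sigma_finite_countable by blast
  then show "\<exists>A :: 'a set set. countable A \<and> A \<subseteq> sets lebesgue \<and> \<Union>A = space lebesgue \<and> (\<forall>B\<in>A. emeasure lebesgue B \<noteq> \<infinity>)"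
    by (intro exI[of _ A]) (auto simp: subset_eq)
qed

lemma product_sigma_finite_lebesgue:
  "product_sigma_finite (\<lambda>_. lebesgue :: 'a::euclidean_space measure)"
  by (simp add: product_sigma_finite_def sigma_finite_lebesgue)

lemma borel_measurable_PiM_lebesgue_component:
  assumes "i \<in> I"
  shows "(\<lambda>s. s i) \<in> borel_measurable (PiM I (\<lambda>_. lebesgue :: real measure))"
proof -
  have "(\<lambda>x. x) \<in> borel_measurable (lebesgue :: real measure)"
    by (rule measurable_completion) simp
  from measurable_compose[OF measurable_component_singleton[OF assms] this] show ?thesis .
qed

definition simplex_integrand :: "real \<Rightarrow> real \<Rightarrow> (real \<Rightarrow> real) \<Rightarrow> real \<Rightarrow> nat \<Rightarrow> (nat \<Rightarrow> real) \<Rightarrow> complex" where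
  "simplex_integrand c y \<alpha> \<omega> j s = indicator (ordered_simplex c y j) s *\<^sub>R
    (cis (2 * \<omega> * (\<Sum>\<nu>=1..j. (-1) ^ (j - \<nu>) * (s \<nu> - c))) * of_real (\<Prod>\<nu>=1..j. \<alpha> (s \<nu>)))"

lemma harmonic_term_eq_integral:
  "harmonic_term c y \<alpha> \<omega> j = (LINT s|PiM {1..j} (\<lambda>_. lebesgue). simplex_integrand c y \<alpha> \<omega> j s)"
proof -
  have "exp (2 * \<i> * of_real \<omega> * of_real r) = cis (2 * \<omega> * r)" for r
    by (simp add: cis_conv_exp mult_ac)
  then show ?thesis
    by (simp only: harmonic_term_def set_lebesgue_integral_def simplex_integrand_def)
qed

lemma integrable_simplex_integrand:
  assumes \<alpha>: "integrable lebesgue \<alpha>"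
  shows "integrable (PiM {1..j} (\<lambda>_. lebesgue)) (simplex_integrand c y \<alpha> \<omega> j)"
proof (rule Bochner_Integration.integrable_bound)
  interpret product_sigma_finite "\<lambda>_ :: nat. lebesgue :: real measure"
    by (rule product_sigma_finite_lebesgue)
  let ?M = "PiM {1..j} (\<lambda>_. lebesgue :: real measure)"
  show "integrable ?M (\<lambda>s. \<Prod>\<nu>\<in>{1..j}. \<alpha> (s \<nu>))"
    by (rule product_integrable_prod) (use \<alpha> in auto)
  have comp: "(\<lambda>s. s \<nu>) \<in> borel_measurable ?M" if "\<nu> \<in> {1..j}" for \<nu>
    using that by (rule borel_measurable_PiM_lebesgue_component)
  have \<alpha>_comp: "(\<lambda>s. \<alpha> (s \<nu>)) \<in> borel_measurable ?M" if "\<nu> \<in> {1..j}" for \<nu>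
    using measurable_compose[OF measurable_component_singleton[OF that] borel_measurable_integrable[OF \<alpha>]] .
  have mem: "s \<in> ordered_simplex c y j \<longleftrightarrow> (\<forall>\<nu>\<in>{1..j}. c < s \<nu> \<and> s \<nu> < y) \<and>
      (\<forall>\<mu>\<in>{1..j}. \<forall>\<nu>\<in>{1..j}. \<mu> < \<nu> \<longrightarrow> s \<mu> < s \<nu>)" for s
    unfolding ordered_simplex_def mem_Collect_eq image_subset_iff monotone_on_def greaterThanLessThan_iff ..
  have "{s \<in> space ?M. s \<in> ordered_simplex c y j} \<in> sets ?M"
    unfolding mem
  proof (intro sets.sets_Collect_conj sets.sets_Collect_finite_All finite_atLeastAtMost)
    fix \<mu> \<nu> assume "\<mu> \<in> {1..j}" "\<nu> \<in> {1..j}"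
    note [measurable] = comp[OF this(1)] comp[OF this(2)]
    show "{s \<in> space ?M. c < s \<nu>} \<in> sets ?M" by measurable
    show "{s \<in> space ?M. s \<nu> < y} \<in> sets ?M" by measurable
    show "{s \<in> space ?M. \<mu> < \<nu> \<longrightarrow> s \<mu> < s \<nu>} \<in> sets ?M" by measurable
  qed
  then have "(\<lambda>s. indicator (ordered_simplex c y j) s :: real) \<in> borel_measurable ?M"
    by (intro borel_measurable_indicator') (simp add: pred_def)
  moreover have "(\<lambda>s. cis (2 * \<omega> * (\<Sum>\<nu>=1..j. (-1) ^ (j - \<nu>) * (s \<nu> - c)))) \<in> borel_measurable ?M"
    by (intro measurable_compose[OF _ borel_measurable_cis] borel_measurable_times borel_measurable_const
        borel_measurable_sum borel_measurable_diff comp)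
  moreover have "(\<lambda>s. complex_of_real (\<Prod>\<nu>=1..j. \<alpha> (s \<nu>))) \<in> borel_measurable ?M"
    using borel_measurable_prod[of "{1..j}" "\<lambda>\<nu> s. \<alpha> (s \<nu>)" ?M, OF \<alpha>_comp]
    by (rule measurable_compose[OF _ borel_measurable_of_real])
  ultimately show "simplex_integrand c y \<alpha> \<omega> j \<in> borel_measurable ?M"
    unfolding simplex_integrand_def[abs_def] by (intro borel_measurable_scaleR borel_measurable_times)
  show "AE s in ?M. norm (simplex_integrand c y \<alpha> \<omega> j s) \<le> norm (\<Prod>\<nu>\<in>{1..j}. \<alpha> (s \<nu>))"
    by (intro AE_I2) (auto simp: simplex_integrand_def norm_mult indicator_def simp del: of_real_prod)
qed

text \<open>The largest variable u is split off. The others lie in the simplex with upper limit u,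
  and since every exponent \<open>j - \<nu>\<close> grows by one their phase changes sign, which is
  conjugation because \<open>\<alpha>\<close> is real.\<close>

lemma simplex_integrand_merge:
  fixes x s :: "nat \<Rightarrow> real" and j :: nat
  defines "u \<equiv> x (Suc j)"
  shows "simplex_integrand c y \<alpha> \<omega> (Suc j) (merge {Suc j} {1..j} (x, s)) =
    (if c < u \<and> u < y then \<alpha> u *\<^sub>R (cis (2 * \<omega> * (u - c)) * cnj (simplex_integrand c u \<alpha> \<omega> j s)) else 0)"
proof -
  define z where "z = merge {Suc j} {1..j} (x, s)"
  have zu: "z (Suc j) = u" and zs: "\<And>\<nu>. \<nu> \<in> {1..j} \<Longrightarrow> z \<nu> = s \<nu>"
    by (auto simp: z_def u_def merge_def)
  have mem: "z \<in> ordered_simplex c y (Suc j) \<longleftrightarrow> c < u \<and> u < y \<and> s \<in> ordered_simplex c u j"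
  proof -
    have split: "{1..Suc j} = insert (Suc j) {1..j}" by auto
    have img: "z ` {1..Suc j} = insert u (s ` {1..j})"
      unfolding split image_insert zu using zs by (metis image_cong)
    show ?thesis
    proof
      assume L: "z \<in> ordered_simplex c y (Suc j)"
      then have r: "z ` {1..Suc j} \<subseteq> {c<..<y}" and mono: "strict_mono_on {1..Suc j} z"
        by (auto simp: ordered_simplex_def)
      have "s \<nu> < u" if "\<nu> \<in> {1..j}" for \<nu>
        using strict_mono_onD[OF mono, of \<nu> "Suc j"] that zu zs[OF that] by auto
      moreover have "strict_mono_on {1..j} s"
      proof (rule strict_mono_onI)
        fix r t assume "r \<in> {1..j}" "t \<in> {1..j}" "r < t"
        then show "s r < s t" using strict_mono_onD[OF mono, of r t] zs[of r] zs[of t] by auto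
      qed
      ultimately show "c < u \<and> u < y \<and> s \<in> ordered_simplex c u j"
        using r unfolding img by (auto simp: ordered_simplex_def)
    next
      assume R: "c < u \<and> u < y \<and> s \<in> ordered_simplex c u j"
      then have r: "s ` {1..j} \<subseteq> {c<..<u}" and mono: "strict_mono_on {1..j} s"
        by (auto simp: ordered_simplex_def)
      have "strict_mono_on {1..Suc j} z"
      proof (rule strict_mono_onI)
        fix q t assume qt: "q \<in> {1..Suc j}" "t \<in> {1..Suc j}" "q < t"
        then have q: "q \<in> {1..j}" by auto
        show "z q < z t"
        proof (cases "t = Suc j")
          case True
          have "s q \<in> {c<..<u}" using r q by blast
          then show ?thesis using True zs[OF q] zu by auto
        next
          case False
          then have t: "t \<in> {1..j}" using qt by auto
          show ?thesis using strict_mono_onD[OF mono q t] qt zs[OF q] zs[OF t] by simp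
        qed
      qed
      moreover have "z ` {1..Suc j} \<subseteq> {c<..<y}"
        unfolding img using r R by auto
      ultimately show "z \<in> ordered_simplex c y (Suc j)"
        by (simp add: ordered_simplex_def)
    qed
  qed
  have sum: "(\<Sum>\<nu>=1..Suc j. (-1) ^ (Suc j - \<nu>) * (z \<nu> - c)) =
      (u - c) - (\<Sum>\<nu>=1..j. (-1) ^ (j - \<nu>) * (s \<nu> - c))"
  proof -
    have "(\<Sum>\<nu>=1..j. (-1) ^ (Suc j - \<nu>) * (z \<nu> - c)) = (\<Sum>\<nu>=1..j. - ((-1) ^ (j - \<nu>) * (s \<nu> - c)))"
      by (rule sum.cong) (auto simp: zs Suc_diff_le)
    then show ?thesis by (simp add: zu sum_negf)
  qed
  have prod: "(\<Prod>\<nu>=1..Suc j. \<alpha> (z \<nu>)) = \<alpha> u * (\<Prod>\<nu>=1..j. \<alpha> (s \<nu>))"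
    by (simp add: zu zs mult.commute)
  show ?thesis
  proof (cases "z \<in> ordered_simplex c y (Suc j)")
    case False
    then show ?thesis
      unfolding z_def[symmetric] simplex_integrand_def using mem by auto
  next
    case True
    with mem have "c < u" "u < y" "s \<in> ordered_simplex c u j" by auto
    then show ?thesis
      unfolding z_def[symmetric] simplex_integrand_def sum prod using True
      by (simp add: cis_cnj cis_mult scaleR_conv_of_real algebra_simps)
  qed
qed

text \<open>Fubini with the largest variable outside. The induction is over all upper limits at
  once, because the inner simplex ends at that variable.\<close>

lemma harmonic_term_eq_iter_term_lebesgue:
  assumes \<alpha>: "integrable lebesgue \<alpha>" and a: "integrable lborel a"
    and eq: "AE x in lebesgue. \<alpha> x = a x"
  shows "harmonic_term c y \<alpha> \<omega> j = iter_term c a j \<omega> y"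
proof (induction j arbitrary: y)
  case 0
  \<comment> \<open>Without variables the product measure is a point mass and the conditions of the
    simplex are vacuous, so the term is 1.\<close>
  show ?case
    by (simp add: harmonic_term_eq_integral simplex_integrand_def ordered_simplex_def PiM_empty
        lebesgue_integral_count_space_finite)
next
  case (Suc j)
  interpret product_sigma_finite "\<lambda>_ :: nat. lebesgue :: real measure"
    by (rule product_sigma_finite_lebesgue)
  have [measurable]: "a \<in> borel_measurable borel"
    using borel_measurable_integrable[OF a] by simp
  let ?g = "\<lambda>f u. if c < u \<and> u < y then f u *\<^sub>R (cis (2 * \<omega> * (u - c)) * cnj (iter_term c a j \<omega> u)) else 0"
  have g_meas: "?g \<alpha> \<in> borel_measurable lebesgue"
  proof -
    have "(\<lambda>u. if c < u \<and> u < y then cis (2 * \<omega> * (u - c)) * cnj (iter_term c a j \<omega> u) else 0) \<in> borel_measurable lebesgue"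
      by (rule measurable_completion) measurable
    then have "(\<lambda>u. \<alpha> u *\<^sub>R (if c < u \<and> u < y then cis (2 * \<omega> * (u - c)) * cnj (iter_term c a j \<omega> u) else 0)) \<in> borel_measurable lebesgue"
      by (intro borel_measurable_scaleR borel_measurable_integrable[OF \<alpha>])
    also have "(\<lambda>u. \<alpha> u *\<^sub>R (if c < u \<and> u < y then cis (2 * \<omega> * (u - c)) * cnj (iter_term c a j \<omega> u) else 0)) = ?g \<alpha>"
      by auto
    finally show ?thesis .
  qed
  have ga_meas: "?g a \<in> borel_measurable lborel" by measurable
  have split: "{1..Suc j} = {Suc j} \<union> {1..j}" by auto
  have "harmonic_term c y \<alpha> \<omega> (Suc j) =
      (LINT x|PiM {Suc j} (\<lambda>_. lebesgue). LINT s|PiM {1..j} (\<lambda>_. lebesgue).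
        simplex_integrand c y \<alpha> \<omega> (Suc j) (merge {Suc j} {1..j} (x, s)))"
    unfolding harmonic_term_eq_integral
    using integrable_simplex_integrand[OF \<alpha>, of "Suc j" c y \<omega>] unfolding split
    by (intro product_integral_fold) auto
  also have "\<dots> = (LINT x|PiM {Suc j} (\<lambda>_. lebesgue). ?g \<alpha> (x (Suc j)))"
  proof (rule Bochner_Integration.integral_cong[OF refl])
    fix x :: "nat \<Rightarrow> real"
    let ?u = "x (Suc j)"
    have inner: "(LINT s|PiM {1..j} (\<lambda>_. lebesgue). \<alpha> ?u *\<^sub>R (cis (2 * \<omega> * (?u - c)) * cnj (simplex_integrand c ?u \<alpha> \<omega> j s))) =
        \<alpha> ?u *\<^sub>R (cis (2 * \<omega> * (?u - c)) * cnj (iter_term c a j \<omega> ?u))"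
      unfolding Suc.IH[symmetric] harmonic_term_eq_integral Bochner_Integration.integral_cnj[symmetric]
      by (simp only: scaleR_conv_of_real integral_mult_right_zero)
    show "(LINT s|PiM {1..j} (\<lambda>_. lebesgue).
        simplex_integrand c y \<alpha> \<omega> (Suc j) (merge {Suc j} {1..j} (x, s))) = ?g \<alpha> ?u"
    proof (cases "c < ?u \<and> ?u < y")
      case True
      then show ?thesis unfolding simplex_integrand_merge by (simp only: if_True simp_thms inner)
    next
      case False
      then show ?thesis unfolding simplex_integrand_merge
        by (simp only: if_False Bochner_Integration.integral_zero)
    qed
  qed
  also have "\<dots> = (LINT u|lebesgue. ?g \<alpha> u)"
    by (rule product_integral_singleton[OF g_meas])
  \<comment> \<open>\<open>\<alpha>\<close> is exchanged for \<open>a\<close> in one variable at a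
    time, so that no null sets of product spaces have to be considered.\<close>
  also have "\<dots> = (LINT u|lebesgue. ?g a u)"
    using eq by (intro integral_cong_AE g_meas measurable_completion[OF ga_meas]) auto
  also have "\<dots> = (LINT u|lborel. ?g a u)"
    by (rule integral_completion[OF ga_meas])
  also have "\<dots> = iter_term c a (Suc j) \<omega> y"
    by (simp add: prim_def)
  finally show ?case .
qed

text \<open>The extension by zero outside X lets later integrals run over the whole line, and the
  Borel representative lets them be taken with respect to \<open>lborel\<close>.\<close>

definition borel_version :: "real set \<Rightarrow> (real \<Rightarrow> real) \<Rightarrow> (real \<Rightarrow> real) \<Rightarrow> bool" where
  "borel_version X \<alpha> a \<longleftrightarrow> a \<in> borel_measurable borel \<and> (AE x in lebesgue. indicator X x * \<alpha> x = a x)"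

lemma borel_version_exists:
  assumes X: "X \<in> sets lebesgue" and \<alpha>: "\<alpha> \<in> borel_measurable (lebesgue_on X)"
  obtains a where "borel_version X \<alpha> a"
proof -
  have "(\<lambda>x. indicator X x * \<alpha> x) \<in> borel_measurable lebesgue"
    using \<alpha> X by (subst (asm) borel_measurable_restrict_space_iff) (auto simp: mult.commute)
  then obtain a where "a \<in> borel_measurable lborel" "AE x in lborel. indicator X x * \<alpha> x = a x"
    using completion_ex_borel_measurable_real by blast
  then show ?thesis
    by (intro that[of a]) (auto simp: borel_version_def intro: AE_completion)
qed

text \<open>\<open>\<Phi> 0 = 0\<close> ensures that the complement of X contributes nothing. The
  identity, the absolute value and the square are the cases used, for integrability, the
  \<open>L^1\<close> norm and membership in \<open>L^2\<close>.\<close>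

lemma borel_version_integral:
  fixes \<Phi> :: "real \<Rightarrow> real"
  assumes X: "X \<in> sets lebesgue" and \<alpha>: "\<alpha> \<in> borel_measurable (lebesgue_on X)" and a: "borel_version X \<alpha> a"
    and [measurable]: "\<Phi> \<in> borel_measurable borel" and \<Phi>0: "\<Phi> 0 = 0"
  shows "integrable lborel (\<lambda>x. \<Phi> (a x)) \<longleftrightarrow> integrable (lebesgue_on X) (\<lambda>x. \<Phi> (\<alpha> x))"
    and "(LINT x|lborel. \<Phi> (a x)) = (LINT x|lebesgue_on X. \<Phi> (\<alpha> x))"
proof -
  have [measurable]: "a \<in> borel_measurable borel" and eq: "AE x in lebesgue. indicator X x * \<alpha> x = a x"
    using a by (auto simp: borel_version_def)
  have eq': "AE x in lebesgue. indicator X x *\<^sub>R \<Phi> (\<alpha> x) = \<Phi> (a x)"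
    using eq by eventually_elim (auto simp: indicator_def \<Phi>0 split: if_splits)
  have m1: "(\<lambda>x. indicator X x *\<^sub>R \<Phi> (\<alpha> x)) \<in> borel_measurable lebesgue"
    using measurable_compose[OF \<alpha> \<open>\<Phi> \<in> _\<close>] X
    by (subst (asm) borel_measurable_restrict_space_iff) auto
  have m2: "(\<lambda>x. \<Phi> (a x)) \<in> borel_measurable lborel" by measurable
  have X': "X \<inter> space lebesgue \<in> sets lebesgue" using X by simp
  show "integrable lborel (\<lambda>x. \<Phi> (a x)) \<longleftrightarrow> integrable (lebesgue_on X) (\<lambda>x. \<Phi> (\<alpha> x))"
    unfolding integrable_restrict_space[OF X'] integrable_completion[OF m2, symmetric]
    by (rule integrable_cong_AE[OF measurable_completion[OF m2] m1]) (use eq' in \<open>auto elim: eventually_mono\<close>)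
  show "(LINT x|lborel. \<Phi> (a x)) = (LINT x|lebesgue_on X. \<Phi> (\<alpha> x))"
    unfolding integral_restrict_space[OF X'] integral_completion[OF m2, symmetric]
    by (rule integral_cong_AE[OF measurable_completion[OF m2] m1]) (use eq' in \<open>auto elim: eventually_mono\<close>)
qed

lemma borel_version_diff:
  assumes "borel_version X \<alpha> a" "borel_version X \<beta> b"
  shows "borel_version X (\<lambda>x. \<beta> x - \<alpha> x) (\<lambda>x. b x - a x)"
proof -
  have "AE x in lebesgue. indicator X x * (\<beta> x - \<alpha> x) = b x - a x"
    using assms unfolding borel_version_def by (auto simp: right_diff_distrib elim!: eventually_elim2)
  then show ?thesis using assms by (auto simp: borel_version_def)
qed

lemma harmonic_exp_eq:
  assumes \<alpha>: "integrable (lebesgue_on {c<..<x1}) \<alpha>" and a: "borel_version {c<..<x1} \<alpha> a" and y: "y \<le> x1"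
  shows "harmonic_exp c y \<alpha> \<omega> = 1 + (\<Sum>j. iter_term c a (Suc j) \<omega> y)"
proof -
  let ?X = "{c<..<x1}" and ?\<alpha> = "\<lambda>x. indicator {c<..<x1} x * \<alpha> x"
  have ia: "integrable lborel a"
    using borel_version_integral(1)[OF _ borel_measurable_integrable[OF \<alpha>] a, of "\<lambda>x. x"] \<alpha> by simp
  have i\<alpha>: "integrable lebesgue ?\<alpha>"
    using \<alpha> by (subst (asm) integrable_restrict_space) auto
  \<comment> \<open>All coordinates of a point of the simplex lie in the interval, since
    \<open>y \<le> x1\<close>, so the extension by zero leaves the integrand unchanged.\<close>
  have "harmonic_term c y \<alpha> \<omega> j = harmonic_term c y ?\<alpha> \<omega> j" for j
  proof -
    have "simplex_integrand c y \<alpha> \<omega> j = simplex_integrand c y ?\<alpha> \<omega> j"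
    proof
      fix s
      show "simplex_integrand c y \<alpha> \<omega> j s = simplex_integrand c y ?\<alpha> \<omega> j s"
      proof (cases "s \<in> ordered_simplex c y j")
        case True
        then have "s \<nu> \<in> ?X" if "\<nu> \<in> {1..j}" for \<nu>
          using that y by (fastforce simp: ordered_simplex_def)
        then have "(\<Prod>\<nu>=1..j. \<alpha> (s \<nu>)) = (\<Prod>\<nu>=1..j. ?\<alpha> (s \<nu>))"
          by (intro prod.cong) auto
        then show ?thesis by (simp only: simplex_integrand_def)
      qed (simp add: simplex_integrand_def)
    qed
    then show ?thesis unfolding harmonic_term_eq_integral by simp
  qed
  then show ?thesis
    unfolding harmonic_exp_def
    using harmonic_term_eq_iter_term_lebesgue[OF i\<alpha> ia] a by (simp add: borel_version_def)
qed

theorem proposition3p8: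
  fixes x0 x1 y :: real
  assumes "x0 < x1" and "x0 < y" and "y \<le> x1"
  defines "X \<equiv> lebesgue_on {x0<..<x1}"
  defines "E \<equiv> harmonic_exp x0 y"
  shows
    "(\<forall>\<alpha>. integrable X \<alpha> \<longrightarrow> E \<alpha> \<in> Linf lebesgue \<and> smooth (E \<alpha>)) \<and>
     (\<forall>\<alpha>. integrable X \<alpha> \<longrightarrow>
        (\<forall>\<epsilon>>0. \<exists>\<delta>>0. \<forall>\<beta>. integrable X \<beta> \<and> L1_norm X (\<lambda>x. \<beta> x - \<alpha> x) < \<delta> \<longrightarrow>
           Linf_norm lebesgue (\<lambda>\<omega>. E \<beta> \<omega> - E \<alpha> \<omega>) < ereal \<epsilon>)) \<and>
     (\<forall>\<alpha> \<omega>. integrable X \<alpha> \<longrightarrow> norm (E \<alpha> \<omega>) \<le> exp (L1_norm X \<alpha>)) \<and>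
     (\<forall>\<alpha> h. integrable X \<alpha> \<and> h = (\<lambda>\<omega>. E \<alpha> \<omega> - 1) \<longrightarrow>
        dist_supp (dist_inv_fourier (regular_dist h)) \<subseteq> {0..2 * (y - x0)} \<and>
        dist_in_L1 (dist_inv_fourier (regular_dist h)) \<and>
        (h \<longlongrightarrow> 0) at_infinity \<and>
        (\<alpha> \<in> L2 X \<longrightarrow> h \<in> L2 lebesgue))"
proof -
  let ?I = "{x0<..<x1}"
  define G where "G a t = complex_of_real (total_density x0 a y t)" for a t
  \<comment> \<open>Both forms of \<open>E\<close> are recorded: the series serves the uniform
    estimates and square integrability, the transform serves smoothness, decay and the
    support.\<close>
  have ver: "\<exists>a. borel_version ?I \<alpha> a \<and> integrable lborel a \<and> L1_norm X \<alpha> = (LINT x|lborel. \<bar>a x\<bar>) \<and>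
      (\<forall>\<omega>. E \<alpha> \<omega> = 1 + (\<Sum>j. iter_term x0 a (Suc j) \<omega> y)) \<and> (\<forall>\<omega>. E \<alpha> \<omega> = 1 + fourier (G a) \<omega>)"
    if \<alpha>: "integrable X \<alpha>" for \<alpha>
  proof -
    have m: "\<alpha> \<in> borel_measurable (lebesgue_on ?I)"
      using \<alpha> unfolding X_def by (rule borel_measurable_integrable)
    obtain a where a: "borel_version ?I \<alpha> a"
      using borel_version_exists[OF _ m] by auto
    have ia: "integrable lborel a"
      using borel_version_integral(1)[OF _ m a, of "\<lambda>x. x"] \<alpha> by (simp add: X_def)
    have E: "E \<alpha> \<omega> = 1 + (\<Sum>j. iter_term x0 a (Suc j) \<omega> y)" for \<omega>
      unfolding E_def using \<alpha> a assms(3) unfolding X_def by (intro harmonic_exp_eq)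
    moreover have "E \<alpha> \<omega> = 1 + fourier (G a) \<omega>" for \<omega>
      unfolding E suminf_iter_term_eq_fourier[OF ia] G_def ..
    moreover have "L1_norm X \<alpha> = (LINT x|lborel. \<bar>a x\<bar>)"
      using borel_version_integral(2)[OF _ m a, of abs] by (simp add: X_def L1_norm_def)
    ultimately show ?thesis using a ia by blast
  qed
  have G_int: "integrable lborel (G a)" if "integrable lborel a" for a
    unfolding G_def by (intro integrable_of_real integrable_total_density that)
  have G_supp: "0 < t \<and> t < 2 * (y - x0)" if "G a t \<noteq> 0" for a t
    using that total_density_support[of x0 a y t] by (simp add: G_def)
  have E_meas: "E \<alpha> \<in> borel_measurable borel" if \<alpha>: "integrable X \<alpha>" for \<alpha>
  proof -
    obtain a where "integrable lborel a" and E: "\<forall>\<omega>. E \<alpha> \<omega> = 1 + fourier (G a) \<omega>"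
      using ver[OF \<alpha>] by blast
    then have [measurable]: "G a \<in> borel_measurable borel"
      using borel_measurable_integrable[OF G_int] by simp
    have "E \<alpha> = (\<lambda>\<omega>. 1 + fourier (G a) \<omega>)" using E by blast
    also have "\<dots> \<in> borel_measurable borel" by measurable
    finally show ?thesis .
  qed
  have bound: "norm (E \<alpha> \<omega>) \<le> exp (L1_norm X \<alpha>)" if \<alpha>: "integrable X \<alpha>" for \<alpha> \<omega>
  proof -
    obtain a where ia: "integrable lborel a" and L: "L1_norm X \<alpha> = (LINT x|lborel. \<bar>a x\<bar>)"
      and E: "\<forall>\<omega>. E \<alpha> \<omega> = 1 + (\<Sum>j. iter_term x0 a (Suc j) \<omega> y)"
      using ver[OF \<alpha>] by blast
    show ?thesis
      unfolding L E[rule_format] by (rule norm_suminf_iter_term_le[OF ia])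
  qed
  have Linf_le: "Linf_norm lebesgue f \<le> ereal c"
    if "f \<in> borel_measurable borel" "\<And>\<omega>. norm (f \<omega>) \<le> c" for f :: "real \<Rightarrow> complex" and c
  proof -
    note [measurable] = that(1)
    have "(\<lambda>x. ereal (norm (f x))) \<in> borel_measurable lebesgue"
      by (rule measurable_completion) measurable
    then show ?thesis
      unfolding Linf_norm_def using that(2) by (intro esssup_I) auto
  qed

  have regular: "E \<alpha> \<in> Linf lebesgue \<and> smooth (E \<alpha>)" if \<alpha>: "integrable X \<alpha>" for \<alpha>
  proof
    have "Linf_norm lebesgue (E \<alpha>) \<le> ereal (exp (L1_norm X \<alpha>))"
      by (rule Linf_le[OF E_meas[OF \<alpha>] bound[OF \<alpha>]])
    then have "Linf_norm lebesgue (E \<alpha>) < \<infinity>"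
      by (rule le_less_trans) simp
    moreover have "E \<alpha> \<in> borel_measurable lebesgue"
      by (rule measurable_completion) (simp add: E_meas[OF \<alpha>])
    ultimately show "E \<alpha> \<in> Linf lebesgue" by (simp add: Linf_def)
    obtain a where ia: "integrable lborel a" and E: "\<forall>\<omega>. E \<alpha> \<omega> = 1 + fourier (G a) \<omega>"
      using ver[OF \<alpha>] by blast
    have "smooth (fourier (G a))"
    proof (rule smooth_fourier[OF G_int[OF ia]])
      show "\<bar>t\<bar> \<le> 2 * (y - x0)" if "G a t \<noteq> 0" for t
        using G_supp[OF that] by simp
    qed
    then have "smooth (\<lambda>\<omega>. 1 + fourier (G a) \<omega>)" by (rule smooth_add_const)
    also have "(\<lambda>\<omega>. 1 + fourier (G a) \<omega>) = E \<alpha>" using E by auto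
    finally show "smooth (E \<alpha>)" .
  qed

  have continuous: "\<exists>\<delta>>0. \<forall>\<beta>. integrable X \<beta> \<and> L1_norm X (\<lambda>x. \<beta> x - \<alpha> x) < \<delta> \<longrightarrow>
      Linf_norm lebesgue (\<lambda>\<omega>. E \<beta> \<omega> - E \<alpha> \<omega>) < ereal \<epsilon>"
    if \<alpha>: "integrable X \<alpha>" and \<epsilon>: "\<epsilon> > 0" for \<alpha> \<epsilon>
  proof -
    obtain a where ia: "integrable lborel a" and va: "borel_version ?I \<alpha> a"
      and Ea: "\<forall>\<omega>. E \<alpha> \<omega> = 1 + (\<Sum>j. iter_term x0 a (Suc j) \<omega> y)"
      using ver[OF \<alpha>] by blast
    let ?A = "LINT x|lborel. \<bar>a x\<bar>"
    \<comment> \<open>For \<open>\<beta>\<close> at distance less than 1 from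
      \<open>\<alpha>\<close>, the two norms add up to at most \<open>2 * ?A + 1\<close>, which
      makes the Lipschitz constant uniform.\<close>
    define C where "C = exp (2 * (2 * ?A + 1))"
    have C: "0 < C" by (simp add: C_def)
    define \<delta> where "\<delta> = min 1 (\<epsilon> / (2 * C))"
    have "Linf_norm lebesgue (\<lambda>\<omega>. E \<beta> \<omega> - E \<alpha> \<omega>) < ereal \<epsilon>"
      if \<beta>: "integrable X \<beta>" and close: "L1_norm X (\<lambda>x. \<beta> x - \<alpha> x) < \<delta>" for \<beta>
    proof -
      obtain b where ib: "integrable lborel b" and vb: "borel_version ?I \<beta> b"
        and Eb: "\<forall>\<omega>. E \<beta> \<omega> = 1 + (\<Sum>j. iter_term x0 b (Suc j) \<omega> y)"
        using ver[OF \<beta>] by blast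
      let ?D = "LINT x|lborel. \<bar>b x - a x\<bar>"
      have "(\<lambda>x. \<beta> x - \<alpha> x) \<in> borel_measurable (lebesgue_on ?I)"
        using \<alpha> \<beta> unfolding X_def by (intro borel_measurable_diff borel_measurable_integrable)
      from borel_version_integral(2)[OF _ this borel_version_diff[OF va vb], of abs]
      have D: "?D < \<delta>" using close by (simp add: X_def L1_norm_def)
      have "(LINT x|lborel. \<bar>a x\<bar> + \<bar>b x\<bar>) \<le> (LINT x|lborel. 2 * \<bar>a x\<bar> + \<bar>b x - a x\<bar>)"
        using ia ib by (intro integral_mono) auto
      also have "\<dots> = 2 * ?A + ?D" using ia ib by simp
      also have "\<dots> \<le> 2 * ?A + 1" using D by (simp add: \<delta>_def)
      finally have "exp (2 * (LINT x|lborel. \<bar>a x\<bar> + \<bar>b x\<bar>)) \<le> C" by (simp add: C_def)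
      moreover have "?D \<le> \<epsilon> / (2 * C)" using D by (simp add: \<delta>_def)
      ultimately have "?D * exp (2 * (LINT x|lborel. \<bar>a x\<bar> + \<bar>b x\<bar>)) \<le> \<epsilon> / (2 * C) * C"
        using C \<epsilon> by (intro mult_mono) auto
      also have "\<dots> = \<epsilon> / 2" using C by simp
      finally have "norm (E \<beta> \<omega> - E \<alpha> \<omega>) \<le> \<epsilon> / 2" for \<omega>
        using norm_suminf_iter_term_diff_le[OF ia ib, of x0 \<omega> y]
        unfolding Ea[rule_format] Eb[rule_format] by (simp only: add_diff_cancel_left)
      \<comment> \<open>The margin \<open>\<epsilon> / 2\<close> is there because a pointwise bound
        passes to the essential supremum only as a non-strict inequality.\<close>
      then have "Linf_norm lebesgue (\<lambda>\<omega>. E \<beta> \<omega> - E \<alpha> \<omega>) \<le> ereal (\<epsilon> / 2)"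
        by (intro Linf_le borel_measurable_diff E_meas \<alpha> \<beta>)
      also have "\<dots> < ereal \<epsilon>" using \<epsilon> by simp
      finally show ?thesis .
    qed
    moreover have "\<delta> > 0" using \<epsilon> C by (simp add: \<delta>_def)
    ultimately show ?thesis by blast
  qed

  have transform: "dist_supp (dist_inv_fourier (regular_dist h)) \<subseteq> {0..2 * (y - x0)} \<and>
      dist_in_L1 (dist_inv_fourier (regular_dist h)) \<and> (h \<longlongrightarrow> 0) at_infinity \<and>
      (\<alpha> \<in> L2 X \<longrightarrow> h \<in> L2 lebesgue)"
    if \<alpha>: "integrable X \<alpha>" and h: "h = (\<lambda>\<omega>. E \<alpha> \<omega> - 1)" for \<alpha> h
  proof -
    obtain a where ia: "integrable lborel a" and va: "borel_version ?I \<alpha> a"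
      and Ea: "\<forall>\<omega>. E \<alpha> \<omega> = 1 + (\<Sum>j. iter_term x0 a (Suc j) \<omega> y)"
      and EG: "\<forall>\<omega>. E \<alpha> \<omega> = 1 + fourier (G a) \<omega>"
      using ver[OF \<alpha>] by blast
    have hG: "h = fourier (G a)" unfolding h using EG by auto
    note iG = G_int[OF ia]
    have [measurable]: "G a \<in> borel_measurable borel"
      using borel_measurable_integrable[OF iG] by simp
    have pairing: "dist_inv_fourier (regular_dist h) \<phi> = (LINT t|lborel. G a t * \<phi> t)" if "schwartz \<phi>" for \<phi>
      unfolding hG by (rule dist_inv_fourier_regular_dist_fourier[OF iG that])
    have supp: "dist_supp (dist_inv_fourier (regular_dist h)) \<subseteq> {0..2 * (y - x0)}"
    proof (rule ccontr)
      assume "\<not> ?thesis"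
      then obtain t where t: "t \<in> dist_supp (dist_inv_fourier (regular_dist h))" "t \<notin> {0..2 * (y - x0)}"
        by blast
      \<comment> \<open>The complement of the closed interval itself serves as the neighbourhood of
        t; its test functions vanish wherever \<open>G a\<close> does not.\<close>
      have "open (- {0..2 * (y - x0)})" by (intro open_Compl closed_atLeastAtMost)
      with t obtain \<phi> where \<phi>: "test_function_on (- {0..2 * (y - x0)}) \<phi>"
        and ne: "dist_inv_fourier (regular_dist h) \<phi> \<noteq> 0"
        unfolding dist_supp_def by blast
      have zero: "G a s * \<phi> s = 0" for s
      proof (cases "G a s = 0")
        case False
        then have "s \<in> {0..2 * (y - x0)}" using G_supp[of a s] by auto
        then have "\<phi> s = 0"
          using \<phi> closure_subset[of "{x. \<phi> x \<noteq> 0}"] unfolding test_function_on_def by blast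
        then show ?thesis by simp
      qed simp
      have "(LINT s|lborel. G a s * \<phi> s) = 0"
        unfolding zero by (rule Bochner_Integration.integral_zero)
      then show False
        using ne pairing[OF test_function_on_imp_schwartz[OF \<phi>]] by simp
    qed
    have L1: "dist_in_L1 (dist_inv_fourier (regular_dist h))"
      unfolding dist_in_L1_def
    proof (intro exI[of _ "G a"] conjI allI impI)
      show "integrable lebesgue (G a)"
        using iG by (subst integrable_completion) auto
      fix \<phi> assume \<phi>: "schwartz \<phi>"
      then have "continuous_on UNIV \<phi>"
        using continuous_on_nth_deriv[of \<phi> 0] by (simp add: schwartz_def nth_deriv_def)
      then have [measurable]: "\<phi> \<in> borel_measurable borel"
        by (rule borel_measurable_continuous_onI)
      have "(\<lambda>t. G a t * \<phi> t) \<in> borel_measurable lborel" by measurable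
      then show "dist_inv_fourier (regular_dist h) \<phi> = regular_dist (G a) \<phi>"
        unfolding pairing[OF \<phi>] regular_dist_def by (rule integral_completion[symmetric])
    qed
    have vanish: "(h \<longlongrightarrow> 0) at_infinity"
      unfolding hG by (rule riemann_lebesgue[OF iG])
    have L2: "h \<in> L2 lebesgue" if "\<alpha> \<in> L2 X"
    proof -
      have m: "\<alpha> \<in> borel_measurable (lebesgue_on ?I)" and i2: "integrable (lebesgue_on ?I) (\<lambda>x. (\<alpha> x)\<^sup>2)"
        using that by (auto simp: L2_def X_def)
      have "integrable lborel (\<lambda>x. (a x)\<^sup>2)"
        using borel_version_integral(1)[OF _ m va, of "\<lambda>x. x\<^sup>2"] i2 by simp
      from nn_integral_suminf_iter_term_square_finite[OF ia this, of x0 y]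
      have "(\<integral>\<^sup>+\<omega>. ennreal ((norm (h \<omega>))\<^sup>2) \<partial>lborel) < \<infinity>"
        unfolding h Ea[rule_format] by (simp only: add_diff_cancel_left')
      moreover have [measurable]: "h \<in> borel_measurable borel" unfolding hG by measurable
      ultimately have "integrable lborel (\<lambda>\<omega>. (norm (h \<omega>))\<^sup>2)"
        by (intro integrableI_bounded) auto
      then have "integrable lebesgue (\<lambda>\<omega>. (norm (h \<omega>))\<^sup>2)"
        by (subst integrable_completion) auto
      moreover have "h \<in> borel_measurable lebesgue"
        by (rule measurable_completion) simp
      ultimately show ?thesis by (simp add: L2_def)
    qed
    show ?thesis using supp L1 vanish L2 by blast
  qed
  show ?thesis
  proof (rule conjI[OF _ conjI[OF _ conjI]]; intro allI impI)
    show "E \<alpha> \<in> Linf lebesgue \<and> smooth (E \<alpha>)" if "integrable X \<alpha>" for \<alpha>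
      using that by (rule regular)
    show "\<exists>\<delta>>0. \<forall>\<beta>. integrable X \<beta> \<and> L1_norm X (\<lambda>x. \<beta> x - \<alpha> x) < \<delta> \<longrightarrow>
        Linf_norm lebesgue (\<lambda>\<omega>. E \<beta> \<omega> - E \<alpha> \<omega>) < ereal \<epsilon>"
      if "integrable X \<alpha>" "0 < \<epsilon>" for \<alpha> \<epsilon>
      using that by (rule continuous)
    show "norm (E \<alpha> \<omega>) \<le> exp (L1_norm X \<alpha>)" if "integrable X \<alpha>" for \<alpha> \<omega>
      using that by (rule bound)
    show "dist_supp (dist_inv_fourier (regular_dist h)) \<subseteq> {0..2 * (y - x0)} \<and>
        dist_in_L1 (dist_inv_fourier (regular_dist h)) \<and> (h \<longlongrightarrow> 0) at_infinity \<and>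
        (\<alpha> \<in> L2 X \<longrightarrow> h \<in> L2 lebesgue)"
      if "integrable X \<alpha> \<and> h = (\<lambda>\<omega>. E \<alpha> \<omega> - 1)" for \<alpha> h
      using that by (elim conjE) (rule transform)
  qed
qed

end
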